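(* Let $D$ be an (oriented) knot diagram with ordered crossings and with a basepoint away from the crossings, let $G$ be its ordered signed Tait graph, let $w$ be the writhe of $D$ and let $k=E_+(G)-E_-(G)+2(V(G)-1)$. Then there exists a differential $\partial$ of bidegree $(-1,-1)$ on the bigraded group $\mathcal{C}(D)=\bigoplus_{u,v}\mathcal{C}^u_v(D)$ generated by the spanning trees of $G$ (that is, $\partial:\mathcal{C}^u_v(D)\to\mathcal{C}^{u-1}_{v-1}(D)$) such that the spanning tree complex $\{\mathcal{C}^u_v(D),\partial\}$ is a deformation retract of the reduced Khovanov complex $\widetilde{C}(D)$. In particular, $$\widetilde{H}^{i,j}(D;\mathbb{Z})\cong H^u_v(\mathcal{C}(D);\mathbb{Z}),\qquad u=j-i-w+1,\quad v=\frac{j}{2}-i-\frac{w-k-2}{4}.$$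
   Context: **Tait graph.** A connected link diagram $D$ is checkerboard colored; its Tait graph $G$ is the planar graph with one vertex per shaded region and one edge per crossing. An edge is positive if the $A$-smoothing of its crossing joins the shaded regions, and negative otherwise. $V(G)$ is the number of vertices, $E_\pm(G)$ the number of positive/negative edges. The coloring is chosen so that $E_+(G)\ge E_-(G)$. An order on the crossings gives an order on the edges. **Activities.** Let $T$ be a spanning tree of $G$. For $e\in T$, $cut(T,e)$ is the set of edges of $G$ connecting the two components of $T\setminus e$ (including $e$); for $f\notin T$, $cyc(T,f)$ is the set of edges of the unique cycle in $T\cup f$. An edge $e\in T$ is internally active (live) if it is the lowest edge of $cut(T,e)$, else internally inactive (dead); an edge $e\notin T$ is externally active (live) if it is the lowest edge of $cyc(T,e)$, else externally inactive (dead). Write $L,D,\ell,d$ for a positive edge that is respectively internally active, internally inactive, externally active, externally inactive, and $\bar L,\bar D,\bar\ell,\bar d$ for the same activities of a negative edge. **Spanning tree groups.** For a spanning tree $T$ set $u(T)=\#L-\#\ell-\#\bar L+\#\bar\ell$ and $v(T)=\#L+\#D$ (the number of positive edges in $T$), counting edges of $G$ by activity with respect to $T$. $\mathcal{C}^u_v(D)$ is the free abelian group on the spanning trees $T$ with $u(T)=u$, $v(T)=v$. **Reduced Khovanov complex (Viro's conventions).** An enhanced state of $D$ is a choice of $A$- or $B$-smoothing at each crossing together with a sign $\pm$ on each resulting circle. Let $\sigma=\#A-\#B$ (smoothings), $\tau=\#(+)-\#(-)$ (circles), $i=(w-\sigma)/2$, $j=i+w-\tau$. The Khovanov complex $C^{i,j}(D)$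 is free abelian on enhanced states of degree $(i,j)$. Its differential has bidegree $(1,0)$: it is the sum, with the standard signs, over all ways of changing one $A$-smoothing to a $B$-smoothing, with merging of circles given by $(-,-)\mapsto -$, $(+,-),(-,+)\mapsto +$, $(+,+)\mapsto 0$ and splitting given by $+\mapsto(+,+)$, $-\mapsto(+,-)+(-,+)$. The reduced complex $\widetilde{C}(D)$ is the subcomplex generated by the enhanced states in which the circle through the basepoint has sign $+$; its homology is $\widetilde H^{i,j}(D)$. Thus for the round unknot $\widetilde{H}=\mathbb{Z}$ in degree $(0,-1)$. **Deformation retract.** A chain complex $X$ is a deformation retract of $Y$ if there are chain maps $r:Y\to X$, $f:X\to Y$ with $r\circ f=\mathrm{id}_X$ and a chain homotopy $F:Y\to Y$ with $\partial_YF+F\partial_Y=\mathrm{id}_Y-f\circ r$. Here the bigradings $(i,j)$ and $(u,v)$ are matched by the formulas in the claim. *)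

theory Defs
  imports Complex_Main "HOL-Library.Product_Plus" "HOL-Algebra.Free_Abelian_Groups"
begin

section \<open>Graded complexes of abelian groups and deformation retracts\<close>

text \<open>
  A complex is a family of abelian groups \<open>X p\<close> indexed by an abelian group of degrees, with
  a differential of degree \<open>s\<close>, i.e. homomorphisms \<open>d p : X p \<rightarrow> X (p + s)\<close>.
\<close>

definition chain_complex ::
    "'p::ab_group_add \<Rightarrow> ('p \<Rightarrow> 'a monoid) \<Rightarrow> ('p \<Rightarrow> 'a \<Rightarrow> 'a) \<Rightarrow> bool" where
  "chain_complex s X d \<longleftrightarrow>
     (\<forall>p. comm_group (X p) \<and> d p \<in> hom (X p) (X (p + s)) \<and>
          (\<forall>x \<in> carrier (X p). d (p + s) (d p x) = \<one>\<^bsub>X (p + s + s)\<^esub>))"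

definition homology ::
    "'p::ab_group_add \<Rightarrow> ('p \<Rightarrow> 'a monoid) \<Rightarrow> ('p \<Rightarrow> 'a \<Rightarrow> 'a) \<Rightarrow> 'p \<Rightarrow> 'a set monoid" where
  "homology s X d p =
     subgroup_generated (X p) (kernel (X p) (X (p + s)) (d p)) Mod (d (p - s) ` carrier (X (p - s)))"

text \<open>
  The complex \<open>X\<close> is a deformation retract of the complex \<open>Y\<close>, where the degrees of the two
  complexes are matched by \<open>\<phi>\<close>: degree \<open>p\<close> of \<open>Y\<close> corresponds to degree \<open>\<phi> p\<close> of \<open>X\<close>.
\<close>

definition deformation_retract ::
    "('p::ab_group_add \<Rightarrow> 'q::ab_group_add) \<Rightarrow>
     'q \<Rightarrow> ('q \<Rightarrow> 'a monoid) \<Rightarrow> ('q \<Rightarrow> 'a \<Rightarrow> 'a) \<Rightarrow>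
     'p \<Rightarrow> ('p \<Rightarrow> 'b monoid) \<Rightarrow> ('p \<Rightarrow> 'b \<Rightarrow> 'b) \<Rightarrow> bool" where
  "deformation_retract \<phi> s X dX t Y dY \<longleftrightarrow>
     chain_complex s X dX \<and> chain_complex t Y dY \<and> (\<forall>p. \<phi> (p + t) = \<phi> p + s) \<and>
     (\<exists>r f F.
        (\<forall>p. r p \<in> hom (Y p) (X (\<phi> p)) \<and>
             (\<forall>y \<in> carrier (Y p). r (p + t) (dY p y) = dX (\<phi> p) (r p y))) \<and>
        (\<forall>p. f p \<in> hom (X (\<phi> p)) (Y p) \<and>
             (\<forall>x \<in> carrier (X (\<phi> p)). f (p + t) (dX (\<phi> p) x) = dY p (f p x))) \<and>
        (\<forall>p. \<forall>x \<in> carrier (X (\<phi> p)). r p (f p x) = x) \<and>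
        (\<forall>p. F p \<in> hom (Y p) (Y (p - t)) \<and>
             (\<forall>y \<in> carrier (Y p).
                dY (p - t) (F p y) \<otimes>\<^bsub>Y p\<^esub> F (p + t) (dY p y) = y \<otimes>\<^bsub>Y p\<^esub> inv\<^bsub>Y p\<^esub> f p (r p y))))"


section \<open>Oriented knot diagrams with ordered crossings and a basepoint\<close>

text \<open>
  A diagram is given by its signed Gauss code. The crossings are \<open>0, \<dots>, n - 1\<close>, in their
  given order. Traversing the knot once from the basepoint, in the direction of the orientation,
  one meets \<open>2 n\<close> crossing passages, numbered \<open>0, \<dots>, 2 n - 1\<close>; crossing \<open>c\<close> is passed on
  the lower strand at time \<open>under_time K c\<close> and on the upper strand at time \<open>over_time K c\<close>.
  Arc \<open>t\<close> ends at passage \<open>t\<close> and arc \<open>t + 1\<close> (modulo \<open>2 n\<close>) leaves it, so the basepoint is on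
  arc \<open>0\<close>. For \<open>n = 0\<close> the diagram is a round circle, which is the single arc \<open>0\<close>.
\<close>

record knot_code =
  crossings :: nat
  under_time :: "nat \<Rightarrow> nat"
  over_time :: "nat \<Rightarrow> nat"
  pos_crossing :: "nat \<Rightarrow> bool"

definition arcs :: "knot_code \<Rightarrow> nat set" where
  "arcs K = {..<max 1 (2 * crossings K)}"

definition next_arc :: "knot_code \<Rightarrow> nat \<Rightarrow> nat" where
  "next_arc K t = Suc t mod (2 * crossings K)"

text \<open>
  The four arc ends at a crossing are numbered counterclockwise by \<open>0, 1, 2, 3\<close>, starting from
  the incoming lower strand (as in a planar diagram code). Thus \<open>0, 2\<close> are on the lower and \<open>1, 3\<close>
  on the upper strand; at a positive crossing the upper strand runs from \<open>3\<close> to \<open>1\<close>, at a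
  negative crossing from \<open>1\<close> to \<open>3\<close>.
\<close>

definition arc_at :: "knot_code \<Rightarrow> nat \<Rightarrow> nat \<Rightarrow> nat" where
  "arc_at K c q =
     (if q = 0 then under_time K c
      else if q = 2 then next_arc K (under_time K c)
      else if (q = 1) = pos_crossing K c then next_arc K (over_time K c)
      else over_time K c)"

definition outgoing :: "knot_code \<Rightarrow> nat \<Rightarrow> nat \<Rightarrow> bool" where
  "outgoing K c q \<longleftrightarrow> q = 2 \<or> q = (if pos_crossing K c then 1 else 3)"

definition generated_classes :: "'a set \<Rightarrow> ('a \<times> 'a) set \<Rightarrow> 'a set set" where
  "generated_classes V R = V // (R \<union> R\<inverse>)\<^sup>*"

text \<open>
  A region of the complement is represented by the set of arc sides that lie on its boundary; the
  side \<open>(a, True)\<close> is the left one and \<open>(a, False)\<close> the right one with respect to the orientation.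
  Corner \<open>q\<close> of a crossing lies between the arc ends \<open>q\<close> and \<open>q + 1\<close> (modulo 4). Looking outward
  from the crossing, it is to the left of the former and to the right of the latter, so the
  corresponding two arc sides belong to the same region.
\<close>

type_synonym region = "(nat \<times> bool) set"

definition corner_relation :: "knot_code \<Rightarrow> ((nat \<times> bool) \<times> (nat \<times> bool)) set" where
  "corner_relation K =
     {((arc_at K c q, outgoing K c q),
       (arc_at K c ((q + 1) mod 4), \<not> outgoing K c ((q + 1) mod 4))) | c q. c < crossings K \<and> q < 4}"

definition regions :: "knot_code \<Rightarrow> region set" where
  "regions K = generated_classes (arcs K \<times> UNIV) (corner_relation K)"

definition region_of_side :: "knot_code \<Rightarrow> nat \<times> bool \<Rightarrow> region" where
  "region_of_side K x = (THE R. R \<in> regions K \<and> x \<in> R)"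

definition region_at :: "knot_code \<Rightarrow> nat \<Rightarrow> nat \<Rightarrow> region" where
  "region_at K c q = region_of_side K (arc_at K c q, outgoing K c q)"

text \<open>
  A Gauss code is realised by a diagram in the sphere iff its ribbon surface has genus zero. The
  underlying connected 4-valent graph has \<open>n\<close> vertices and \<open>2 n\<close> edges, so by Euler's formula this
  means that there are \<open>n + 2\<close> regions (this is also right for \<open>n = 0\<close>).
\<close>

definition knot_diagram :: "knot_code \<Rightarrow> bool" where
  "knot_diagram K \<longleftrightarrow>
     bij_betw (case_sum (under_time K) (over_time K))
       ({..<crossings K} <+> {..<crossings K}) {..<2 * crossings K} \<and>
     card (regions K) = crossings K + 2"

definition writhe :: "knot_code \<Rightarrow> int" where
  "writhe K = int (card {c. c < crossings K \<and> pos_crossing K c})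
            - int (card {c. c < crossings K \<and> \<not> pos_crossing K c})"


section \<open>Signed graphs and activities\<close>

text \<open>
  Undirected multigraphs, in which loops and multiple edges are allowed: \<open>ends G e\<close> is the set of
  the one or two end vertices of the edge \<open>e\<close>. A subgraph containing all vertices is given by its
  set of edges.
\<close>

record ('v, 'e) signed_graph =
  verts :: "'v set"
  edges :: "'e set"
  ends :: "'e \<Rightarrow> 'v set"
  pos_edge :: "'e \<Rightarrow> bool"

definition linked :: "('v, 'e) signed_graph \<Rightarrow> 'e set \<Rightarrow> 'v \<Rightarrow> 'v \<Rightarrow> bool" where
  "linked G T x y \<longleftrightarrow> (x, y) \<in> {(a, b). \<exists>e \<in> T. ends G e = {a, b}}\<^sup>*"

definition is_cycle :: "('v, 'e) signed_graph \<Rightarrow> 'e set \<Rightarrow> bool" where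
  "is_cycle G C \<longleftrightarrow>
     (\<exists>vs es. es \<noteq> [] \<and> length vs = length es \<and> distinct vs \<and> distinct es \<and>
        set vs \<subseteq> verts G \<and> set es \<subseteq> edges G \<and> C = set es \<and>
        (\<forall>i < length es. ends G (es ! i) = {vs ! i, vs ! ((i + 1) mod length vs)}))"

definition spanning_tree :: "('v, 'e) signed_graph \<Rightarrow> 'e set \<Rightarrow> bool" where
  "spanning_tree G T \<longleftrightarrow>
     T \<subseteq> edges G \<and> (\<forall>x \<in> verts G. \<forall>y \<in> verts G. linked G T x y) \<and> (\<forall>C \<subseteq> T. \<not> is_cycle G C)"

definition cut :: "('v, 'e) signed_graph \<Rightarrow> 'e set \<Rightarrow> 'e \<Rightarrow> 'e set" where
  "cut G T e = {g \<in> edges G. \<exists>x y. ends G g = {x, y} \<and> \<not> linked G (T - {e}) x y}"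

definition cyc :: "('v, 'e) signed_graph \<Rightarrow> 'e set \<Rightarrow> 'e \<Rightarrow> 'e set" where
  "cyc G T f = (THE C. is_cycle G C \<and> C \<subseteq> insert f T)"

definition internally_active :: "('v, 'e::linorder) signed_graph \<Rightarrow> 'e set \<Rightarrow> 'e \<Rightarrow> bool" where
  "internally_active G T e \<longleftrightarrow> e \<in> T \<and> (\<forall>g \<in> cut G T e. e \<le> g)"

definition externally_active :: "('v, 'e::linorder) signed_graph \<Rightarrow> 'e set \<Rightarrow> 'e \<Rightarrow> bool" where
  "externally_active G T e \<longleftrightarrow> e \<in> edges G - T \<and> (\<forall>g \<in> cyc G T e. e \<le> g)"

definition tree_u :: "('v, 'e::linorder) signed_graph \<Rightarrow> 'e set \<Rightarrow> int" where
  "tree_u G T =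
       int (card {e \<in> edges G. pos_edge G e \<and> internally_active G T e})
     - int (card {e \<in> edges G. pos_edge G e \<and> externally_active G T e})
     - int (card {e \<in> edges G. \<not> pos_edge G e \<and> internally_active G T e})
     + int (card {e \<in> edges G. \<not> pos_edge G e \<and> externally_active G T e})"

definition tree_v :: "('v, 'e) signed_graph \<Rightarrow> 'e set \<Rightarrow> int" where
  "tree_v G T = int (card {e \<in> T. pos_edge G e})"

text \<open>
  The second degree is allowed to be rational, so that the formula relating it to the Khovanov
  degrees can be used as it stands; the group is trivial if \<open>v\<close> is not an integer.
\<close>

definition tree_group ::
    "('v, 'e::linorder) signed_graph \<Rightarrow> int \<times> rat \<Rightarrow> ('e set \<Rightarrow>\<^sub>0 int) monoid" where
  "tree_group G = (\<lambda>(u, v).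
     free_Abelian_group {T. spanning_tree G T \<and> tree_u G T = u \<and> of_int (tree_v G T) = v})"

definition E_plus :: "('v, 'e) signed_graph \<Rightarrow> nat" where
  "E_plus G = card {e \<in> edges G. pos_edge G e}"

definition E_minus :: "('v, 'e) signed_graph \<Rightarrow> nat" where
  "E_minus G = card {e \<in> edges G. \<not> pos_edge G e}"


section \<open>The Tait graph\<close>

definition checkerboard :: "knot_code \<Rightarrow> region set \<Rightarrow> bool" where
  "checkerboard K S \<longleftrightarrow>
     S \<subseteq> regions K \<and>
     (\<forall>a \<in> arcs K. (region_of_side K (a, True) \<in> S) \<noteq> (region_of_side K (a, False) \<in> S))"

text \<open>
  The \<open>A\<close>-smoothing joins the regions swept out when the upper strand (arc ends 1 and 3) is turned
  counterclockwise, i.e. those at the corners 1 and 3.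
\<close>

definition tait_graph :: "knot_code \<Rightarrow> region set \<Rightarrow> (region, nat) signed_graph" where
  "tait_graph K S =
     \<lparr>verts = S,
      edges = {..<crossings K},
      ends = (\<lambda>c. {region_at K c q | q. q < 4} \<inter> S),
      pos_edge = (\<lambda>c. region_at K c 1 \<in> S \<and> region_at K c 3 \<in> S)\<rparr>"


section \<open>The reduced Khovanov complex\<close>

text \<open>
  A state is given by the set \<open>B\<close> of the crossings with a \<open>B\<close>-smoothing. Its circles are
  represented by the sets of arcs they contain. The \<open>A\<close>-smoothing connects the arc ends \<open>0, 1\<close> and
  \<open>2, 3\<close>, the \<open>B\<close>-smoothing connects \<open>1, 2\<close> and \<open>3, 0\<close>. An enhanced state \<open>(B, P)\<close> also has the set
  \<open>P\<close> of the circles with sign \<open>+\<close>.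
\<close>

type_synonym enhanced_state = "nat set \<times> nat set set"

definition smoothing :: "knot_code \<Rightarrow> nat set \<Rightarrow> (nat \<times> nat) set" where
  "smoothing K B =
     (\<Union>c \<in> {..<crossings K} - B. {(arc_at K c 0, arc_at K c 1), (arc_at K c 2, arc_at K c 3)}) \<union>
     (\<Union>c \<in> {..<crossings K} \<inter> B. {(arc_at K c 1, arc_at K c 2), (arc_at K c 3, arc_at K c 0)})"

definition circles :: "knot_code \<Rightarrow> nat set \<Rightarrow> nat set set" where
  "circles K B = generated_classes (arcs K) (smoothing K B)"

definition enhanced_states :: "knot_code \<Rightarrow> enhanced_state set" where
  "enhanced_states K = {(B, P). B \<subseteq> {..<crossings K} \<and> P \<subseteq> circles K B}"

definition state_sigma :: "knot_code \<Rightarrow> enhanced_state \<Rightarrow> int" where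
  "state_sigma K = (\<lambda>(B, P). int (card ({..<crossings K} - B)) - int (card B))"

definition state_tau :: "knot_code \<Rightarrow> enhanced_state \<Rightarrow> int" where
  "state_tau K = (\<lambda>(B, P). int (card P) - int (card (circles K B - P)))"

definition has_degree :: "knot_code \<Rightarrow> enhanced_state \<Rightarrow> int \<times> int \<Rightarrow> bool" where
  "has_degree K s = (\<lambda>(i, j).
     2 * i = writhe K - state_sigma K s \<and> j = i + writhe K - state_tau K s)"

definition base_plus :: "enhanced_state \<Rightarrow> bool" where
  "base_plus = (\<lambda>(B, P). \<exists>C \<in> P. 0 \<in> C)"

definition reduced_khovanov_group ::
    "knot_code \<Rightarrow> int \<times> int \<Rightarrow> (enhanced_state \<Rightarrow>\<^sub>0 int) monoid" where
  "reduced_khovanov_group K p =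
     free_Abelian_group {s \<in> enhanced_states K. has_degree K s p \<and> base_plus s}"

text \<open>
  The effect of changing crossing \<open>c\<close> from \<open>A\<close> to \<open>B\<close>. In a diagram this either merges two circles
  (\<open>gone\<close>) into one (\<open>made\<close>) or splits one circle (\<open>gone\<close>) into two (\<open>made\<close>).
\<close>

definition resolve_map :: "knot_code \<Rightarrow> nat \<Rightarrow> enhanced_state \<Rightarrow> (enhanced_state \<Rightarrow>\<^sub>0 int)" where
  "resolve_map K c = (\<lambda>(B, P).
     let B' = insert c B;
         gone = circles K B - circles K B';
         made = circles K B' - circles K B;
         rest = P - gone
     in if card gone = 2 then
          (if gone \<inter> P = {} then frag_of (B', rest)
           else if gone \<subseteq> P then 0
           else frag_of (B', rest \<union> made))
        else
          (if gone \<subseteq> P then frag_of (B', rest \<union> made)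
           else (\<Sum>x \<in> made. frag_of (B', insert x rest))))"

definition khovanov_diff :: "knot_code \<Rightarrow> (enhanced_state \<Rightarrow>\<^sub>0 int) \<Rightarrow> (enhanced_state \<Rightarrow>\<^sub>0 int)" where
  "khovanov_diff K = frag_extend (\<lambda>(B, P).
     \<Sum>c \<in> {..<crossings K} - B. frag_cmul ((- 1) ^ card {b \<in> B. b < c}) (resolve_map K c (B, P)))"

end

theory Submission
  imports Defs "HOL-Library.Product_Lexorder" "HOL-Combinatorics.Permutations" "HOL-Library.Transitive_Closure_Table"
begin

text \<open>
  An edge \<open>e\<close> is called live with respect to an arbitrary set \<open>H\<close> of edges if the edges of \<open>H\<close> above
  \<open>e\<close> link its ends (externally live), or if these edges together with all edges below \<open>e\<close> do not
  (internally live); for spanning trees this is activity. Changing a live edge changes no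
  activity, so the cube of smoothings is the disjoint union of subcubes in which exactly the live
  crossings vary, one for each spanning tree. By Euler's formula the number of circles of a
  smoothing is determined by a subgraph of the Tait graph, and each subcube is that of an
  unknot diagram in which all crossings are nugatory: starting from the smoothing with a single
  circle, each change of a live crossing cuts off one further circle.

  In each subcube, enhanced states which differ at one live crossing and between which the
  differential has coefficient 1 or -1 can be matched so that a single state remains. The matching
  is acyclic: the dead crossings with a B-smoothing, read as a binary number, increase whenever
  the differential leaves a subcube, and a weight given by the nesting of the circles that are
  cut off increases within it. Gaussian elimination along the matched pairs then leaves a
  complex on the unmatched states, which correspond to the spanning trees.
\<close>

section \<open>Acyclic matchings\<close>

text \<open>A surgery must never turn one circle into one circle. Directing all arcs with the shaded
  region on the left makes each smoothing a permutation of the arcs whose cycles are the circles;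
  changing a crossing multiplies it by a transposition, so it merges two cycles or splits one. The
  matching at a live crossing pairs states as a Reidemeister I move does. Matching basis states
  avoids computing the differential of a smaller diagram after each move, but leaves a second term
  of the differential to control, in which the near circle becomes positive instead of the far one.
  The basepoint separates near from far, and the nesting around it supplies the weight that this
  term raises. Dead crossings are read in binary because changing one of them can alter the liveness
  of smaller crossings only. That the differential squares to zero rests on linearity: merging and
  splitting commute with multiplication at any arc, so surgeries at two crossings need only be
  compared on the state without positive circles.\<close>

lemma additive_frag_extend: "additive (frag_extend f)"
  by unfold_locales (rule frag_extend_add)

lemma additive_comp: "additive f \<Longrightarrow> additive g \<Longrightarrow> additive (\<lambda>x. f (g x))"
  by (simp add: additive_def)

lemma additive_frag_eq:
  fixes f g :: "('a \<Rightarrow>\<^sub>0 int) \<Rightarrow> 'b::ab_group_add"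
  assumes "additive f" "additive g" "Poly_Mapping.keys x \<subseteq> S"
    and "\<And>s. s \<in> S \<Longrightarrow> f (frag_of s) = g (frag_of s)"
  shows "f x = g x"
  using assms(3)
  by (induction x rule: frag_induction)
    (simp_all add: assms additive.zero additive.diff)

lemma keys_additive:
  fixes f :: "('a \<Rightarrow>\<^sub>0 int) \<Rightarrow> ('b \<Rightarrow>\<^sub>0 int)"
  assumes "additive f" "Poly_Mapping.keys x \<subseteq> S"
    and "\<And>s. s \<in> S \<Longrightarrow> Poly_Mapping.keys (f (frag_of s)) \<subseteq> T"
  shows "Poly_Mapping.keys (f x) \<subseteq> T"
  using assms(2)
proof (induction x rule: frag_induction)
  case (diff a b)
  then show ?case
    by (metis additive.diff[OF assms(1)] keys_diff le_sup_iff order_trans)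
qed (simp_all add: assms additive.zero)

lemma hom_free_Abelian_groupI:
  assumes "additive f" "\<And>s. s \<in> S \<Longrightarrow> Poly_Mapping.keys (f (frag_of s)) \<subseteq> T"
  shows "f \<in> hom (free_Abelian_group S) (free_Abelian_group T)"
  using keys_additive[OF assms(1) _ assms(2)] additive.add[OF assms(1)]
  by (intro homI) auto

definition restrict_frag :: "'a set \<Rightarrow> ('a \<Rightarrow>\<^sub>0 int) \<Rightarrow> ('a \<Rightarrow>\<^sub>0 int)" where
  "restrict_frag A = frag_extend (\<lambda>s. if s \<in> A then frag_of s else 0)"

lemma additive_restrict_frag: "additive (restrict_frag A)"
  unfolding restrict_frag_def by (rule additive_frag_extend)

lemma restrict_frag_of: "restrict_frag A (frag_of s) = (if s \<in> A then frag_of s else 0)"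
  by (simp add: restrict_frag_def)

lemma lookup_restrict_frag:
  "Poly_Mapping.lookup (restrict_frag A x) s = (if s \<in> A then Poly_Mapping.lookup x s else 0)"
proof -
  have "restrict_frag A x = restrict_frag A x \<and>
      Poly_Mapping.lookup (restrict_frag A x) s = (if s \<in> A then Poly_Mapping.lookup x s else 0)"
    using subset_UNIV[of "Poly_Mapping.keys x"]
    by (induction x rule: frag_induction)
      (auto simp: additive.zero[OF additive_restrict_frag] additive.diff[OF additive_restrict_frag]
          restrict_frag_of lookup_minus)
  then show ?thesis by simp
qed

lemma keys_restrict_frag: "Poly_Mapping.keys (restrict_frag A x) = Poly_Mapping.keys x \<inter> A"
  by (auto simp: in_keys_iff lookup_restrict_frag split: if_splits)

lemma restrict_frag_id: "Poly_Mapping.keys x \<subseteq> A \<Longrightarrow> restrict_frag A x = x"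
  by (rule poly_mapping_eqI) (auto simp: lookup_restrict_frag in_keys_iff subset_iff)

lemma restrict_frag_0: "Poly_Mapping.keys x \<inter> A = {} \<Longrightarrow> restrict_frag A x = 0"
  by (metis keys_eq_empty keys_restrict_frag)

lemma restrict_frag_Un:
  "A \<inter> B = {} \<Longrightarrow> restrict_frag (A \<union> B) x = restrict_frag A x + restrict_frag B x"
  by (rule poly_mapping_eqI) (auto simp: lookup_restrict_frag lookup_add)

text \<open>Discrete Morse theory. Listed by \<open>rank\<close>, the block of \<open>d\<close> from
  \<open>M1\<close> to \<open>M2\<close> is triangular with diagonal entries 1 or -1, hence
  invertible over the integers. Ties in \<open>rank\<close> are harmless, since the entries between
  tied states vanish.\<close>

locale acyclic_matching =
  fixes \<Omega> :: "'b set" and deg :: "'b \<Rightarrow> 'p::ab_group_add" and t :: 'p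
    and d :: "('b \<Rightarrow>\<^sub>0 int) \<Rightarrow> ('b \<Rightarrow>\<^sub>0 int)"
    and M1 M2 :: "'b set" and \<mu> :: "'b \<Rightarrow> 'b" and rank :: "'b \<Rightarrow> 'r::linorder"
  assumes finite_basis: "finite \<Omega>"
    and additive_d: "additive d"
    and keys_d: "\<And>s. s \<in> \<Omega> \<Longrightarrow> Poly_Mapping.keys (d (frag_of s)) \<subseteq> {s' \<in> \<Omega>. deg s' = deg s + t}"
    and d_d: "\<And>s. s \<in> \<Omega> \<Longrightarrow> d (d (frag_of s)) = 0"
    and M1: "M1 \<subseteq> \<Omega>" and M2: "M2 \<subseteq> \<Omega>" and M_disjoint: "M1 \<inter> M2 = {}"
    and \<mu>: "bij_betw \<mu> M1 M2"
    and coeff_\<mu>: "\<And>s. s \<in> M1 \<Longrightarrow> \<bar>Poly_Mapping.lookup (d (frag_of s)) (\<mu> s)\<bar> = 1"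
    and rank: "\<And>s s'. s \<in> M1 \<Longrightarrow> s' \<in> M1 \<Longrightarrow> s' \<noteq> s \<Longrightarrow>
                 \<mu> s' \<in> Poly_Mapping.keys (d (frag_of s)) \<Longrightarrow> rank s < rank s'"
begin

abbreviation "frags A \<equiv> {x :: 'b \<Rightarrow>\<^sub>0 int. Poly_Mapping.keys x \<subseteq> A}"

abbreviation "critical \<equiv> \<Omega> - M1 - M2"

section \<open>Inverting the matched block of the differential\<close>

lemma deg_\<mu>: "s \<in> M1 \<Longrightarrow> deg (\<mu> s) = deg s + t"
  using coeff_\<mu>[of s] keys_d[of s] M1
  by (metis (mono_tags, lifting) abs_zero in_keys_iff mem_Collect_eq subsetD zero_neq_one)

lemma \<mu>_in: "s \<in> M1 \<Longrightarrow> \<mu> s \<in> M2"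
  using \<mu> by (auto simp: bij_betw_def)

lemma \<mu>_inj: "s \<in> M1 \<Longrightarrow> s' \<in> M1 \<Longrightarrow> \<mu> s = \<mu> s' \<longleftrightarrow> s = s'"
  using \<mu> by (auto simp: bij_betw_def inj_on_def)

text \<open>Back substitution: apart from its diagonal entry, the image of \<open>x\<close> in
  \<open>M2\<close> involves only partners of states of higher rank, which are already hit. The
  degree is recorded so that the inverse of the block is homogeneous.\<close>

lemma matched_block_surj:
  assumes "x \<in> M1"
  shows "\<exists>z. Poly_Mapping.keys z \<subseteq> {s \<in> M1. deg s = deg x} \<and> restrict_frag M2 (d z) = frag_of (\<mu> x)"
  using assms
proof (induction "card {s \<in> M1. rank x < rank s}" arbitrary: x rule: less_induct)
  case less
  \<comment> \<open>A unit of the integers; it is removed at the end by changing the sign of the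
    preimage if necessary.\<close>
  define \<epsilon> where "\<epsilon> = Poly_Mapping.lookup (d (frag_of x)) (\<mu> x)"
  have \<epsilon>: "\<epsilon> * \<epsilon> = 1"
    using coeff_\<mu>[OF less.prems] by (simp add: \<epsilon>_def) (metis abs_mult_self mult_1)
  define w where "w = restrict_frag M2 (d (frag_of x)) - frag_cmul \<epsilon> (frag_of (\<mu> x))"
  define Y where "Y = {y \<in> M1. rank x < rank y \<and> deg y = deg x}"
  have "Poly_Mapping.keys w \<subseteq> \<mu> ` Y"
  proof
    fix k assume k: "k \<in> Poly_Mapping.keys w"
    then have "Poly_Mapping.lookup w k \<noteq> 0" by (simp add: in_keys_iff)
    then have k': "k \<in> M2" "k \<noteq> \<mu> x" "k \<in> Poly_Mapping.keys (d (frag_of x))"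
      using \<mu>_in[OF less.prems]
      by (auto simp: w_def lookup_minus lookup_restrict_frag \<epsilon>_def in_keys_iff split: if_splits)
    then obtain y where y: "y \<in> M1" "k = \<mu> y" using \<mu> by (auto simp: bij_betw_def)
    have "deg k = deg x + t" using keys_d k'(3) less.prems M1 by blast
    then have "deg y = deg x" using deg_\<mu>[OF y(1)] y(2) by simp
    moreover have "rank x < rank y" using rank[OF less.prems y(1)] k' y by auto
    ultimately show "k \<in> \<mu> ` Y" using y by (auto simp: Y_def)
  qed
  then have "\<exists>z. Poly_Mapping.keys z \<subseteq> {s \<in> M1. deg s = deg x} \<and> restrict_frag M2 (d z) = w"
  proof (induction w rule: frag_induction)
    case zero
    show ?case
      by (rule exI[of _ 0])
        (simp add: additive.zero[OF additive_d] additive.zero[OF additive_restrict_frag])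
  next
    case (one k)
    then obtain y where y: "y \<in> Y" "k = \<mu> y" by auto
    have "card {s \<in> M1. rank y < rank s} < card {s \<in> M1. rank x < rank s}"
    proof (rule psubset_card_mono)
      show "finite {s \<in> M1. rank x < rank s}"
        using finite_subset[OF M1 finite_basis] by simp
      show "{s \<in> M1. rank y < rank s} \<subset> {s \<in> M1. rank x < rank s}"
        using y(1) by (auto simp: Y_def)
    qed
    from less.hyps[OF this] y show ?case by (auto simp: Y_def)
  next
    case (diff a b)
    then obtain za zb where "Poly_Mapping.keys za \<subseteq> {s \<in> M1. deg s = deg x}"
      "restrict_frag M2 (d za) = a" "Poly_Mapping.keys zb \<subseteq> {s \<in> M1. deg s = deg x}"
      "restrict_frag M2 (d zb) = b" by blast
    then show ?case
      using keys_diff[of za zb]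
      by (intro exI[of _ "za - zb"])
        (auto simp: additive.diff[OF additive_d] additive.diff[OF additive_restrict_frag])
  qed
  then obtain z where z: "Poly_Mapping.keys z \<subseteq> {s \<in> M1. deg s = deg x}" "restrict_frag M2 (d z) = w"
    by blast
  have sgn: "frag_cmul \<epsilon> v = v \<or> frag_cmul \<epsilon> v = - v" for v :: "'b \<Rightarrow>\<^sub>0 int"
    using coeff_\<mu>[OF less.prems] by (auto simp: \<epsilon>_def[symmetric] abs_if split: if_splits)
  have "restrict_frag M2 (d (frag_of x - z)) = frag_cmul \<epsilon> (frag_of (\<mu> x))"
    using z(2) by (simp add: w_def additive.diff[OF additive_d] additive.diff[OF additive_restrict_frag])
  moreover have "Poly_Mapping.keys (frag_of x - z) \<subseteq> {s \<in> M1. deg s = deg x}"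
    using keys_diff[of "frag_of x" z] z(1) less.prems by auto
  ultimately show ?case
    using sgn[of "frag_of (\<mu> x)"]
    by (metis (no_types, lifting) add.inverse_inverse additive.minus[OF additive_d]
        additive.minus[OF additive_restrict_frag] keys_minus)
qed

text \<open>Among the states occurring in \<open>z\<close>, only the one of lowest rank itself can
  reach its partner, so that coefficient does not cancel.\<close>

lemma matched_block_inj:
  assumes "z \<in> frags M1" "restrict_frag M2 (d z) = 0"
  shows "z = 0"
proof (rule ccontr)
  assume "z \<noteq> 0"
  then have ne: "Poly_Mapping.keys z \<noteq> {}" by simp
  define x where "x = arg_min_on rank (Poly_Mapping.keys z)"
  have x: "x \<in> Poly_Mapping.keys z" "\<And>y. y \<in> Poly_Mapping.keys z \<Longrightarrow> rank x \<le> rank y"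
    using arg_min_if_finite(1)[OF finite_keys ne, of rank] arg_min_least[OF finite_keys ne, of _ rank]
    by (auto simp: x_def)
  have xM: "x \<in> M1" using assms x by blast
  have "d z = (\<Sum>y\<in>Poly_Mapping.keys z. frag_cmul (Poly_Mapping.lookup z y) (d (frag_of y)))"
  proof -
    have "d z = frag_extend (\<lambda>y. d (frag_of y)) z"
      by (rule additive_frag_eq[OF additive_d additive_frag_extend subset_UNIV]) simp
    then show ?thesis by (simp add: frag_extend_def)
  qed
  then have "Poly_Mapping.lookup (d z) (\<mu> x)
      = (\<Sum>y\<in>Poly_Mapping.keys z. Poly_Mapping.lookup z y * Poly_Mapping.lookup (d (frag_of y)) (\<mu> x))"
    by (simp add: lookup_sum)
  also have "\<dots> = (\<Sum>y\<in>Poly_Mapping.keys z. if y = x then Poly_Mapping.lookup z x * Poly_Mapping.lookup (d (frag_of x)) (\<mu> x) else 0)"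
  proof (rule sum.cong[OF refl])
    fix y assume y: "y \<in> Poly_Mapping.keys z"
    show "Poly_Mapping.lookup z y * Poly_Mapping.lookup (d (frag_of y)) (\<mu> x) =
      (if y = x then Poly_Mapping.lookup z x * Poly_Mapping.lookup (d (frag_of x)) (\<mu> x) else 0)"
    proof (cases "y = x")
      case False
      have "y \<in> M1" using y assms by auto
      then have "\<mu> x \<notin> Poly_Mapping.keys (d (frag_of y))"
        using rank[of y x] x(2)[OF y] xM False by force
      then show ?thesis using False by (simp add: in_keys_iff)
    qed simp
  qed
  also have "\<dots> = Poly_Mapping.lookup z x * Poly_Mapping.lookup (d (frag_of x)) (\<mu> x)"
    using x(1) by simp
  also have "\<dots> \<noteq> 0" using x(1) coeff_\<mu>[OF xM] by (auto simp: in_keys_iff)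
  finally have "Poly_Mapping.lookup (restrict_frag M2 (d z)) (\<mu> x) \<noteq> 0"
    using \<mu>_in[OF xM] by (simp add: lookup_restrict_frag)
  then show False using assms by simp
qed

definition preimage :: "'b \<Rightarrow> ('b \<Rightarrow>\<^sub>0 int)" where
  "preimage y = (SOME z. Poly_Mapping.keys z \<subseteq> {s \<in> M1. deg s = deg y - t} \<and>
                   restrict_frag M2 (d z) = frag_of y)"

lemma preimage:
  assumes "y \<in> M2"
  shows "Poly_Mapping.keys (preimage y) \<subseteq> {s \<in> M1. deg s = deg y - t}"
    "restrict_frag M2 (d (preimage y)) = frag_of y"
proof -
  obtain x where x: "x \<in> M1" "y = \<mu> x" using assms \<mu> by (auto simp: bij_betw_def)
  have "\<exists>z. Poly_Mapping.keys z \<subseteq> {s \<in> M1. deg s = deg y - t} \<and> restrict_frag M2 (d z) = frag_of y"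
    using matched_block_surj[OF x(1)] deg_\<mu>[OF x(1)] x(2) by simp
  from someI_ex[OF this] show "Poly_Mapping.keys (preimage y) \<subseteq> {s \<in> M1. deg s = deg y - t}"
    "restrict_frag M2 (d (preimage y)) = frag_of y" unfolding preimage_def by auto
qed

text \<open>The inverse of the matched block, extended by zero to all other basis states.\<close>

definition htpy :: "('b \<Rightarrow>\<^sub>0 int) \<Rightarrow> ('b \<Rightarrow>\<^sub>0 int)" where
  "htpy = frag_extend (\<lambda>y. if y \<in> M2 then preimage y else 0)"

text \<open>For this map the homotopy formula of a deformation retract holds by definition; what
  remains is that it projects onto a copy of the group on the critical states.\<close>

definition proj :: "('b \<Rightarrow>\<^sub>0 int) \<Rightarrow> ('b \<Rightarrow>\<^sub>0 int)" where
  "proj x = x - d (htpy x) - htpy (d x)"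

section \<open>The homotopy and the projection\<close>

lemma additive_htpy: "additive htpy"
  unfolding htpy_def by (rule additive_frag_extend)

lemmas htpy_simps = additive.add[OF additive_htpy] additive.diff[OF additive_htpy]
  additive.zero[OF additive_htpy]
lemmas d_simps = additive.add[OF additive_d] additive.diff[OF additive_d] additive.zero[OF additive_d]

lemma additive_proj: "additive proj"
  by unfold_locales (simp add: proj_def htpy_simps d_simps)

lemma htpy_of: "htpy (frag_of y) = (if y \<in> M2 then preimage y else 0)"
  by (simp add: htpy_def)

lemma htpy_frags: "htpy x \<in> frags M1"
proof -
  have "Poly_Mapping.keys (htpy (frag_of s)) \<subseteq> M1" for s
    using preimage(1)[of s] by (auto simp: htpy_of)
  then show ?thesis
    using keys_additive[OF additive_htpy subset_UNIV, where x=x and T=M1] by simp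
qed

lemma htpy_restrict: "htpy x = htpy (restrict_frag M2 x)"
  by (rule additive_frag_eq[OF additive_htpy additive_comp[OF additive_htpy additive_restrict_frag] subset_UNIV])
    (simp add: htpy_of restrict_frag_of htpy_simps)

lemma restrict_d_htpy: "restrict_frag M2 (d (htpy x)) = restrict_frag M2 x"
  by (rule additive_frag_eq[OF additive_comp[OF additive_restrict_frag
          additive_comp[OF additive_d additive_htpy]] additive_restrict_frag subset_UNIV])
    (simp add: htpy_of restrict_frag_of preimage d_simps additive.zero[OF additive_restrict_frag])

lemma htpy_M1: "x \<in> frags M1 \<Longrightarrow> htpy x = 0"
  by (subst htpy_restrict) (use M_disjoint in \<open>simp add: restrict_frag_0 htpy_simps subset_iff disjoint_iff\<close>)

lemma htpy_critical: "x \<in> frags critical \<Longrightarrow> htpy x = 0"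
  by (subst htpy_restrict, subst restrict_frag_0) (auto simp: htpy_simps)

text \<open>\<open>htpy\<close> is a right inverse of the block by construction; injectivity of the
  block makes it a left inverse as well.\<close>

lemma htpy_d_M1:
  assumes "x \<in> frags M1"
  shows "htpy (d x) = x"
proof -
  have "restrict_frag M2 (d (htpy (d x) - x)) = 0"
    by (simp add: d_simps additive.diff[OF additive_restrict_frag] restrict_d_htpy)
  moreover have "htpy (d x) - x \<in> frags M1"
    using htpy_frags[of "d x"] assms keys_diff[of "htpy (d x)" x] by auto
  ultimately have "htpy (d x) - x = 0" by (rule matched_block_inj[rotated])
  then show ?thesis by simp
qed

lemma d_frags: "x \<in> frags \<Omega> \<Longrightarrow> d x \<in> frags \<Omega>"
  using keys_additive[OF additive_d, of x \<Omega> \<Omega>] keys_d by auto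

lemma d_d_frags: "x \<in> frags \<Omega> \<Longrightarrow> d (d x) = 0"
  using additive_frag_eq[OF additive_comp[OF additive_d additive_d], of "\<lambda>_. 0" x \<Omega>] d_d
  by (simp add: additive_def)

lemma htpy_frags_\<Omega>: "htpy x \<in> frags \<Omega>"
  using htpy_frags M1 by blast

lemma proj_frags: "x \<in> frags \<Omega> \<Longrightarrow> proj x \<in> frags \<Omega>"
  using d_frags[OF htpy_frags_\<Omega>, of x] htpy_frags_\<Omega>[of "d x"]
    keys_diff[of x "d (htpy x)"] keys_diff[of "x - d (htpy x)" "htpy (d x)"]
  unfolding proj_def mem_Collect_eq by blast

lemma proj_d: "x \<in> frags \<Omega> \<Longrightarrow> proj (d x) = d (proj x)"
  by (simp only: proj_def d_simps d_d_frags d_d_frags[OF htpy_frags_\<Omega>] htpy_simps diff_zero)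

lemma proj_M1: "x \<in> frags M1 \<Longrightarrow> proj x = 0"
  by (simp add: proj_def htpy_M1 htpy_d_M1 d_simps)

lemma restrict_proj_critical: 
  assumes "x \<in> frags critical"
  shows "restrict_frag critical (proj x) = x"
proof -
  have "restrict_frag critical (htpy (d x)) = 0"
    using htpy_frags[of "d x"] by (intro restrict_frag_0) auto
  then show ?thesis
    using assms
    by (simp add: proj_def htpy_critical[simplified] d_simps additive.diff[OF additive_restrict_frag]
        restrict_frag_id)
qed

lemma restrict_M2_proj: "restrict_frag M2 (proj x) = 0"
proof -
  have "restrict_frag M2 (htpy (d x)) = 0"
    using htpy_frags[of "d x"] M_disjoint by (intro restrict_frag_0) auto
  then show ?thesis
    by (simp add: proj_def additive.diff[OF additive_restrict_frag] restrict_d_htpy)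
qed

text \<open>\<open>htpy\<close> only sees components in \<open>M2\<close>, and neither
  \<open>proj x\<close> nor its boundary, which is \<open>proj (d x)\<close>, has any.\<close>

lemma proj_proj:
  assumes "x \<in> frags \<Omega>"
  shows "proj (proj x) = proj x"
proof -
  have "htpy (proj x) = 0"
    by (subst htpy_restrict) (simp add: restrict_M2_proj htpy_simps)
  moreover have "htpy (d (proj x)) = 0"
    unfolding proj_d[OF assms, symmetric]
    by (subst htpy_restrict) (simp add: restrict_M2_proj htpy_simps)
  ultimately show ?thesis by (simp add: proj_def[of "proj x"] d_simps)
qed

text \<open>The component of \<open>proj x\<close> in \<open>M2\<close> vanishes and
  \<open>proj\<close> kills the one in \<open>M1\<close>, so the critical component determines
  everything.\<close>

lemma proj_restrict_proj:
  assumes "x \<in> frags \<Omega>"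
  shows "proj (restrict_frag critical (proj x)) = proj x"
proof -
  have "proj x = restrict_frag \<Omega> (proj x)"
    using proj_frags[OF assms] by (simp add: restrict_frag_id)
  also have "\<Omega> = (critical \<union> M1) \<union> M2" using M1 M2 by auto
  also have "restrict_frag \<dots> (proj x) =
      restrict_frag critical (proj x) + restrict_frag M1 (proj x) + restrict_frag M2 (proj x)"
    using M_disjoint by (subst restrict_frag_Un; (subst restrict_frag_Un)?) auto
  finally have split: "proj x = restrict_frag critical (proj x) + restrict_frag M1 (proj x)"
    unfolding restrict_M2_proj add_0_right .
  have "proj x = proj (proj x)" by (rule proj_proj[OF assms, symmetric])
  also have "\<dots> = proj (restrict_frag critical (proj x)) + proj (restrict_frag M1 (proj x))"
    by (subst split) (rule additive.add[OF additive_proj])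
  also have "proj (restrict_frag M1 (proj x)) = 0"
    by (rule proj_M1) (simp add: keys_restrict_frag)
  finally show ?thesis unfolding add_0_right by (rule sym)
qed

section \<open>The retract on the critical states\<close>

lemma keys_htpy:
  assumes "s \<in> \<Omega>"
  shows "Poly_Mapping.keys (htpy (frag_of s)) \<subseteq> {s' \<in> \<Omega>. deg s' = deg s - t}"
  using preimage(1)[of s] M1 by (auto simp: htpy_of)

lemma keys_proj:
  assumes "s \<in> \<Omega>"
  shows "Poly_Mapping.keys (proj (frag_of s)) \<subseteq> {s' \<in> \<Omega>. deg s' = deg s}"
proof -
  have "Poly_Mapping.keys (d (htpy (frag_of s))) \<subseteq> {s' \<in> \<Omega>. deg s' = deg s}"
    by (rule keys_additive[OF additive_d keys_htpy[OF assms]]) (use keys_d in fastforce)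
  moreover have "Poly_Mapping.keys (htpy (d (frag_of s))) \<subseteq> {s' \<in> \<Omega>. deg s' = deg s}"
    by (rule keys_additive[OF additive_htpy keys_d[OF assms]]) (use keys_htpy in fastforce)
  moreover have "Poly_Mapping.keys (frag_of s) \<subseteq> {s' \<in> \<Omega>. deg s' = deg s}"
    using assms by simp
  ultimately show ?thesis
    unfolding proj_def by (meson Un_least keys_diff order_trans)
qed

text \<open>The retract is the image of \<open>proj\<close>, described by its critical components:
  states are embedded by projecting, and the retraction projects and then forgets the matched
  states. Injectivity of \<open>\<phi>\<close> lets the degree of a critical state be recovered from
  that of its label.\<close>

theorem deformation_retract_critical:
  fixes \<beta> :: "'c \<Rightarrow> 'b" and \<phi> :: "'p \<Rightarrow> 'q::ab_group_add"
  assumes \<beta>: "bij_betw \<beta> \<Theta> critical" and degT: "\<And>T. T \<in> \<Theta> \<Longrightarrow> degT T = \<phi> (deg (\<beta> T))"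
    and \<phi>: "inj \<phi>" "\<And>p. \<phi> (p + t) = \<phi> p + s"
  shows "\<exists>D. deformation_retract \<phi> s (\<lambda>q. free_Abelian_group {T \<in> \<Theta>. degT T = q}) D
                t (\<lambda>p. free_Abelian_group {x \<in> \<Omega>. deg x = p}) (\<lambda>_. d)"
proof -
  define X where "X = (\<lambda>q. {T \<in> \<Theta>. degT T = q})"
  define Y where "Y = (\<lambda>p. {x \<in> \<Omega>. deg x = p})"
  define \<iota> where "\<iota> = frag_extend (\<lambda>T. frag_of (\<beta> T))"
  define \<kappa> where "\<kappa> = frag_extend (\<lambda>x. frag_of (inv_into \<Theta> \<beta> x))"
  define r where "r = (\<lambda>x. \<kappa> (restrict_frag critical (proj x)))"
  define f where "f = (\<lambda>x. proj (\<iota> x))"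
  \<comment> \<open>Forced by the chain map condition: \<open>r (f x) = x\<close> turns
    \<open>f (D x) = d (f x)\<close> into this formula.\<close>
  define D where "D = (\<lambda>x. r (d (f x)))"
  have add\<iota>: "additive \<iota>" and add\<kappa>: "additive \<kappa>"
    unfolding \<iota>_def \<kappa>_def by (rule additive_frag_extend)+
  have add_r: "additive r"
    unfolding r_def by (rule additive_comp[OF add\<kappa> additive_comp[OF additive_restrict_frag additive_proj]])
  have add_f: "additive f"
    unfolding f_def by (rule additive_comp[OF additive_proj add\<iota>])
  have add_D: "additive D"
    unfolding D_def by (rule additive_comp[OF add_r additive_comp[OF additive_d add_f]])
  have \<beta>T: "\<beta> T \<in> critical" "inv_into \<Theta> \<beta> (\<beta> T) = T" if "T \<in> \<Theta>" for T
    using bij_betw_apply[OF \<beta> that] bij_betw_inv_into_left[OF \<beta> that] by auto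
  have \<beta>x: "inv_into \<Theta> \<beta> x \<in> \<Theta>" "\<beta> (inv_into \<Theta> \<beta> x) = x" if "x \<in> critical" for x
    using bij_betw_apply[OF bij_betw_inv_into[OF \<beta>] that] bij_betw_inv_into_right[OF \<beta> that] by auto
  have X\<iota>: "\<iota> x \<in> frags critical" if "Poly_Mapping.keys x \<subseteq> \<Theta>" for x
    using keys_additive[OF add\<iota> that, where T=critical] \<beta>T by (simp add: \<iota>_def)
  have \<kappa>\<iota>: "\<kappa> (\<iota> x) = x" if "Poly_Mapping.keys x \<subseteq> \<Theta>" for x
    by (rule additive_frag_eq[OF additive_comp[OF add\<kappa> add\<iota>], of "\<lambda>x. x", OF _ that])
      (auto simp: additive_def \<iota>_def \<kappa>_def \<beta>T)
  have \<iota>\<kappa>: "\<iota> (\<kappa> x) = x" if "x \<in> frags critical" for x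
    by (rule additive_frag_eq[OF additive_comp[OF add\<iota> add\<kappa>], of "\<lambda>x. x" _ critical])
      (use that in \<open>auto simp: additive_def \<iota>_def \<kappa>_def \<beta>x\<close>)
  have crit_\<Omega>: "frags critical \<subseteq> frags \<Omega>" by auto
  have \<iota>_frags: "\<iota> x \<in> frags \<Omega>" if "Poly_Mapping.keys x \<subseteq> \<Theta>" for x
    using X\<iota>[OF that] crit_\<Omega> by blast
  have restrict_crit: "restrict_frag critical x \<in> frags critical" for x
    by (simp add: keys_restrict_frag)
  have rf: "r (f x) = x" if "Poly_Mapping.keys x \<subseteq> \<Theta>" for x
    by (simp only: r_def f_def proj_proj[OF \<iota>_frags[OF that]] restrict_proj_critical[OF X\<iota>[OF that]]
        \<kappa>\<iota>[OF that])
  have fr: "f (r x) = proj x" if "x \<in> frags \<Omega>" for x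
    by (simp only: r_def f_def \<iota>\<kappa>[OF restrict_crit] proj_restrict_proj[OF that])
  have f_frags: "f x \<in> frags \<Omega>" if "Poly_Mapping.keys x \<subseteq> \<Theta>" for x
    unfolding f_def by (rule proj_frags[OF \<iota>_frags[OF that]])
  have proj_f: "proj (f x) = f x" if "Poly_Mapping.keys x \<subseteq> \<Theta>" for x
    unfolding f_def by (rule proj_proj[OF \<iota>_frags[OF that]])
  have r_proj: "r (proj x) = r x" if "x \<in> frags \<Omega>" for x
    by (simp add: r_def proj_proj[OF that])
  have fD: "f (D x) = d (f x)" if "Poly_Mapping.keys x \<subseteq> \<Theta>" for x
    unfolding D_def fr[OF d_frags[OF f_frags[OF that]]] proj_d[OF f_frags[OF that]] proj_f[OF that] ..
  have Dr: "r (d x) = D (r x)" if "x \<in> frags \<Omega>" for x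
    unfolding D_def fr[OF that] proj_d[OF that, symmetric] r_proj[OF d_frags[OF that]] ..
  have keys_f: "Poly_Mapping.keys (f (frag_of T)) \<subseteq> Y p" if "T \<in> \<Theta>" "degT T = \<phi> p" for T p
    using keys_proj[of "\<beta> T"] \<beta>T[OF that(1)] degT[OF that(1)] that \<phi>(1)
    by (auto simp: f_def \<iota>_def Y_def dest: injD)
  have keys_r: "Poly_Mapping.keys (r (frag_of x)) \<subseteq> X (\<phi> p)" if "x \<in> Y p" for x p
  proof -
    have "Poly_Mapping.keys (restrict_frag critical (proj (frag_of x))) \<subseteq> Y p \<inter> critical"
      using keys_proj[of x] that by (auto simp: keys_restrict_frag Y_def)
    then show ?thesis unfolding r_def
      by (rule keys_additive[OF add\<kappa>]) (use \<beta>x in \<open>auto simp: \<kappa>_def X_def Y_def degT\<close>)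
  qed
  have keys_d': "Poly_Mapping.keys (d (frag_of x)) \<subseteq> Y (p + t)" if "x \<in> Y p" for x p
    using keys_d[of x] that by (auto simp: Y_def)
  have keys_D: "Poly_Mapping.keys (D (frag_of T)) \<subseteq> X (q + s)" if T: "T \<in> X q" for T q
  proof -
    \<comment> \<open>Only degrees in the image of \<open>\<phi>\<close> carry basis elements, so
      the degree \<open>q\<close> of a given \<open>T\<close> has the form
      \<open>\<phi> p\<close>.\<close>
    define p where "p = deg (\<beta> T)"
    have q: "T \<in> \<Theta>" "q = \<phi> p" "degT T = \<phi> p" using T degT by (auto simp: X_def p_def)
    show ?thesis unfolding D_def q(2) \<phi>(2)[symmetric]
      by (rule keys_additive[OF add_r keys_additive[OF additive_d keys_f[OF q(1,3)] keys_d'] keys_r])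
  qed
  have X\<Theta>: "X q \<subseteq> \<Theta>" for q by (auto simp: X_def)
  have Y\<Omega>: "Y q \<subseteq> \<Omega>" for q by (auto simp: Y_def)
  have DD: "D (D x) = 0" if "Poly_Mapping.keys x \<subseteq> \<Theta>" for x
  proof -
    have "D (D x) = r (d (f (D x)))" by (simp add: D_def)
    also have "\<dots> = r (d (d (f x)))" by (simp only: fD[OF that])
    also have "\<dots> = 0" by (simp only: d_d_frags[OF f_frags[OF that]] additive.zero[OF add_r])
    finally show ?thesis .
  qed
  have "deformation_retract \<phi> s (\<lambda>q. free_Abelian_group (X q)) (\<lambda>_. D)
          t (\<lambda>p. free_Abelian_group (Y p)) (\<lambda>_. d)"
    unfolding deformation_retract_def
  proof (intro conjI)
    show "chain_complex s (\<lambda>q. free_Abelian_group (X q)) (\<lambda>_. D)"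
      unfolding chain_complex_def
    proof (intro allI conjI ballI)
      fix q x
      show "D \<in> hom (free_Abelian_group (X q)) (free_Abelian_group (X (q + s)))"
        by (rule hom_free_Abelian_groupI[OF add_D keys_D])
      assume "x \<in> carrier (free_Abelian_group (X q))"
      then have "Poly_Mapping.keys x \<subseteq> \<Theta>" using X\<Theta>[of q] by auto
      then show "D (D x) = \<one>\<^bsub>free_Abelian_group (X (q + s + s))\<^esub>" by (simp add: DD)
    qed (rule abelian_free_Abelian_group)
    show "chain_complex t (\<lambda>p. free_Abelian_group (Y p)) (\<lambda>_. d)"
      unfolding chain_complex_def
    proof (intro allI conjI ballI)
      fix p x
      show "d \<in> hom (free_Abelian_group (Y p)) (free_Abelian_group (Y (p + t)))"
        by (rule hom_free_Abelian_groupI[OF additive_d keys_d'])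
      assume "x \<in> carrier (free_Abelian_group (Y p))"
      then have "x \<in> frags \<Omega>" using Y\<Omega>[of p] by auto
      then show "d (d x) = \<one>\<^bsub>free_Abelian_group (Y (p + t + t))\<^esub>" by (simp only: d_d_frags one_free_Abelian_group)
    qed (rule abelian_free_Abelian_group)
    show "\<forall>p. \<phi> (p + t) = \<phi> p + s" using \<phi>(2) by blast
    have r_hom: "r \<in> hom (free_Abelian_group (Y p)) (free_Abelian_group (X (\<phi> p)))" for p
      by (rule hom_free_Abelian_groupI[OF add_r keys_r])
    have f_hom: "f \<in> hom (free_Abelian_group (X (\<phi> p))) (free_Abelian_group (Y p))" for p
      by (rule hom_free_Abelian_groupI[OF add_f keys_f]) (auto simp: X_def)
    have F_hom: "htpy \<in> hom (free_Abelian_group (Y p)) (free_Abelian_group (Y (p - t)))" for p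
      by (rule hom_free_Abelian_groupI[OF additive_htpy]) (use keys_htpy in \<open>auto simp: Y_def\<close>)
    have F: "d (htpy y) \<otimes>\<^bsub>free_Abelian_group (Y p)\<^esub> htpy (d y) =
        y \<otimes>\<^bsub>free_Abelian_group (Y p)\<^esub> inv\<^bsub>free_Abelian_group (Y p)\<^esub> f (r y)"
      if y: "y \<in> carrier (free_Abelian_group (Y p))" for y p
    proof -
      have "y \<in> frags \<Omega>" using y Y\<Omega> by auto
      moreover have "Poly_Mapping.keys (f (r y)) \<subseteq> Y p"
        using hom_in_carrier[OF f_hom hom_in_carrier[OF r_hom y]] by simp
      ultimately show ?thesis by (simp add: fr proj_def)
    qed
    have Dr': "r (d y) = D (r y)" if "y \<in> carrier (free_Abelian_group (Y p))" for y p
      using Dr[of y] that Y\<Omega>[of p] by auto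
    have fD': "f (D x) = d (f x)" if "x \<in> carrier (free_Abelian_group (X q))" for x q
      using fD[of x] that X\<Theta>[of q] by auto
    have rf': "r (f x) = x" if "x \<in> carrier (free_Abelian_group (X q))" for x q
      using rf[of x] that X\<Theta>[of q] by auto
    show "\<exists>r f F.
        (\<forall>p. r p \<in> hom (free_Abelian_group (Y p)) (free_Abelian_group (X (\<phi> p))) \<and>
             (\<forall>y \<in> carrier (free_Abelian_group (Y p)). r (p + t) (d y) = D (r p y))) \<and>
        (\<forall>p. f p \<in> hom (free_Abelian_group (X (\<phi> p))) (free_Abelian_group (Y p)) \<and>
             (\<forall>x \<in> carrier (free_Abelian_group (X (\<phi> p))). f (p + t) (D x) = d (f p x))) \<and>
        (\<forall>p. \<forall>x \<in> carrier (free_Abelian_group (X (\<phi> p))). r p (f p x) = x) \<and>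
        (\<forall>p. F p \<in> hom (free_Abelian_group (Y p)) (free_Abelian_group (Y (p - t))) \<and>
             (\<forall>y \<in> carrier (free_Abelian_group (Y p)).
                d (F p y) \<otimes>\<^bsub>free_Abelian_group (Y p)\<^esub> F (p + t) (d y) =
                  y \<otimes>\<^bsub>free_Abelian_group (Y p)\<^esub> inv\<^bsub>free_Abelian_group (Y p)\<^esub> f p (r p y)))"
      by (rule exI[of _ "\<lambda>_. r"], rule exI[of _ "\<lambda>_. f"], rule exI[of _ "\<lambda>_. htpy"])
        (intro conjI allI ballI r_hom f_hom F_hom F Dr' fD' rf', assumption+)
  qed
  then show ?thesis unfolding X_def Y_def by blast
qed

end

section \<open>Homology of a deformation retract\<close>

lemma subgroup_kernel:
  assumes "group G" "group H" "h \<in> hom G H"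
  shows "subgroup (kernel G H h) G"
proof -
  interpret group_hom G H h using assms by (simp add: group_hom_def group_hom_axioms_def)
  show ?thesis by (rule subgroup_kernel)
qed

locale complex_at =
  fixes X0 X1 X2 :: "'a monoid" and d0 d1 :: "'a \<Rightarrow> 'a"
  assumes X: "comm_group X0" "comm_group X1" "comm_group X2"
    and d: "d0 \<in> hom X0 X1" "d1 \<in> hom X1 X2"
    and dd: "\<And>x. x \<in> carrier X0 \<Longrightarrow> d1 (d0 x) = \<one>\<^bsub>X2\<^esub>"
begin

abbreviation "cycles \<equiv> subgroup_generated X1 (kernel X1 X2 d1)"
abbreviation "boundaries \<equiv> d0 ` carrier X0"

lemma groups: "group X0" "group X1" "group X2"
  using X by (auto simp: comm_group_def)

lemma subgroup_cycles: "subgroup (kernel X1 X2 d1) X1"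
  by (rule subgroup_kernel[OF groups(2,3) d(2)])

lemma carrier_cycles: "carrier cycles = kernel X1 X2 d1"
  by (rule subgroup.carrier_subgroup_generated_subgroup[OF subgroup_cycles])

lemma comm_group_cycles: "comm_group cycles"
  using X(2) by (simp add: group.abelian_subgroup_generated groups(2))

lemma boundaries_subset: "boundaries \<subseteq> kernel X1 X2 d1"
  using d dd by (auto simp: kernel_def hom_def)

lemma subgroup_boundaries: "subgroup boundaries cycles"
proof -
  have "subgroup boundaries X1"
    by (rule group_hom.img_is_subgroup) (simp add: group_hom_def group_hom_axioms_def groups d)
  then show ?thesis
    by (meson boundaries_subset group.subgroup_of_subgroup_generated groups(2))
qed

lemma normal_boundaries: "boundaries \<lhd> cycles"
  using comm_group.normal_iff_subgroup[OF comm_group_cycles] subgroup_boundaries by blast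

lemma coset_eq_iff:
  assumes "x \<in> kernel X1 X2 d1"
  shows "boundaries #>\<^bsub>cycles\<^esub> x = boundaries \<longleftrightarrow> x \<in> boundaries"
  using assms subgroup_boundaries group.coset_join1[of cycles] group.coset_join2[of cycles]
  by (metis carrier_cycles comm_group.axioms(2) comm_group_cycles subgroup.subset)

end

lemma chain_complex_at:
  assumes "chain_complex s X d"
  shows "complex_at (X (p - s)) (X p) (X (p + s)) (d (p - s)) (d p)"
  using assms unfolding chain_complex_def complex_at_def
  by (metis diff_add_cancel)

text \<open>\<open>r\<close> induces the isomorphism. It is onto because \<open>f\<close> sends
  cycles to cycles and \<open>r\<close> undoes \<open>f\<close>; a cycle \<open>y\<close> whose
  image \<open>r p y\<close> is a boundary is itself a boundary by the homotopy formula.\<close>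

theorem homology_deformation_retract:
  assumes "deformation_retract \<phi> s X dX t Y dY"
  shows "homology t Y dY p \<cong> homology s X dX (\<phi> p)"
proof -
  have XY: "chain_complex s X dX" "chain_complex t Y dY" and \<phi>: "\<And>p. \<phi> (p + t) = \<phi> p + s"
    using assms by (auto simp: deformation_retract_def)
  have \<phi>': "\<phi> (p - t) = \<phi> p - s"
    using \<phi>[of "p - t"] by (simp add: algebra_simps)
  obtain r f F where
    r: "\<And>p. r p \<in> hom (Y p) (X (\<phi> p))"
      "\<And>p y. y \<in> carrier (Y p) \<Longrightarrow> r (p + t) (dY p y) = dX (\<phi> p) (r p y)"
    and f: "\<And>p. f p \<in> hom (X (\<phi> p)) (Y p)"
      "\<And>p x. x \<in> carrier (X (\<phi> p)) \<Longrightarrow> f (p + t) (dX (\<phi> p) x) = dY p (f p x)"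
    and rf: "\<And>p x. x \<in> carrier (X (\<phi> p)) \<Longrightarrow> r p (f p x) = x"
    and F: "\<And>p. F p \<in> hom (Y p) (Y (p - t))"
      "\<And>p y. y \<in> carrier (Y p) \<Longrightarrow>
        dY (p - t) (F p y) \<otimes>\<^bsub>Y p\<^esub> F (p + t) (dY p y) = y \<otimes>\<^bsub>Y p\<^esub> inv\<^bsub>Y p\<^esub> f p (r p y)"
    using assms unfolding deformation_retract_def by metis
  define q where "q = \<phi> p"
  interpret Y: complex_at "Y (p - t)" "Y p" "Y (p + t)" "dY (p - t)" "dY p"
    by (rule chain_complex_at[OF XY(2)])
  interpret X: complex_at "X (q - s)" "X q" "X (q + s)" "dX (q - s)" "dX q"
    by (rule chain_complex_at[OF XY(1)])
  interpret XN: normal X.boundaries X.cycles by (rule X.normal_boundaries)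
  interpret Yp: comm_group "Y p" by (rule Y.X(2))
  have r_car: "r p y \<in> carrier (X q)" if "y \<in> carrier (Y p)" for y
    using r(1)[of p] that by (auto simp: hom_def q_def)
  have f_car: "f p x \<in> carrier (Y p)" if "x \<in> carrier (X q)" for x
    using f(1)[of p] that by (auto simp: hom_def q_def)
  have r1: "r p' \<one>\<^bsub>Y p'\<^esub> = \<one>\<^bsub>X (\<phi> p')\<^esub>" for p'
    using XY r(1)[of p'] unfolding chain_complex_def by (meson comm_group.axioms(2) hom_one)
  have f1: "f p' \<one>\<^bsub>X (\<phi> p')\<^esub> = \<one>\<^bsub>Y p'\<^esub>" for p'
    using XY f(1)[of p'] unfolding chain_complex_def by (meson comm_group.axioms(2) hom_one)
  have F1: "F p' \<one>\<^bsub>Y p'\<^esub> = \<one>\<^bsub>Y (p' - t)\<^esub>" for p'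
    using XY F(1)[of p'] unfolding chain_complex_def by (meson comm_group.axioms(2) hom_one)
  have rK: "r p y \<in> kernel (X q) (X (q + s)) (dX q)" if "y \<in> kernel (Y p) (Y (p + t)) (dY p)" for y
    using that r(2)[of y p] r1[of "p + t"] r_car by (simp add: kernel_def q_def \<phi>)
  have fK: "f p x \<in> kernel (Y p) (Y (p + t)) (dY p)" if "x \<in> kernel (X q) (X (q + s)) (dX q)" for x
    using that f(2)[of x p] f1[of "p + t"] f_car by (simp add: kernel_def q_def \<phi>)
  define h where "h y = X.boundaries #>\<^bsub>X.cycles\<^esub> r p y" for y
  have hom: "h \<in> hom Y.cycles (X.cycles Mod X.boundaries)"
  proof (rule homI)
    fix y assume "y \<in> carrier Y.cycles"
    then show "h y \<in> carrier (X.cycles Mod X.boundaries)"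
      using rK by (auto simp: h_def Y.carrier_cycles X.carrier_cycles FactGroup_def RCOSETS_def)
  next
    fix y z assume yz: "y \<in> carrier Y.cycles" "z \<in> carrier Y.cycles"
    then have "r p (y \<otimes>\<^bsub>Y p\<^esub> z) = r p y \<otimes>\<^bsub>X q\<^esub> r p z"
      using r(1)[of p] unfolding Y.carrier_cycles by (auto simp: hom_def q_def kernel_def)
    then show "h (y \<otimes>\<^bsub>Y.cycles\<^esub> z) = h y \<otimes>\<^bsub>X.cycles Mod X.boundaries\<^esub> h z"
      using XN.rcos_sum[of "r p y" "r p z"] yz rK
      by (simp add: h_def Y.carrier_cycles X.carrier_cycles FactGroup_def)
  qed
  interpret group_hom Y.cycles "X.cycles Mod X.boundaries" h
    using hom Y.comm_group_cycles XN.factorgroup_is_group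
    by (simp add: group_hom_def group_hom_axioms_def comm_group.axioms(2))
  have "h ` carrier Y.cycles = carrier (X.cycles Mod X.boundaries)"
  proof
    show "carrier (X.cycles Mod X.boundaries) \<subseteq> h ` carrier Y.cycles"
    proof
      fix c assume "c \<in> carrier (X.cycles Mod X.boundaries)"
      then obtain x where x: "x \<in> kernel (X q) (X (q + s)) (dX q)" "c = X.boundaries #>\<^bsub>X.cycles\<^esub> x"
        by (auto simp: FactGroup_def RCOSETS_def X.carrier_cycles)
      then have "c = h (f p x)" using rf[of x p] by (simp add: h_def q_def kernel_def)
      then show "c \<in> h ` carrier Y.cycles" using fK[OF x(1)] by (simp add: Y.carrier_cycles)
    qed
  qed (use hom in \<open>auto simp: hom_def\<close>)
  moreover have "kernel Y.cycles (X.cycles Mod X.boundaries) h = Y.boundaries"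
  proof
    show "kernel Y.cycles (X.cycles Mod X.boundaries) h \<subseteq> Y.boundaries"
    proof
      fix y assume y: "y \<in> kernel Y.cycles (X.cycles Mod X.boundaries) h"
      then have yK: "y \<in> kernel (Y p) (Y (p + t)) (dY p)" and "h y = X.boundaries"
        unfolding kernel_def[of Y.cycles] Y.carrier_cycles by (auto simp: FactGroup_def)
      then have "r p y \<in> X.boundaries" using X.coset_eq_iff[OF rK[OF yK]] by (simp add: h_def)
      then obtain w where w: "w \<in> carrier (X (q - s))" "r p y = dX (q - s) w" by auto
      have yc: "y \<in> carrier (Y p)" "dY p y = \<one>\<^bsub>Y (p + t)\<^esub>" using yK by (auto simp: kernel_def)
      have wY: "f (p - t) w \<in> carrier (Y (p - t))"
        using f(1)[of "p - t"] w(1) \<phi>' by (auto simp: hom_def q_def)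
      have Fy: "F p y \<in> carrier (Y (p - t))" using F(1)[of p] yc by (auto simp: hom_def)
      have e1: "f p (r p y) = dY (p - t) (f (p - t) w)"
        using f(2)[of w "p - t"] w \<phi>' by (simp add: q_def)
      have dF: "dY (p - t) (F p y) \<in> carrier (Y p)" "dY (p - t) (f (p - t) w) \<in> carrier (Y p)"
        using Y.d(1) Fy wY by (auto simp: hom_def)
      \<comment> \<open>As \<open>y\<close> is a cycle, one term of the homotopy formula is the
        unit, and \<open>f p (r p y)\<close> is the boundary of the image of \<open>w\<close>.
        Solving for \<open>y\<close> exhibits it as a boundary.\<close>
      have "dY (p - t) (F p y) = y \<otimes>\<^bsub>Y p\<^esub> inv\<^bsub>Y p\<^esub> dY (p - t) (f (p - t) w)"
        using F(2)[OF yc(1)] F1[of "p + t"] dF by (simp add: yc e1)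
      then have "dY (p - t) (F p y) \<otimes>\<^bsub>Y p\<^esub> dY (p - t) (f (p - t) w) = y"
        using dF yc(1) by (simp add: Yp.m_assoc)
      then have "y = dY (p - t) (F p y \<otimes>\<^bsub>Y (p - t)\<^esub> f (p - t) w)"
        using Y.d(1) Fy wY by (simp add: hom_def)
      moreover have "F p y \<otimes>\<^bsub>Y (p - t)\<^esub> f (p - t) w \<in> carrier (Y (p - t))"
        using Fy wY Y.groups(1) by (simp add: group.is_monoid monoid.m_closed)
      ultimately show "y \<in> Y.boundaries" by blast
    qed
    show "Y.boundaries \<subseteq> kernel Y.cycles (X.cycles Mod X.boundaries) h"
    proof
      fix y assume y: "y \<in> Y.boundaries"
      then obtain z where z: "z \<in> carrier (Y (p - t))" "y = dY (p - t) z" by auto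
      have yK: "y \<in> kernel (Y p) (Y (p + t)) (dY p)" using Y.boundaries_subset y by auto
      have "r (p - t) z \<in> carrier (X (q - s))"
        using r(1)[of "p - t"] z(1) \<phi>' by (auto simp: hom_def q_def)
      moreover have "r p y = dX (q - s) (r (p - t) z)"
        using r(2)[OF z(1)] z(2) \<phi>' by (simp add: q_def)
      ultimately have "h y = X.boundaries"
        unfolding h_def X.coset_eq_iff[OF rK[OF yK]] by blast
      then show "y \<in> kernel Y.cycles (X.cycles Mod X.boundaries) h"
        using yK by (simp add: kernel_def[of Y.cycles] Y.carrier_cycles FactGroup_def)
    qed
  qed
  ultimately show ?thesis
    using FactGroup_iso by (simp add: homology_def q_def)
qed

section \<open>Uniting two classes of an equivalence relation\<close>

text \<open>For an equivalence relation \<open>R\<close> this is the equivalence relation generated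
  by \<open>R\<close> and \<open>(p, q)\<close>; the closed form decides membership without
  paths.\<close>

definition unite :: "('a \<times> 'a) set \<Rightarrow> 'a \<Rightarrow> 'a \<Rightarrow> ('a \<times> 'a) set" where
  "unite R p q = R \<union> {(a, b). (a, p) \<in> R \<and> (q, b) \<in> R} \<union> {(a, b). (a, q) \<in> R \<and> (p, b) \<in> R}"

lemma equiv_UNIV_D:
  assumes "equiv UNIV R"
  shows "(a, a) \<in> R" "(a, b) \<in> R \<Longrightarrow> (b, a) \<in> R" "(a, b) \<in> R \<Longrightarrow> (b, c) \<in> R \<Longrightarrow> (a, c) \<in> R"
  using assms unfolding equiv_def refl_on_def sym_def trans_def by blast+

lemma unite_iff:
  "(a, b) \<in> unite R p q \<longleftrightarrow> (a, b) \<in> R \<or> (a, p) \<in> R \<and> (q, b) \<in> R \<or> (a, q) \<in> R \<and> (p, b) \<in> R"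
  by (auto simp: unite_def)

lemma unite_absorb:
  assumes "equiv UNIV R" "(p, q) \<in> R"
  shows "unite R p q = R"
proof -
  have "(a, b) \<in> unite R p q \<longleftrightarrow> (a, b) \<in> R" for a b
    unfolding unite_iff using assms(2) by (metis equiv_UNIV_D(2,3)[OF assms(1)])
  then show ?thesis by auto
qed

lemma unite_commute: "unite R p q = unite R q p"
  by (auto simp: unite_def)

lemma equiv_unite:
  assumes "equiv UNIV R"
  shows "equiv UNIV (unite R p q)"
proof -
  note E = equiv_UNIV_D[OF assms]
  show ?thesis
  proof (rule equivI)
    show "refl (unite R p q)" using E(1) by (auto simp: refl_on_def unite_iff)
    show "sym (unite R p q)" by (rule symI) (metis E(2) unite_iff)
    show "trans (unite R p q)"
    proof (rule transI)
      fix a b c assume "(a, b) \<in> unite R p q" "(b, c) \<in> unite R p q"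
      then show "(a, c) \<in> unite R p q"
        unfolding unite_iff by (metis E(2,3))
    qed
  qed simp
qed

lemma unite_least:
  assumes "equiv UNIV R'" "R \<subseteq> R'" "(p, q) \<in> R'"
  shows "unite R p q \<subseteq> R'"
proof
  fix z assume "z \<in> unite R p q"
  then obtain a b where "z = (a, b)" "(a, b) \<in> unite R p q" by (cases z) auto
  then show "z \<in> R'"
    using assms(2,3) equiv_UNIV_D(2,3)[OF assms(1)] unfolding unite_iff by (metis subsetD)
qed

lemma class_eq_iff: "equiv UNIV R \<Longrightarrow> R `` {a} = R `` {b} \<longleftrightarrow> (a, b) \<in> R"
  by (simp add: equiv_class_eq_iff)

lemma class_unite:
  assumes "equiv UNIV R"
  shows "unite R p q `` {a} = (if a \<in> R `` {p} \<union> R `` {q} then R `` {p} \<union> R `` {q} else R `` {a})"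
proof -
  note E = equiv_UNIV_D[OF assms]
  have "b \<in> unite R p q `` {a} \<longleftrightarrow>
      b \<in> (if a \<in> R `` {p} \<union> R `` {q} then R `` {p} \<union> R `` {q} else R `` {a})" for b
    by (simp add: unite_iff) (metis E(2,3))
  then show ?thesis by blast
qed

lemma image_Diff_cong:
  assumes "\<And>a. a \<in> Q \<Longrightarrow> f a \<in> Z \<longleftrightarrow> a \<in> W" "\<And>a. a \<in> Q \<Longrightarrow> a \<notin> W \<Longrightarrow> g a = f a"
  shows "f ` Q - Z = g ` (Q - W)"
proof -
  have "f ` Q - Z = f ` (Q - W)" using assms(1) by auto
  also have "\<dots> = g ` (Q - W)" by (rule image_cong) (use assms(2) in auto)
  finally show ?thesis .
qed

text \<open>Uniting leaves alone exactly the classes that contain neither \<open>p\<close> nor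
  \<open>q\<close>; both sides list those that meet \<open>Q\<close>.\<close>

lemma image_class_unite:
  assumes "equiv UNIV R"
  shows "(\<lambda>a. R `` {a}) ` Q - {R `` {p}, R `` {q}} =
    (\<lambda>a. unite R p q `` {a}) ` (Q - unite R p q `` {p})"
proof -
  have dp: "unite R p q `` {p} = R `` {p} \<union> R `` {q}"
    using class_unite[OF assms, of p q p] equiv_UNIV_D(1)[OF assms] by simp
  have "R `` {a} \<notin> {R `` {p}, R `` {q}} \<longleftrightarrow> a \<notin> R `` {p} \<union> R `` {q}" for a
    using class_eq_iff[OF assms, of p a] class_eq_iff[OF assms, of q a] by auto
  moreover have "unite R p q `` {a} = R `` {a}" if "a \<notin> R `` {p} \<union> R `` {q}" for a
    using class_unite[OF assms, of p q a] that by simp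
  ultimately show ?thesis unfolding dp by (intro image_Diff_cong) auto
qed

lemma card_class_unite:
  assumes "equiv UNIV R" "finite Q" "(p, q) \<notin> R" "p \<in> Q" "q \<in> Q"
  shows "card ((\<lambda>a. R `` {a}) ` Q) = Suc (card ((\<lambda>a. unite R p q `` {a}) ` Q))"
proof -
  let ?c = "\<lambda>a. R `` {a}" and ?d = "\<lambda>a. unite R p q `` {a}"
  note E = equiv_UNIV_D[OF assms(1)]
  have "?c ` Q = insert (?c p) (insert (?c q) (?c ` Q - {?c p, ?c q}))"
    using assms by auto
  moreover have "?c p \<noteq> ?c q" using class_eq_iff[OF assms(1)] assms(3) by simp
  ultimately have 1: "card (?c ` Q) = Suc (Suc (card (?c ` Q - {?c p, ?c q})))"
    using assms(2) by (metis (no_types, lifting) DiffD2 card_insert_disjoint finite_Diff finite_imageI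
        finite_insert insertCI insertE)
  have eq: "?d p = ?d a" if "a \<in> ?d p" for a
    using that equiv_class_eq[OF equiv_unite[OF assms(1)], of p a p q] by auto
  have "?d ` Q = insert (?d p) (?d ` (Q - ?d p))"
    using assms(4) eq by (auto simp: image_iff)
  moreover have "?d p \<notin> ?d ` (Q - ?d p)"
    using equiv_UNIV_D(1)[OF equiv_unite[OF assms(1)], of _ p q] by auto
  ultimately have 2: "card (?d ` Q) = Suc (card (?d ` (Q - ?d p)))"
    using assms(2) by (metis card_insert_disjoint finite_Diff finite_imageI)
  show ?thesis using 1 2 image_class_unite[OF assms(1), of Q p q] by simp
qed

section \<open>Systems of circles with surgeries\<close>

definition flip :: "'a \<Rightarrow> 'a set \<Rightarrow> 'a set" where
  "flip c B = (if c \<in> B then B - {c} else insert c B)"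

lemma flip_flip [simp]: "flip c (flip c B) = B"
  by (auto simp: flip_def)

lemma in_flip_iff: "e \<in> flip c B \<longleftrightarrow> (if e = c then c \<notin> B else e \<in> B)"
  by (auto simp: flip_def)

lemma flip_commute: "flip c (flip e B) = flip e (flip c B)"
  by (auto simp: flip_def)

text \<open>Smoothings without the diagram: \<open>E B\<close> relates points on a common circle,
  and \<open>x c\<close>, \<open>y c\<close> lie on the two strands at \<open>c\<close>. By
  \<open>unite_flip\<close> a surgery affects only the circles through these points, and by
  \<open>xor_flip\<close> it always merges two circles or splits one.\<close>

locale circle_system =
  fixes n :: nat and A :: "'a set" and E :: "nat set \<Rightarrow> ('a \<times> 'a) set"
    and x y :: "nat \<Rightarrow> 'a" and base :: 'a
  assumes finite_A: "finite A" and base_A: "base \<in> A"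
    and xy_A: "\<And>c. c < n \<Longrightarrow> x c \<in> A" "\<And>c. c < n \<Longrightarrow> y c \<in> A"
    and equiv_E: "\<And>B. equiv UNIV (E B)"
    and E_A: "\<And>B a b. (a, b) \<in> E B \<Longrightarrow> a \<in> A \<Longrightarrow> b \<in> A"
    and unite_flip: "\<And>c B. c < n \<Longrightarrow> unite (E (flip c B)) (x c) (y c) = unite (E B) (x c) (y c)"
    and xor_flip: "\<And>c B. c < n \<Longrightarrow> (x c, y c) \<in> E (flip c B) \<longleftrightarrow> (x c, y c) \<notin> E B"
begin

section \<open>Merging and splitting circles\<close>

lemmas E = equiv_UNIV_D[OF equiv_E]

abbreviation "cl B a \<equiv> E B `` {a}"
abbreviation "cls B Q \<equiv> (\<lambda>a. E B `` {a}) ` Q"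
abbreviation "circ B \<equiv> cls B A"

lemma cl_eq_iff: "cl B a = cl B b \<longleftrightarrow> (a, b) \<in> E B"
  by (rule class_eq_iff[OF equiv_E])

text \<open>After the flip the two points share a circle by \<open>xor_flip\<close>, so uniting them
  there changes nothing, and \<open>unite_flip\<close> gives the new relation.\<close>

lemma E_merge:
  assumes "c < n" "(x c, y c) \<notin> E B"
  shows "E (flip c B) = unite (E B) (x c) (y c)"
  using unite_flip[OF assms(1), of B] unite_absorb[OF equiv_E, of "x c" "y c" "flip c B"]
    xor_flip[OF assms(1), of B] assms by simp

lemma E_split:
  assumes "c < n" "(x c, y c) \<in> E B"
  shows "E B = unite (E (flip c B)) (x c) (y c)"
  using E_merge[OF assms(1), of "flip c B"] xor_flip[OF assms(1), of B] assms(2) by simp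

lemma cls_cl: "cls B (cl B a) = {cl B a}"
proof -
  have "cls B (cl B a) = (\<lambda>_. cl B a) ` cl B a"
    by (rule image_cong[OF refl]) (metis Image_singleton_iff cl_eq_iff)
  also have "\<dots> = {cl B a}" using E(1)[of a B] by blast
  finally show ?thesis .
qed

lemma cls_Un_cl: "cls B (Q \<union> cl B a) = insert (cl B a) (cls B Q)"
  by (simp add: image_Un cls_cl)

text \<open>A set of positive circles is encoded by the set \<open>Q\<close> of the arcs on them.
  Unlike a set of circles, the same \<open>Q\<close> can be read in several smoothings.\<close>

definition sat :: "nat set \<Rightarrow> 'a set \<Rightarrow> bool" where
  "sat B Q \<longleftrightarrow> Q \<subseteq> A \<and> (\<forall>a b. (a, b) \<in> E B \<longrightarrow> a \<in> Q \<longrightarrow> b \<in> Q)"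

lemma satD: "sat B Q \<Longrightarrow> (a, b) \<in> E B \<Longrightarrow> a \<in> Q \<longleftrightarrow> b \<in> Q"
  unfolding sat_def using E(2) by blast

lemma sat_subset: "sat B Q \<Longrightarrow> Q \<subseteq> A"
  by (simp add: sat_def)

lemma sat_class: "sat B Q \<Longrightarrow> cl B a \<in> cls B Q \<longleftrightarrow> a \<in> Q"
  using cl_eq_iff satD by (auto simp: image_iff)

lemma sat_Union: "sat B Q \<Longrightarrow> \<Union> (cls B Q) = Q"
  unfolding sat_def using E(1) by blast

lemma sat_Un_class: "sat B Q \<Longrightarrow> a \<in> A \<Longrightarrow> sat B (Q \<union> cl B a)"
  unfolding sat_def using E(3) E_A by blast

lemma sat_Diff_class: "sat B Q \<Longrightarrow> sat B (Q - cl B a)"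
  unfolding sat_def using E(2,3) by blast

lemma sat_mono: "E B' \<subseteq> E B \<Longrightarrow> sat B Q \<Longrightarrow> sat B' Q"
  unfolding sat_def by blast

lemma classes_subset: "Q \<subseteq> A \<Longrightarrow> cls B Q \<subseteq> circ B"
  by blast

lemma states_sat:
  assumes "P \<subseteq> circ B"
  shows "sat B (\<Union>P)" "cls B (\<Union>P) = P"
proof -
  have P: "C = cl B a" "a \<in> A" if Ca: "C \<in> P" "a \<in> C" for C a
  proof -
    obtain b where b: "b \<in> A" "C = cl B b" using assms Ca by blast
    then show "C = cl B a" "a \<in> A" using Ca cl_eq_iff E_A by auto
  qed
  show "sat B (\<Union>P)" unfolding sat_def using P by blast
  have "C \<in> cls B (\<Union>P)" if C: "C \<in> P" for C
  proof -
    obtain b where b: "b \<in> A" "C = cl B b" using assms C by auto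
    then have "b \<in> \<Union>P" using C E(1) by blast
    then show ?thesis using b by blast
  qed
  then show "cls B (\<Union>P) = P" using P by blast
qed

lemma merge_subset: "c < n \<Longrightarrow> (x c, y c) \<notin> E B \<Longrightarrow> E B \<subseteq> E (flip c B)"
  using E_merge by (simp add: unite_def) blast

lemma split_subset: "c < n \<Longrightarrow> (x c, y c) \<in> E B \<Longrightarrow> E (flip c B) \<subseteq> E B"
  using merge_subset[of c "flip c B"] xor_flip by simp

lemma class_merge:
  assumes "c < n" "(x c, y c) \<notin> E B"
  shows "cl (flip c B) a =
    (if a \<in> cl B (x c) \<union> cl B (y c) then cl B (x c) \<union> cl B (y c) else cl B a)"
  unfolding E_merge[OF assms] by (rule class_unite[OF equiv_E])

lemma gone_made_merge:
  assumes "c < n" "(x c, y c) \<notin> E B"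
  shows "circ B - circ (flip c B) = {cl B (x c), cl B (y c)}"
    "circ (flip c B) - circ B = {cl (flip c B) (x c)}"
proof -
  have d: "cl B (x c) \<noteq> cl B (y c)" using assms cl_eq_iff by simp
  have xy: "x c \<in> A" "y c \<in> A" using xy_A assms by auto
  have mem: "x c \<in> cl B (x c)" "y c \<in> cl B (y c)" using E(1) by auto
  have disj: "x c \<notin> cl B (y c)" "y c \<notin> cl B (x c)" using assms E(2) by blast+
  note cm = class_merge[OF assms]
  have ne: "cl B (x c) \<union> cl B (y c) \<noteq> cl B a" for a
  proof
    assume "cl B (x c) \<union> cl B (y c) = cl B a"
    then have "(a, x c) \<in> E B" "(a, y c) \<in> E B" using mem by blast+
    then show False using assms(2) E(2,3) by blast
  qed
  have mx: "cl (flip c B) (x c) = cl B (x c) \<union> cl B (y c)" using mem(1) by (simp add: cm)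
  have notin: "cl B (x c) \<noteq> cl (flip c B) a" "cl B (y c) \<noteq> cl (flip c B) a" for a
  proof -
    have "cl (flip c B) a = cl B (x c) \<union> cl B (y c) \<or> x c \<notin> cl (flip c B) a \<and> y c \<notin> cl (flip c B) a"
      unfolding cm using E(2)[of a "x c" B] E(2)[of a "y c" B] by auto
    then show "cl B (x c) \<noteq> cl (flip c B) a" "cl B (y c) \<noteq> cl (flip c B) a"
      using mem disj by auto
  qed
  have keep: "cl B a = cl (flip c B) a" if "cl B a \<noteq> cl B (x c)" "cl B a \<noteq> cl B (y c)" for a
    unfolding cm using that cl_eq_iff[of B "x c" a] cl_eq_iff[of B "y c" a] by auto
  have new: "cl (flip c B) a = cl B a \<or> cl (flip c B) a = cl (flip c B) (x c)" for a
    unfolding mx unfolding cm by simp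
  show "circ B - circ (flip c B) = {cl B (x c), cl B (y c)}"
  proof (intro equalityI subsetI)
    fix C assume "C \<in> circ B - circ (flip c B)"
    then obtain a where a: "a \<in> A" "C = cl B a" "C \<notin> circ (flip c B)" by auto
    then have "cl B a \<noteq> cl (flip c B) a" by auto
    then show "C \<in> {cl B (x c), cl B (y c)}" using keep[of a] a(2) by blast
  next
    fix C assume C: "C \<in> {cl B (x c), cl B (y c)}"
    then have "C \<in> circ B" using xy by auto
    moreover have "C \<notin> circ (flip c B)" using C notin by auto
    ultimately show "C \<in> circ B - circ (flip c B)" by simp
  qed
  show "circ (flip c B) - circ B = {cl (flip c B) (x c)}"
  proof (intro equalityI subsetI)
    fix C assume "C \<in> circ (flip c B) - circ B"
    then obtain a where a: "a \<in> A" "C = cl (flip c B) a" "C \<notin> circ B" by auto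
    then have "cl (flip c B) a \<noteq> cl B a" by auto
    then show "C \<in> {cl (flip c B) (x c)}" using new[of a] a(2) by auto
  next
    fix C assume C: "C \<in> {cl (flip c B) (x c)}"
    then have "C \<in> circ (flip c B)" using xy by auto
    moreover have "C \<notin> circ B" using C ne mx by auto
    ultimately show "C \<in> circ (flip c B) - circ B" by simp
  qed
qed

lemma gone_made_split:
  assumes "c < n" "(x c, y c) \<in> E B"
  shows "circ B - circ (flip c B) = {cl B (x c)}"
    "circ (flip c B) - circ B = {cl (flip c B) (x c), cl (flip c B) (y c)}"
  using gone_made_merge[of c "flip c B"] xor_flip assms by auto

lemma card_classes_merge:
  assumes "c < n" "(x c, y c) \<notin> E B" "finite Q" "x c \<in> Q" "y c \<in> Q"
  shows "card (cls B Q) = Suc (card (cls (flip c B) Q))"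
  unfolding E_merge[OF assms(1,2)] using assms(2-) card_class_unite[OF equiv_E] by blast

lemma card_classes_disjoint:
  assumes "c < n" "(x c, y c) \<notin> E B" "sat B Q" "x c \<notin> Q" "y c \<notin> Q"
  shows "cls (flip c B) Q = cls B Q"
proof (rule image_cong[OF refl])
  fix a assume "a \<in> Q"
  then have "a \<notin> cl B (x c) \<union> cl B (y c)" using satD[OF assms(3)] assms(4,5) by blast
  then show "cl (flip c B) a = cl B a" by (simp add: class_merge[OF assms(1,2)])
qed

text \<open>The formula of \<open>resolve_map\<close> for an arbitrary circle system, which keeps
  the algebra independent of diagrams.\<close>

definition resolve :: "nat \<Rightarrow> nat set \<times> 'a set set \<Rightarrow> ((nat set \<times> 'a set set) \<Rightarrow>\<^sub>0 int)" where
  "resolve c = (\<lambda>(B, P).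
     let B' = insert c B;
         gone = circ B - circ B';
         made = circ B' - circ B;
         rest = P - gone
     in if card gone = 2 then
          (if gone \<inter> P = {} then frag_of (B', rest)
           else if gone \<subseteq> P then 0
           else frag_of (B', rest \<union> made))
        else
          (if gone \<subseteq> P then frag_of (B', rest \<union> made)
           else (\<Sum>z \<in> made. frag_of (B', insert z rest))))"

definition st :: "nat set \<Rightarrow> 'a set \<Rightarrow> nat set \<times> 'a set set" where
  "st B Q = (B, cls B Q)"

section \<open>Surgery in terms of positive arcs\<close>

lemma insert_flip: "c \<notin> B \<Longrightarrow> insert c B = flip c B"
  by (simp add: flip_def)

lemma resolve_merge:
  assumes "c < n" "c \<notin> B" "(x c, y c) \<notin> E B" "sat B Q"
  shows "resolve c (st B Q) =
    (if x c \<in> Q \<and> y c \<in> Q then 0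
     else if x c \<in> Q \<or> y c \<in> Q then frag_of (st (flip c B) (Q \<union> cl (flip c B) (x c)))
     else frag_of (st (flip c B) Q))"
proof -
  let ?B = "flip c B"
  note gm = gone_made_merge[OF assms(1,3)]
  have c2: "card {cl B (x c), cl B (y c)} = 2" using assms(3) cl_eq_iff by simp
  have rest: "cls B Q - {cl B (x c), cl B (y c)} = cls ?B (Q - cl ?B (x c))"
    unfolding E_merge[OF assms(1,3)] by (rule image_class_unite[OF equiv_E])
  have "cls ?B (Q - cl ?B (x c)) \<union> {cl ?B (x c)} = cls ?B (Q \<union> cl ?B (x c))"
  proof -
    have "Q \<union> cl ?B (x c) = (Q - cl ?B (x c)) \<union> cl ?B (x c)" by blast
    then show ?thesis using cls_Un_cl[of ?B "Q - cl ?B (x c)" "x c"] by simp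
  qed
  note both = this
  have none: "cls B Q - {cl B (x c), cl B (y c)} = cls ?B Q" if "x c \<notin> Q" "y c \<notin> Q"
  proof -
    have "a \<notin> cl B (x c)" "a \<notin> cl B (y c)" if "a \<in> Q" for a
      using satD[OF assms(4), of "x c" a] satD[OF assms(4), of "y c" a] that \<open>x c \<notin> Q\<close> \<open>y c \<notin> Q\<close>
      by auto
    moreover have "cl ?B (x c) = cl B (x c) \<union> cl B (y c)"
      using class_merge[OF assms(1,3), of "x c"] E(1) by simp
    ultimately have "Q - cl ?B (x c) = Q" by blast
    then show ?thesis using rest by simp
  qed
  show ?thesis
    unfolding resolve_def st_def prod.case Let_def insert_flip[OF assms(2)] gm c2
    using none both
    by (simp add: rest sat_class[OF assms(4)])
qed

lemma resolve_split:
  assumes "c < n" "c \<notin> B" "(x c, y c) \<in> E B" "sat B Q"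
  shows "resolve c (st B Q) =
    (if x c \<in> Q then frag_of (st (flip c B) Q)
     else frag_of (st (flip c B) (Q \<union> cl (flip c B) (x c)))
        + frag_of (st (flip c B) (Q \<union> cl (flip c B) (y c))))"
proof -
  let ?B = "flip c B"
  note gm = gone_made_split[OF assms(1,3)]
  have nxy: "(x c, y c) \<notin> E ?B" using xor_flip assms by simp
  have EB: "E B = unite (E ?B) (x c) (y c)" by (rule E_split[OF assms(1,3)])
  have sat': "sat ?B Q" by (rule sat_mono[OF split_subset[OF assms(1,3)] assms(4)])
  have ne: "cl ?B (x c) \<noteq> cl ?B (y c)" using nxy cl_eq_iff by simp
  have cl': "cl B a = (if a \<in> cl ?B (x c) \<union> cl ?B (y c) then cl ?B (x c) \<union> cl ?B (y c) else cl ?B a)" for a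
    using class_merge[OF assms(1) nxy] by simp
  have rest: "cls ?B Q - {cl ?B (x c), cl ?B (y c)} = cls B (Q - cl B (x c))"
    unfolding EB by (rule image_class_unite[OF equiv_E])
  have diff: "cls B Q - {cl B (x c)} = cls B (Q - cl B (x c))"
    using cl_eq_iff[of B "x c"] by (intro image_Diff_cong) auto
  have yQ: "y c \<in> Q \<longleftrightarrow> x c \<in> Q" using satD[OF assms(4,3)] by simp
  have in': "cls B Q - {cl B (x c)} \<union> {cl ?B (x c), cl ?B (y c)} = cls ?B Q" if "x c \<in> Q"
    unfolding diff rest[symmetric] using that yQ by blast
  have out: "cls B Q - {cl B (x c)} = cls ?B Q" if "x c \<notin> Q"
    unfolding diff rest[symmetric] using that yQ sat_class[OF sat', of "x c"] sat_class[OF sat', of "y c"]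
    by blast
  note ins = cls_Un_cl[of ?B Q, symmetric]
  have def_eq: "resolve c (st B Q) =
      (if cl B (x c) \<in> cls B Q
       then frag_of (?B, cls B Q - {cl B (x c)} \<union> {cl ?B (x c), cl ?B (y c)})
       else (\<Sum>z \<in> {cl ?B (x c), cl ?B (y c)}. frag_of (?B, insert z (cls B Q - {cl B (x c)}))))"
    unfolding resolve_def st_def prod.case Let_def insert_flip[OF assms(2)] gm by simp
  show ?thesis
  proof (cases "x c \<in> Q")
    case True
    then show ?thesis unfolding def_eq sat_class[OF assms(4)] in'[OF True] by (simp add: st_def)
  next
    case False
    then show ?thesis unfolding def_eq sat_class[OF assms(4)] out[OF False]
      using ne by (simp add: st_def ins)
  qed
qed

end

section \<open>The Khovanov differential\<close>

context circle_system
begin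

text \<open>In the Frobenius algebra behind the complex, minus is the unit and plus an element of
  square zero. This is multiplication by the latter on the circle through \<open>a\<close>.\<close>

definition plus_at :: "'a \<Rightarrow> ((nat set \<times> 'a set set) \<Rightarrow>\<^sub>0 int) \<Rightarrow> ((nat set \<times> 'a set set) \<Rightarrow>\<^sub>0 int)" where
  "plus_at a = frag_extend (\<lambda>(B, P). if cl B a \<in> P then 0 else frag_of (B, insert (cl B a) P))"

definition surgery :: "nat \<Rightarrow> ((nat set \<times> 'a set set) \<Rightarrow>\<^sub>0 int) \<Rightarrow> ((nat set \<times> 'a set set) \<Rightarrow>\<^sub>0 int)" where
  "surgery c = frag_extend (resolve c)"

lemma additive_plus_at: "additive (plus_at a)" and additive_surgery: "additive (surgery c)"
  unfolding plus_at_def surgery_def by (rule additive_frag_extend)+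

lemmas plus_at_add = additive.add[OF additive_plus_at]
lemmas surgery_add = additive.add[OF additive_surgery]
lemmas plus_at_0 = additive.zero[OF additive_plus_at]
lemmas surgery_0 = additive.zero[OF additive_surgery]

lemma surgery_of [simp]: "surgery c (frag_of s) = resolve c s"
  by (simp add: surgery_def)

lemma sat_finite: "sat B Q \<Longrightarrow> finite Q"
  using sat_subset finite_A by (rule finite_subset)

lemma plus_at_st:
  "sat B Q \<Longrightarrow> plus_at a (frag_of (st B Q)) = (if a \<in> Q then 0 else frag_of (st B (Q \<union> cl B a)))"
  by (simp add: plus_at_def st_def sat_class cls_Un_cl)

lemma plus_at_commute_st:
  assumes "sat B Q" "a \<in> A" "b \<in> A"
  shows "plus_at a (plus_at b (frag_of (st B Q))) = plus_at b (plus_at a (frag_of (st B Q)))"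
proof -
  have *: "a \<in> cl B b \<longleftrightarrow> b \<in> cl B a" using E(2) by auto
  have "a \<in> cl B b \<Longrightarrow> a \<in> Q \<longleftrightarrow> b \<in> Q" using satD[OF assms(1), of b a] by auto
  then show ?thesis
    using * by (simp add: plus_at_st assms sat_Un_class plus_at_0 Un_ac)
qed

text \<open>The state without positive circles is the unit: a merge preserves it, and a split sends
  it to the coproduct of the unit, written as a sum of multiplications at the two strands.\<close>

lemma resolve_none:
  assumes "c < n" "c \<notin> B"
  shows "resolve c (st B {}) =
    (if (x c, y c) \<in> E B
     then plus_at (x c) (frag_of (st (flip c B) {})) + plus_at (y c) (frag_of (st (flip c B) {}))
     else frag_of (st (flip c B) {}))"
proof -
  have "sat B' {}" for B' by (simp add: sat_def)
  then show ?thesis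
    using resolve_merge[OF assms, of "{}"] resolve_split[OF assms, of "{}"] by (simp add: plus_at_st)
qed

lemma sat_merge_closed:
  assumes "c < n" "(x c, y c) \<notin> E B" "sat B Q" "x c \<in> Q \<longleftrightarrow> y c \<in> Q"
  shows "sat (flip c B) Q"
  unfolding sat_def
proof (intro conjI allI impI)
  show "Q \<subseteq> A" by (rule sat_subset[OF assms(3)])
  fix a b assume "(a, b) \<in> E (flip c B)" "a \<in> Q"
  then show "b \<in> Q" unfolding E_merge[OF assms(1,2)] unite_iff using satD[OF assms(3)] assms(4) by metis
qed

lemma sat_merge_Un:
  assumes "c < n" "(x c, y c) \<notin> E B" "sat B Q"
  shows "sat (flip c B) (Q \<union> cl (flip c B) (x c))"
proof (rule sat_merge_closed[OF assms(1,2)])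
  have "cl (flip c B) (x c) = cl B (x c) \<union> cl B (y c)"
    using class_merge[OF assms(1,2), of "x c"] E(1) by simp
  then show "sat B (Q \<union> cl (flip c B) (x c))"
    using sat_Un_class[OF sat_Un_class[OF assms(3)]] xy_A assms(1) by (simp add: Un_assoc)
  show "x c \<in> Q \<union> cl (flip c B) (x c) \<longleftrightarrow> y c \<in> Q \<union> cl (flip c B) (x c)"
    using E(1)[of "x c"] xor_flip[OF assms(1), of B] assms(2) by simp
qed

lemma tau_merge_Un:
  assumes "c < n" "(x c, y c) \<notin> E B" "sat B Q" "(x c \<in> Q) \<noteq> (y c \<in> Q)"
  shows "card (cls (flip c B) (Q \<union> cl (flip c B) (x c))) = card (cls B Q)"
proof -
  have cl': "cl (flip c B) (x c) = cl B (x c) \<union> cl B (y c)"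
    using class_merge[OF assms(1,2), of "x c"] E(1) by simp
  have abs: "Q \<union> cl B a = Q" if "a \<in> Q" for a using satD[OF assms(3), of a] that by auto
  have "\<exists>z. z \<notin> Q \<and> Q \<union> cl (flip c B) (x c) = Q \<union> cl B z"
  proof (cases "x c \<in> Q")
    case True
    then show ?thesis using assms(4) abs[OF True] cl' by (intro exI[of _ "y c"]) auto
  next
    case False
    then show ?thesis using assms(4) abs[of "y c"] cl' by (intro exI[of _ "x c"]) auto
  qed
  then obtain z where z: "z \<notin> Q" and Q: "Q \<union> cl (flip c B) (x c) = Q \<union> cl B z" by blast
  have fin: "finite (Q \<union> cl (flip c B) (x c))"
    by (rule sat_finite[OF sat_merge_Un[OF assms(1-3)]])
  have "card (cls B (Q \<union> cl (flip c B) (x c))) = Suc (card (cls B Q))"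
    unfolding Q cls_Un_cl using z sat_class[OF assms(3), of z] fin by simp
  moreover have "card (cls B (Q \<union> cl (flip c B) (x c))) = Suc (card (cls (flip c B) (Q \<union> cl (flip c B) (x c))))"
    by (rule card_classes_merge[OF assms(1,2) fin]) (use cl' E(1) in auto)
  ultimately show ?thesis by simp
qed

lemma card_circ_flip:
  assumes "c < n"
  shows "int (card (circ (flip c B))) = int (card (circ B)) + (if (x c, y c) \<in> E B then 1 else -1)"
  using card_classes_merge[OF assms _ finite_A, of B] card_classes_merge[OF assms _ finite_A, of "flip c B"]
    xy_A[OF assms] xor_flip[OF assms, of B] by auto

text \<open>The last equation says that \<open>state_tau\<close> rises by one, which balances the
  rise of \<open>i\<close> and leaves \<open>j\<close> unchanged. The inclusion of \<open>Q\<close>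
  in the new set keeps the circle through the basepoint positive.\<close>

lemma resolve_keys:
  assumes "c < n" "c \<notin> B" "sat B Q" "s \<in> Poly_Mapping.keys (resolve c (st B Q))"
  shows "\<exists>Q'. s = st (flip c B) Q' \<and> sat (flip c B) Q' \<and> Q \<subseteq> Q' \<and>
    2 * int (card (cls (flip c B) Q')) - int (card (circ (flip c B))) =
      2 * int (card (cls B Q)) - int (card (circ B)) + 1"
proof (cases "(x c, y c) \<in> E B")
  case False
  note cc = card_circ_flip[OF assms(1), of B]
  show ?thesis
  proof (cases "x c \<in> Q \<longleftrightarrow> y c \<in> Q")
    case True
    then have s: "x c \<notin> Q" "y c \<notin> Q" "s = st (flip c B) Q"
      using assms(4) by (auto simp: resolve_merge[OF assms(1,2) False assms(3)] split: if_splits)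
    then show ?thesis
      using sat_merge_closed[OF assms(1) False assms(3) True] cc False
        card_classes_disjoint[OF assms(1) False assms(3)] by (intro exI[of _ Q]) simp
  next
    case xy: False
    then have s: "s = st (flip c B) (Q \<union> cl (flip c B) (x c))"
      using assms(4) by (auto simp: resolve_merge[OF assms(1,2) False assms(3)] split: if_splits)
    show ?thesis
      using s sat_merge_Un[OF assms(1) False assms(3)] tau_merge_Un[OF assms(1) False assms(3) xy] cc False
      by (intro exI[of _ "Q \<union> cl (flip c B) (x c)"]) simp
  qed
next
  case True
  note cc = card_circ_flip[OF assms(1), of B]
  have nxy: "(x c, y c) \<notin> E (flip c B)" using xor_flip assms True by simp
  have sat': "sat (flip c B) Q" by (rule sat_mono[OF split_subset[OF assms(1) True] assms(3)])
  have fin: "finite Q" by (rule sat_finite[OF assms(3)])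
  have yQ: "y c \<in> Q \<longleftrightarrow> x c \<in> Q" using satD[OF assms(3) True] by simp
  show ?thesis
  proof (cases "x c \<in> Q")
    case xQ: True
    have "card (cls (flip c B) Q) = Suc (card (cls B Q))"
      using card_classes_merge[OF assms(1) nxy fin] xQ yQ by simp
    then show ?thesis
      using assms(4) xQ sat' cc True
      by (intro exI[of _ Q]) (simp add: resolve_split[OF assms(1,2) True assms(3)])
  next
    case xQ: False
    have "cls (flip c B) Q = cls B Q"
      using card_classes_disjoint[OF assms(1) nxy sat'] xQ yQ by simp
    then have *: "card (cls (flip c B) (Q \<union> cl (flip c B) z)) = Suc (card (cls B Q))" if "z \<notin> Q" for z
      unfolding cls_Un_cl using that sat_class[OF sat', of z] fin by simp
    have "s \<in> {st (flip c B) (Q \<union> cl (flip c B) (x c)), st (flip c B) (Q \<union> cl (flip c B) (y c))}"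
      using assms(4) xQ keys_add[of "frag_of (st (flip c B) (Q \<union> cl (flip c B) (x c)))"
        "frag_of (st (flip c B) (Q \<union> cl (flip c B) (y c)))"]
      by (auto simp: resolve_split[OF assms(1,2) True assms(3)])
    then obtain z where z: "z \<in> {x c, y c}" "s = st (flip c B) (Q \<union> cl (flip c B) z)" by auto
    then have "sat (flip c B) (Q \<union> cl (flip c B) z)" "z \<notin> Q"
      using sat_Un_class[OF sat'] xy_A[OF assms(1)] xQ yQ by auto
    then show ?thesis using z(2) * cc True by (intro exI[of _ "Q \<union> cl (flip c B) z"]) simp
  qed
qed

text \<open>Linearity of the surgery over the algebra acting at \<open>a\<close>: the arc persists
  although its circle changes. The cases distinguish whether the circle through \<open>a\<close>
  takes part in the surgery, and at which strand.\<close>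

lemma plus_at_resolve:
  assumes "c < n" "c \<notin> B" "sat B Q" "a \<in> A"
  shows "surgery c (plus_at a (frag_of (st B Q))) = plus_at a (resolve c (st B Q))"
proof (cases "a \<in> Q")
  case True
  have "plus_at a (frag_of s) = 0" if "s \<in> Poly_Mapping.keys (resolve c (st B Q))" for s
    using resolve_keys[OF assms(1-3) that] True by (auto simp: plus_at_st)
  then have "plus_at a (resolve c (st B Q)) = 0"
    using additive_frag_eq[OF additive_plus_at _ order_refl, of "\<lambda>_. 0"] by (simp add: additive_def)
  then show ?thesis using True by (simp add: plus_at_st assms surgery_0)
next
  case aQ: False
  let ?B = "flip c B"
  define Q' where "Q' = Q \<union> cl B a"
  have satQ': "sat B Q'" unfolding Q'_def by (rule sat_Un_class[OF assms(3,4)])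
  have lhs: "surgery c (plus_at a (frag_of (st B Q))) = resolve c (st B Q')"
    using aQ by (simp add: plus_at_st assms Q'_def)
  have sym: "u \<in> cl B' v \<longleftrightarrow> v \<in> cl B' u" for u v B' using E(2) by auto
  have satcl: "u \<in> cl B v \<Longrightarrow> u \<in> Q \<longleftrightarrow> v \<in> Q" for u v using satD[OF assms(3), of v u] by auto
  show ?thesis
  proof (cases "(x c, y c) \<in> E B")
    case False
    note cm = class_merge[OF assms(1) False]
    have clx: "cl ?B (x c) = cl B (x c) \<union> cl B (y c)" using cm[of "x c"] E(1) by simp
    have yx: "y c \<notin> cl B (x c)" "x c \<notin> cl B (y c)" using False E(2) by auto
    note rm = resolve_merge[OF assms(1,2) False]
    have satU: "sat ?B (Q \<union> cl ?B (x c))" by (rule sat_merge_Un[OF assms(1) False assms(3)])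
    have satN: "sat ?B Q" if "x c \<notin> Q" "y c \<notin> Q"
      using sat_merge_closed[OF assms(1) False assms(3)] that by simp
    consider "a \<in> cl B (x c)" | "a \<in> cl B (y c)" | "a \<notin> cl B (x c)" "a \<notin> cl B (y c)" by blast
    then show ?thesis
    proof cases
      case 1
      then have e: "cl B a = cl B (x c)" "cl ?B a = cl ?B (x c)" "x c \<notin> Q" "a \<in> cl ?B (x c)"
        using satcl[OF 1] aQ cm clx cl_eq_iff[of B "x c" a] by auto
      have "y c \<in> Q' \<longleftrightarrow> y c \<in> Q" "x c \<in> Q'" using e yx E(1) by (auto simp: Q'_def)
      moreover have "Q' \<union> cl ?B (x c) = Q \<union> cl ?B (x c)" using e clx by (auto simp: Q'_def)
      ultimately show ?thesis
        unfolding lhs rm[OF satQ'] rm[OF assms(3)]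
        using e aQ satU satN by (simp add: plus_at_st plus_at_0)
    next
      case 2
      then have e: "cl B a = cl B (y c)" "cl ?B a = cl ?B (x c)" "y c \<notin> Q" "a \<in> cl ?B (x c)"
        using satcl[OF 2] aQ cm clx cl_eq_iff[of B "y c" a] by auto
      have "x c \<in> Q' \<longleftrightarrow> x c \<in> Q" "y c \<in> Q'" using e yx E(1) by (auto simp: Q'_def)
      moreover have "Q' \<union> cl ?B (x c) = Q \<union> cl ?B (x c)" using e clx by (auto simp: Q'_def)
      ultimately show ?thesis
        unfolding lhs rm[OF satQ'] rm[OF assms(3)]
        using e aQ satU satN by (simp add: plus_at_st plus_at_0)
    next
      case 3
      then have e: "cl ?B a = cl B a" "a \<notin> cl ?B (x c)" using cm clx by auto
      have "x c \<in> Q' \<longleftrightarrow> x c \<in> Q" "y c \<in> Q' \<longleftrightarrow> y c \<in> Q" using 3 sym[of "x c" B a] sym[of "y c" B a] by (auto simp: Q'_def)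
      moreover have "Q' \<union> cl ?B (x c) = Q \<union> cl ?B (x c) \<union> cl ?B a" "Q' = Q \<union> cl ?B a"
        using e by (auto simp: Q'_def)
      ultimately show ?thesis
        unfolding lhs rm[OF satQ'] rm[OF assms(3)]
        using e aQ satU satN by (simp add: plus_at_st plus_at_0)
    qed
  next
    case True
    have nxy: "(x c, y c) \<notin> E ?B" using xor_flip assms True by simp
    have cm: "cl B a = (if a \<in> cl ?B (x c) \<union> cl ?B (y c) then cl ?B (x c) \<union> cl ?B (y c) else cl ?B a)" for a
      using class_merge[OF assms(1) nxy] by simp
    have clx: "cl B (x c) = cl ?B (x c) \<union> cl ?B (y c)" using cm[of "x c"] E(1) by simp
    have yx: "u \<notin> cl ?B (y c)" if "u \<in> cl ?B (x c)" for u
      using nxy that by (metis E(2,3) Image_singleton_iff)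
    note rs = resolve_split[OF assms(1,2) True]
    have sat': "sat ?B Q" by (rule sat_mono[OF split_subset[OF assms(1) True] assms(3)])
    have satU: "sat ?B (Q \<union> cl ?B (x c))" "sat ?B (Q \<union> cl ?B (y c))"
      using sat_Un_class[OF sat'] xy_A[OF assms(1)] by auto
    consider "a \<in> cl ?B (x c)" | "a \<in> cl ?B (y c)" | "a \<notin> cl ?B (x c)" "a \<notin> cl ?B (y c)" by blast
    then show ?thesis
    proof cases
      case 1
      have "x c \<notin> Q" using 1 clx satcl[of a "x c"] aQ by auto
      moreover have "cl B a = cl B (x c)" "cl ?B a = cl ?B (x c)" "a \<notin> cl ?B (y c)"
        using 1 cm clx yx cl_eq_iff[of ?B "x c" a] by auto
      moreover have "Q \<union> cl ?B (y c) \<union> cl ?B (x c) = Q \<union> cl B (x c)" using clx by auto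
      ultimately show ?thesis
        unfolding lhs rs[OF satQ'] rs[OF assms(3)]
        using 1 aQ satU E(1)[of "x c" B] by (simp add: plus_at_st plus_at_add Q'_def)
    next
      case 2
      have "x c \<notin> Q" using 2 clx satcl[of a "x c"] aQ by auto
      moreover have "cl B a = cl B (x c)" "cl ?B a = cl ?B (y c)" "a \<notin> cl ?B (x c)"
        using 2 cm clx yx cl_eq_iff[of ?B "y c" a] by auto
      moreover have "Q \<union> cl ?B (x c) \<union> cl ?B (y c) = Q \<union> cl B (x c)" using clx by auto
      ultimately show ?thesis
        unfolding lhs rs[OF satQ'] rs[OF assms(3)]
        using 2 aQ satU E(1)[of "x c" B] by (simp add: plus_at_st plus_at_add Q'_def)
    next
      case 3
      then have e: "cl B a = cl ?B a" "a \<notin> cl B (x c)" using cm clx by auto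
      have "x c \<in> Q' \<longleftrightarrow> x c \<in> Q" using e(2) sym[of "x c" B a] by (auto simp: Q'_def)
      moreover have "Q \<union> cl ?B z \<union> cl ?B a = Q' \<union> cl ?B z" "Q \<union> cl ?B a = Q'" for z
        using e by (auto simp: Q'_def)
      ultimately show ?thesis
        unfolding lhs rs[OF satQ'] rs[OF assms(3)]
        using 3 aQ satU sat' by (simp add: plus_at_st plus_at_add)
    qed
  qed
qed

lemma plus_at_surgery:
  assumes "c < n" "c \<notin> B" "a \<in> A" "Poly_Mapping.keys z \<subseteq> {st B Q | Q. sat B Q}"
  shows "surgery c (plus_at a z) = plus_at a (surgery c z)"
  by (rule additive_frag_eq[OF additive_comp[OF additive_surgery additive_plus_at]
        additive_comp[OF additive_plus_at additive_surgery] assms(4)])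
    (use plus_at_resolve[OF assms(1,2) _ assms(3)] in auto)

section \<open>Surgeries at different crossings commute\<close>

lemma sat_empty: "sat B {}"
  by (simp add: sat_def)

text \<open>Each surgery is trivial or multiplication by a sum over two strands, and these
  multiplications commute. Only the types of the surgeries may depend on the order; when they do,
  each order has one merge and one split, and both splits multiply by the same element.\<close>

lemma resolve_commute_none:
  assumes c: "c < n" "c \<notin> B" and e: "e < n" "e \<notin> B" and ce: "c \<noteq> e"
  shows "surgery e (resolve c (st B {})) = surgery c (resolve e (st B {}))"
proof -
  define v where "v = frag_of (st (flip e (flip c B)) {})"
  define F where "F p u z = (if p then plus_at (x u) z + plus_at (y u) z else z)" for p u z
  have formula: "surgery e (resolve c (st B {})) =
      F ((x c, y c) \<in> E B) c (F ((x e, y e) \<in> E (flip c B)) e (frag_of (st (flip e (flip c B)) {})))"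
    if "c < n" "c \<notin> B" "e < n" "e \<notin> B" "c \<noteq> e" for c e
  proof -
    have e': "e \<notin> flip c B" using that by (simp add: in_flip_iff)
    have "surgery e (plus_at a (frag_of (st (flip c B) {}))) = plus_at a (resolve e (st (flip c B) {}))"
      if "a \<in> A" for a
      by (rule plus_at_resolve[OF \<open>e < n\<close> e' sat_empty that])
    then show ?thesis
      using xy_A that by (simp add: resolve_none F_def surgery_add e')
  qed
  have comm: "plus_at a (plus_at b v) = plus_at b (plus_at a v)" if "a \<in> A" "b \<in> A" for a b
    unfolding v_def by (rule plus_at_commute_st[OF sat_empty that])
  have FF: "F p c (F q e v) = F q e (F p c v)" for p q
    using xy_A c(1) e(1) by (simp add: F_def plus_at_add comm algebra_simps)
  \<comment> \<open>Both orders end in the same smoothing, so the total change in the number of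
    circles agrees; it determines how many of the two surgeries are splits.\<close>
  have "(if (x c, y c) \<in> E B then 1 else -1) + (if (x e, y e) \<in> E (flip c B) then 1 else -1) =
      (if (x e, y e) \<in> E B then 1 else -1) + (if (x c, y c) \<in> E (flip e B) then 1 else (-1::int))"
    using card_circ_flip[OF c(1), of B] card_circ_flip[OF e(1), of "flip c B"]
      card_circ_flip[OF e(1), of B] card_circ_flip[OF c(1), of "flip e B", unfolded flip_commute[of c e B]]
    by linarith
  then have count: "(x c, y c) \<in> E B \<and> (x e, y e) \<in> E (flip c B) \<longleftrightarrow> (x e, y e) \<in> E B \<and> (x c, y c) \<in> E (flip e B)"
    "(x c, y c) \<in> E B \<or> (x e, y e) \<in> E (flip c B) \<longleftrightarrow> (x e, y e) \<in> E B \<or> (x c, y c) \<in> E (flip e B)"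
    by (simp_all split: if_splits)
  have "F ((x c, y c) \<in> E B) c (F ((x e, y e) \<in> E (flip c B)) e v) =
        F ((x e, y e) \<in> E B) e (F ((x c, y c) \<in> E (flip e B)) c v)"
  proof (cases "(x c, y c) \<in> E B \<longleftrightarrow> (x c, y c) \<in> E (flip e B)")
    case True
    then have "(x e, y e) \<in> E B \<longleftrightarrow> (x e, y e) \<in> E (flip c B)"
      using count by argo+
    then show ?thesis using True FF by simp
  next
    case False
    then have ne: "(x e, y e) \<in> E B \<longleftrightarrow> (x c, y c) \<in> E B" "(x e, y e) \<in> E (flip c B) \<longleftrightarrow> (x c, y c) \<in> E (flip e B)"
      using count by argo+
    have cls_eq: "plus_at a v = plus_at b v" if "(a, b) \<in> E (flip e (flip c B))" for a b
      using that cl_eq_iff[of "flip e (flip c B)" a b] unfolding v_def by (simp add: plus_at_st sat_empty)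
    \<comment> \<open>In the final smoothing the ends of \<open>c\<close> lie, in some order, on the
      circles through the ends of \<open>e\<close>.\<close>
    have "plus_at (x c) v + plus_at (y c) v = plus_at (x e) v + plus_at (y e) v"
    proof (cases "(x c, y c) \<in> E B")
      case True
      then have h: "(x e, y e) \<in> E B" "(x e, y e) \<notin> E (flip c B)" using False ne by auto
      have B: "E B = unite (E (flip c B)) (x c) (y c)" by (rule E_split[OF c(1) True])
      have B2: "E (flip e (flip c B)) = unite (E (flip c B)) (x e) (y e)" by (rule E_merge[OF e(1) h(2)])
      have "(x e, x c) \<in> E (flip c B) \<and> (y c, y e) \<in> E (flip c B) \<or>
          (x e, y c) \<in> E (flip c B) \<and> (x c, y e) \<in> E (flip c B)"
        using h unfolding B unite_iff by blast
      then have "(x c, x e) \<in> E (flip e (flip c B))" "(y c, y e) \<in> E (flip e (flip c B))"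
        unfolding B2 unite_iff using E(1,2) by metis+
      then show ?thesis using cls_eq by simp
    next
      case nc: False
      then have h: "(x e, y e) \<notin> E B" "(x e, y e) \<in> E (flip c B)" "(x c, y c) \<in> E (flip e B)"
        using False ne by auto
      have n1: "(x e, y e) \<notin> E (flip e (flip c B))" using xor_flip[OF e(1)] h by simp
      have n2: "(x c, y c) \<notin> E (flip e (flip c B))"
        using xor_flip[OF c(1), of "flip e B"] h by (simp add: flip_commute[of e c])
      have B1: "E (flip c B) = unite (E (flip e (flip c B))) (x e) (y e)" by (rule E_split[OF e(1) h(2)])
      have "(x c, y c) \<in> E (flip c B)" using xor_flip[OF c(1)] nc by simp
      then have "(x c, x e) \<in> E (flip e (flip c B)) \<and> (y c, y e) \<in> E (flip e (flip c B)) \<or>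
          (x c, y e) \<in> E (flip e (flip c B)) \<and> (y c, x e) \<in> E (flip e (flip c B))"
        using n2 unfolding B1 unite_iff by (metis E(2))
      then show ?thesis using cls_eq by (auto simp: add.commute)
    qed
    then show ?thesis using False ne by (auto simp: F_def)
  qed
  then show ?thesis
    using formula[OF c e ce] formula[OF e c ce[symmetric]]
    by (simp add: v_def flip_commute[of e c])
qed

text \<open>A state with positive circles arises by multiplication from one with fewer of them, and
  surgeries commute with this multiplication, so the state without positive circles decides.\<close>

lemma resolve_commute:
  assumes c: "c < n" "c \<notin> B" and e: "e < n" "e \<notin> B" and ce: "c \<noteq> e" and sat: "sat B Q"
  shows "surgery e (resolve c (st B Q)) = surgery c (resolve e (st B Q))"
  using sat
proof (induction "card Q" arbitrary: Q rule: less_induct)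
  case less
  show ?case
  proof (cases "Q = {}")
    case True
    then show ?thesis using resolve_commute_none[OF c e ce] by simp
  next
    case False
    then obtain a where a: "a \<in> Q" by blast
    define R where "R = Q - cl B a"
    have R: "sat B R" unfolding R_def by (rule sat_Diff_class[OF less.prems])
    have aA: "a \<in> A" using sat_subset[OF less.prems] a by blast
    have aR: "a \<notin> R" using E(1) by (simp add: R_def)
    have QR: "Q = R \<union> cl B a" using satD[OF less.prems, of a] a by (auto simp: R_def)
    have "card R < card Q"
      using a aR sat_subset[OF less.prems] finite_A
      by (metis QR Un_iff finite_subset psubsetI psubset_card_mono subsetI)
    note IH = less.hyps[OF this R]
    have v: "frag_of (st B Q) = plus_at a (frag_of (st B R))"
      using aR by (simp add: plus_at_st[OF R] QR)
    have step: "surgery e (resolve c (st B Q)) = plus_at a (surgery e (resolve c (st B R)))"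
      if "c < n" "c \<notin> B" "e < n" "e \<notin> B" "c \<noteq> e" for c e
    proof -
      have e': "e \<notin> flip c B" using that by (simp add: in_flip_iff)
      have "resolve c (st B Q) = plus_at a (resolve c (st B R))"
        using plus_at_resolve[OF that(1,2) R aA] v by (metis surgery_of)
      moreover have "Poly_Mapping.keys (resolve c (st B R)) \<subseteq> {st (flip c B) Q' | Q'. sat (flip c B) Q'}"
        using resolve_keys[OF that(1,2) R] by blast
      ultimately show ?thesis using plus_at_surgery[OF that(3) e' aA] by simp
    qed
    show ?thesis unfolding step[OF c e ce] step[OF e c ce[symmetric]] IH ..
  qed
qed

definition diff :: "((nat set \<times> 'a set set) \<Rightarrow>\<^sub>0 int) \<Rightarrow> ((nat set \<times> 'a set set) \<Rightarrow>\<^sub>0 int)" where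
  "diff = frag_extend (\<lambda>(B, P).
     \<Sum>c \<in> {..<n} - B. frag_cmul ((- 1) ^ card {b \<in> B. b < c}) (resolve c (B, P)))"

abbreviation sgn_at :: "nat \<Rightarrow> nat set \<Rightarrow> int" where
  "sgn_at c B \<equiv> (- 1) ^ card {b \<in> B. b < c}"

section \<open>The differential squares to zero\<close>

lemma additive_diff: "additive diff"
  unfolding diff_def by (rule additive_frag_extend)

lemma diff_st:
  "diff (frag_of (st B Q)) = (\<Sum>c \<in> {..<n} - B. frag_cmul (sgn_at c B) (resolve c (st B Q)))"
  by (simp add: diff_def st_def)

lemma additive_frag_cmul: "additive (frag_cmul k)"
  by (simp add: additive_def frag_cmul_distrib2)

lemma additive_sum: "(\<And>i. i \<in> I \<Longrightarrow> additive (f i)) \<Longrightarrow> additive (\<lambda>z. \<Sum>i\<in>I. f i z)"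
  by (simp add: additive_def sum.distrib)

lemma diff_states:
  assumes "Poly_Mapping.keys z \<subseteq> {st B Q | Q. sat B Q}"
  shows "diff z = (\<Sum>c \<in> {..<n} - B. frag_cmul (sgn_at c B) (surgery c z))"
proof (rule additive_frag_eq[OF additive_diff _ assms])
  show "additive (\<lambda>z. \<Sum>c \<in> {..<n} - B. frag_cmul (sgn_at c B) (surgery c z))"
    by (intro additive_sum additive_comp[OF additive_frag_cmul additive_surgery])
qed (auto simp: diff_st)

lemma sgn_at_antisym:
  assumes "c \<notin> B" "e \<notin> B" "c \<noteq> e" "finite B"
  shows "sgn_at c B * sgn_at e (flip c B) = - (sgn_at e B * sgn_at c (flip e B))"
proof -
  have *: "sgn_at e (flip c B) = (if c < e then - sgn_at e B else sgn_at e B)"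
    if "c \<notin> B" for c e
  proof (cases "c < e")
    case True
    then have "{b \<in> flip c B. b < e} = insert c {b \<in> B. b < e}" using that by (auto simp: flip_def)
    then show ?thesis using True that assms(4) by simp
  next
    case False
    then have "{b \<in> flip c B. b < e} = {b \<in> B. b < e}" using that by (auto simp: flip_def)
    then show ?thesis using False by simp
  qed
  show ?thesis using *[OF assms(1), of e] *[OF assms(2), of c] assms(3) by (cases "c < e") auto
qed

lemma diff_diff:
  assumes "B \<subseteq> {..<n}" "sat B Q"
  shows "diff (diff (frag_of (st B Q))) = 0"
proof -
  \<comment> \<open>The zero diagonal extends the sum to a full square, where the two indices can be
    exchanged.\<close>
  define t where "t c e = (if c = e then 0 else
      frag_cmul (sgn_at c B * sgn_at e (flip c B)) (surgery e (resolve c (st B Q))))" for c e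
  have fin: "finite B" using assms(1) finite_subset by blast
  have "diff (resolve c (st B Q)) =
      (\<Sum>e \<in> {..<n} - flip c B. frag_cmul (sgn_at e (flip c B)) (surgery e (resolve c (st B Q))))"
    if "c < n" "c \<notin> B" for c
    by (rule diff_states) (use resolve_keys[OF that assms(2)] in blast)
  moreover have "diff (frag_cmul k z) = frag_cmul k (diff z)" for k z
    by (simp add: diff_def frag_extend_cmul)
  moreover have "{..<n} - flip c B = {..<n} - B - {c}" if "c \<notin> B" for c
    using that by (auto simp: flip_def)
  ultimately have "diff (diff (frag_of (st B Q))) =
      (\<Sum>c \<in> {..<n} - B. \<Sum>e \<in> {..<n} - B - {c}.
         frag_cmul (sgn_at c B * sgn_at e (flip c B)) (surgery e (resolve c (st B Q))))"
    by (simp add: diff_st additive.sum[OF additive_diff] frag_cmul_sum)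
  also have "\<dots> = (\<Sum>c \<in> {..<n} - B. \<Sum>e \<in> {..<n} - B. t c e)"
    by (intro sum.cong sum.mono_neutral_cong_left) (auto simp: t_def)
  finally have dd: "diff (diff (frag_of (st B Q))) = (\<Sum>c \<in> {..<n} - B. \<Sum>e \<in> {..<n} - B. t c e)" .
  have anti: "t c e = - t e c" if "c \<in> {..<n} - B" "e \<in> {..<n} - B" for c e
    using that resolve_commute[of c B e, OF _ _ _ _ _ assms(2)] sgn_at_antisym[of c B e, OF _ _ _ fin]
    by (auto simp: t_def)
  have "(\<Sum>c \<in> {..<n} - B. \<Sum>e \<in> {..<n} - B. t c e) = (\<Sum>c \<in> {..<n} - B. \<Sum>e \<in> {..<n} - B. - t e c)"
    using anti by (intro sum.cong refl) blast
  also have "\<dots> = - (\<Sum>c \<in> {..<n} - B. \<Sum>e \<in> {..<n} - B. t c e)"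
    by (subst sum.swap) (simp add: sum_negf)
  \<comment> \<open>The sum equals its own negative, and the group has no 2-torsion.\<close>
  finally have "S = 0" if "S = (\<Sum>c \<in> {..<n} - B. \<Sum>e \<in> {..<n} - B. t c e)" for S
  proof -
    assume "(\<Sum>c \<in> {..<n} - B. \<Sum>e \<in> {..<n} - B. t c e) = - (\<Sum>c \<in> {..<n} - B. \<Sum>e \<in> {..<n} - B. t c e)"
    then have "S = - S" using that by simp
    then have "Poly_Mapping.lookup S s = - Poly_Mapping.lookup S s" for s by (metis lookup_uminus)
    then have "Poly_Mapping.lookup S s = 0" for s by (metis equal_neg_zero)
    then show "S = 0" by (intro poly_mapping_eqI) simp
  qed
  then show ?thesis using dd by simp
qed

end

section \<open>Live crossings and the matching\<close>

definition flips :: "'a set \<Rightarrow> 'a set \<Rightarrow> 'a set" where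
  "flips S B = {c. (c \<in> B) \<noteq> (c \<in> S)}"

lemma in_flips: "c \<in> flips S B \<longleftrightarrow> (c \<in> B) \<noteq> (c \<in> S)"
  by (simp add: flips_def)

lemma flips_empty [simp]: "flips {} B = B"
  by (auto simp: flips_def)

lemma flips_insert: "e \<notin> S \<Longrightarrow> flips (insert e S) B = flip e (flips S B)"
  by (auto simp: flips_def flip_def)

text \<open>What the matching needs to know about the Tait graph: \<open>U B\<close> consists of the
  live crossings, and \<open>N B\<close> orders the subcubes. By \<open>linked_flip\<close> changing
  a live crossing does not affect whether another one separates circles; by
  \<open>one_circle\<close> each subcube contains a smoothing with a single circle.\<close>

locale live_circles = circle_system +
  fixes U :: "nat set \<Rightarrow> nat set" and N :: "nat set \<Rightarrow> nat"
  assumes U_less: "\<And>e B. e \<in> U B \<Longrightarrow> e < n"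
    and U_flip: "\<And>e B. e \<in> U B \<Longrightarrow> U (flip e B) = U B"
    and N_flip: "\<And>e B. e \<in> U B \<Longrightarrow> N (flip e B) = N B"
    and N_less: "\<And>c B. c < n \<Longrightarrow> c \<notin> B \<Longrightarrow> c \<notin> U B \<Longrightarrow> N B < N (flip c B)"
    and linked_flip: "\<And>e g B. e \<in> U B \<Longrightarrow> g \<in> U B \<Longrightarrow> e \<noteq> g \<Longrightarrow>
          (x g, y g) \<in> E (flip e B) \<longleftrightarrow> (x g, y g) \<in> E B"
    and one_circle: "\<And>B a b. (\<And>e. e \<in> U B \<Longrightarrow> (x e, y e) \<in> E B) \<Longrightarrow> a \<in> A \<Longrightarrow> b \<in> A \<Longrightarrow> (a, b) \<in> E B"
begin

text \<open>The live crossings whose strands lie on different circles: those flipped away from the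
  smoothing with a single circle, which is \<open>root B\<close>.\<close>

definition Fl :: "nat set \<Rightarrow> nat set" where
  "Fl B = {e \<in> U B. (x e, y e) \<notin> E B}"

section \<open>The smoothings of one subcube\<close>

lemma finite_U: "finite (U B)"
  using U_less by (meson finite_nat_iff_bounded lessThan_iff subsetI)

lemma Fl_subset: "Fl B \<subseteq> U B"
  by (auto simp: Fl_def)

lemma finite_Fl: "finite (Fl B)"
  using Fl_subset finite_U by (rule finite_subset)

lemma Fl_flip:
  assumes "e \<in> U B"
  shows "g \<in> Fl (flip e B) \<longleftrightarrow> (if g = e then e \<notin> Fl B else g \<in> Fl B)"
  using assms U_flip[OF assms] linked_flip[OF assms, of g] xor_flip[OF U_less[OF assms], of B]
  by (auto simp: Fl_def)

lemma flips_live: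
  assumes "finite S" "S \<subseteq> U B"
  shows "U (flips S B) = U B" "N (flips S B) = N B" "Fl (flips S B) = flips S (Fl B)"
proof -
  have "U (flips S B) = U B \<and> N (flips S B) = N B \<and> Fl (flips S B) = flips S (Fl B)"
    using assms
  proof (induction S rule: finite_induct)
    case (insert e S)
    then have IH: "U (flips S B) = U B" "N (flips S B) = N B" "Fl (flips S B) = flips S (Fl B)"
      and e: "e \<in> U (flips S B)" by auto
    have "g \<in> Fl (flip e (flips S B)) \<longleftrightarrow> g \<in> flips (insert e S) (Fl B)" for g
      unfolding Fl_flip[OF e] IH(3) in_flips using insert.hyps(2) by auto
    then show ?case
      using IH U_flip[OF e] N_flip[OF e] by (simp add: flips_insert[OF insert.hyps(2)] set_eq_iff)
  qed simp
  then show "U (flips S B) = U B" "N (flips S B) = N B" "Fl (flips S B) = flips S (Fl B)" by auto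
qed

lemma E_unflip:
  assumes "e \<in> Fl B"
  shows "E (flip e B) = unite (E B) (x e) (y e)"
  using assms E_merge[OF U_less, of e B B] by (auto simp: Fl_def)

lemma E_flips_mono:
  assumes "finite S" "S \<subseteq> Fl B"
  shows "E B \<subseteq> E (flips S B)"
  using assms
proof (induction S rule: finite_induct)
  case (insert e S)
  have S: "S \<subseteq> U B" "e \<in> Fl B" using insert.prems Fl_subset by auto
  have "e \<in> Fl (flips S B)"
    using flips_live(3)[OF insert.hyps(1) S(1)] S(2) insert.hyps(2) by (simp add: in_flips)
  then have "E (flips S B) \<subseteq> E (flip e (flips S B))"
    using E_unflip by (auto simp: unite_def)
  then show ?case using insert by (auto simp: flips_insert)
qed simp

definition root :: "nat set \<Rightarrow> nat set" where
  "root B = flips (Fl B) B"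

lemma root_live: "U (root B) = U B" "Fl (root B) = {}"
  using flips_live[OF finite_Fl Fl_subset, of B] by (auto simp: root_def in_flips)

lemma root_flip:
  assumes "e \<in> U B"
  shows "root (flip e B) = root B"
  using Fl_flip[OF assms] by (auto simp: root_def in_flips in_flip_iff split: if_splits)

lemma in_root: "c \<in> root B \<longleftrightarrow> (if c \<in> Fl B then c \<notin> B else c \<in> B)"
  by (auto simp: root_def in_flips)

lemma E_root: "a \<in> A \<Longrightarrow> b \<in> A \<Longrightarrow> (a, b) \<in> E (root B)"
  by (rule one_circle) (use root_live in \<open>auto simp: Fl_def\<close>)

text \<open>For a live \<open>e\<close> this smoothing has just two circles, the two sides of
  \<open>e\<close>. It depends on \<open>B\<close> only through \<open>root B\<close>, so it is
  constant on the subcube.\<close>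

definition solo :: "nat \<Rightarrow> nat set \<Rightarrow> nat set" where
  "solo e B = flip e (root B)"

lemma solo_flip: "g \<in> U B \<Longrightarrow> solo e (flip g B) = solo e B"
  by (simp add: solo_def root_flip)

lemma solo_live:
  assumes "e \<in> U B"
  shows "U (solo e B) = U B" "Fl (solo e B) = {e}"
  using assms Fl_flip[of e "root B"] U_flip[of e "root B"] root_live[of B]
  by (auto simp: solo_def split: if_splits)

lemma E_solo_root: "e \<in> U B \<Longrightarrow> E (root B) = unite (E (solo e B)) (x e) (y e)"
  using E_unflip[of e "solo e B"] solo_live[of e B] by (simp add: solo_def)

lemma solo_not_linked: "e \<in> U B \<Longrightarrow> (x e, y e) \<notin> E (solo e B)"
  using solo_live(2)[of e B] by (auto simp: Fl_def)

lemma solo_eq_flips: "e \<in> Fl B \<Longrightarrow> solo e B = flips (Fl B - {e}) B"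
  by (auto simp: solo_def root_def in_flips in_flip_iff split: if_splits)

lemma E_solo: "e \<in> Fl B \<Longrightarrow> E B \<subseteq> E (solo e B)"
  unfolding solo_eq_flips by (rule E_flips_mono) (use finite_Fl in auto)

text \<open>The strand of \<open>e\<close> on the side away from the basepoint, judged in
  \<open>solo e B\<close> and therefore the same throughout the subcube.\<close>

definition far :: "nat \<Rightarrow> nat set \<Rightarrow> 'a" where
  "far e B = (if (x e, base) \<in> E (solo e B) then y e else x e)"

definition near :: "nat \<Rightarrow> nat set \<Rightarrow> 'a" where
  "near e B = (if (x e, base) \<in> E (solo e B) then x e else y e)"

section \<open>Nesting of the circles that are cut off\<close>

lemma far_near_cases:
  "(far e B = x e \<and> near e B = y e) \<or> (far e B = y e \<and> near e B = x e)"
  by (simp add: far_def near_def)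

lemma unite_far_near: "unite R (x e) (y e) = unite R (near e B) (far e B)"
  using far_near_cases[of e B] unite_commute by metis

lemma far_near_A: "e \<in> U B \<Longrightarrow> far e B \<in> A" "e \<in> U B \<Longrightarrow> near e B \<in> A"
  using far_near_cases[of e B] xy_A[OF U_less] by auto

lemma far_flip: "g \<in> U B \<Longrightarrow> far e (flip g B) = far e B" "g \<in> U B \<Longrightarrow> near e (flip g B) = near e B"
  by (simp_all add: far_def near_def solo_flip)

lemma far_near_solo:
  assumes "e \<in> U B"
  shows "(near e B, base) \<in> E (solo e B)" "(far e B, base) \<notin> E (solo e B)"
proof -
  have n: "(x e, y e) \<notin> E (solo e B)" by (rule solo_not_linked[OF assms])
  have "(x e, base) \<in> E (root B)" using E_root xy_A(1)[OF U_less[OF assms]] base_A by simp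
  then have "(x e, base) \<in> E (solo e B) \<or> (y e, base) \<in> E (solo e B)"
    unfolding E_solo_root[OF assms] unite_iff using n by blast
  moreover have "\<not> ((x e, base) \<in> E (solo e B) \<and> (y e, base) \<in> E (solo e B))"
    using n by (metis E(2,3))
  ultimately show "(near e B, base) \<in> E (solo e B)" "(far e B, base) \<notin> E (solo e B)"
    by (auto simp: near_def far_def)
qed

lemma far_not_near: "e \<in> Fl B \<Longrightarrow> (far e B, near e B) \<notin> E B"
  using far_near_cases[of e B] E(2)[of "far e B" "near e B" B] by (auto simp: Fl_def)

lemma near_eq_far: "e \<in> U B \<Longrightarrow> e \<notin> Fl B \<Longrightarrow> (near e B, far e B) \<in> E B"
  using far_near_cases[of e B] E(2)[of "x e" "y e" B] by (auto simp: Fl_def)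

lemma far_not_base: "e \<in> Fl B \<Longrightarrow> (far e B, base) \<notin> E B"
  using far_near_solo(2)[of e B] E_solo[of e B] Fl_subset by blast

text \<open>Here \<open>e\<close> and \<open>g\<close> alone remain flipped. Since
  \<open>E B\<close> only grows on the way, a coincidence of circles in \<open>B\<close> can be
  studied in this smoothing.\<close>

definition two :: "nat \<Rightarrow> nat \<Rightarrow> nat set \<Rightarrow> nat set" where
  "two e g B = flips (Fl B - {e, g}) B"

lemma two_facts:
  assumes "e \<in> Fl B" "g \<in> Fl B" "e \<noteq> g"
  shows "E B \<subseteq> E (two e g B)" "E (solo g B) = unite (E (two e g B)) (near e B) (far e B)"
proof -
  have S: "finite (Fl B - {e, g})" "Fl B - {e, g} \<subseteq> U B" using finite_Fl Fl_subset by auto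
  show "E B \<subseteq> E (two e g B)" unfolding two_def by (rule E_flips_mono) (use S in auto)
  have "e \<in> Fl (two e g B)"
    using assms unfolding two_def flips_live(3)[OF S] in_flips by auto
  moreover have "flip e (two e g B) = solo g B"
    unfolding solo_eq_flips[OF assms(2)] two_def using assms by (auto simp: in_flips in_flip_iff split: if_splits)
  ultimately show "E (solo g B) = unite (E (two e g B)) (near e B) (far e B)"
    using E_unflip[of e "two e g B"] unite_far_near[of _ e B] by simp
qed

lemma two_commute: "two e g B = two g e B"
  by (simp add: two_def insert_commute)

text \<open>A common circle of the far strands would persist when only \<open>e\<close> and
  \<open>g\<close> are flipped. There it misses the basepoint, and so do the near strands, as
  otherwise undoing one crossing would join the basepoint to the far side of the other. Undoing
  \<open>e\<close> then cannot join the near strand of \<open>g\<close> to the basepoint.\<close>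

lemma far_far:
  assumes "e \<in> Fl B" "g \<in> Fl B" "e \<noteq> g"
  shows "(far e B, far g B) \<notin> E B"
proof
  assume "(far e B, far g B) \<in> E B"
  let ?R = "E (two e g B)"
  have ff: "(far e B, far g B) \<in> ?R" using two_facts(1)[OF assms] \<open>(far e B, far g B) \<in> E B\<close> by blast
  have g: "E (solo g B) = unite ?R (near e B) (far e B)" by (rule two_facts(2)[OF assms])
  have e: "E (solo e B) = unite ?R (near g B) (far g B)"
    using two_facts(2)[OF assms(2,1)] assms(3) two_commute[of e g B] by simp
  have U: "e \<in> U B" "g \<in> U B" using assms Fl_subset by auto
  have 1: "(near g B, base) \<in> E (solo g B)" "(far g B, base) \<notin> E (solo g B)"
    "(near e B, base) \<in> E (solo e B)" "(far e B, base) \<notin> E (solo e B)"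
    using far_near_solo[OF U(1)] far_near_solo[OF U(2)] by auto
  have "(near g B, base) \<notin> ?R"
    using 1(4) ff unfolding e unite_iff by (metis E(2))
  moreover have "(near e B, base) \<notin> ?R"
    using 1(2) ff unfolding g unite_iff by (metis E(2))
  moreover have "(far e B, base) \<notin> ?R" using 1(4) unfolding e unite_iff by blast
  ultimately show False
    using 1(1) unfolding g unite_iff by blast
qed

text \<open>The number of arcs on the basepoint's side of \<open>e\<close>. The circles that are cut
  off form a tree rooted at the basepoint, and this number grows with the depth.\<close>

definition W :: "nat \<Rightarrow> nat set \<Rightarrow> nat" where
  "W e B = card {a \<in> A. (a, base) \<in> E (solo e B)}"

lemma W_pos: "0 < W e B"
  using base_A E(1) finite_A by (auto simp: W_def card_gt_0_iff)

lemma W_flip: "g \<in> U B \<Longrightarrow> W e (flip g B) = W e B"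
  by (simp add: W_def solo_flip)

text \<open>The far circle of \<open>g\<close> is the near circle of \<open>e\<close>, so
  \<open>g\<close> separates \<open>e\<close> from the basepoint. The basepoint's side of
  \<open>e\<close> contains that of \<open>g\<close> and also \<open>far g B\<close>.\<close>

lemma W_nested:
  assumes "e \<in> Fl B" "g \<in> Fl B" "e \<noteq> g" "(near e B, far g B) \<in> E B"
  shows "W g B < W e B"
proof -
  let ?R = "E (two e g B)"
  have nf: "(near e B, far g B) \<in> ?R" using two_facts(1)[OF assms(1-3)] assms(4) by blast
  have g: "E (solo g B) = unite ?R (near e B) (far e B)" by (rule two_facts(2)[OF assms(1-3)])
  have e: "E (solo e B) = unite ?R (near g B) (far g B)"
    using two_facts(2)[OF assms(2,1)] assms(3) two_commute[of e g B] by simp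
  have U: "e \<in> U B" "g \<in> U B" using assms Fl_subset by auto
  have 1: "(far g B, base) \<notin> E (solo g B)" "(near e B, base) \<in> E (solo e B)"
    using far_near_solo[OF U(1)] far_near_solo[OF U(2)] by auto
  have sub: "(a, base) \<in> E (solo e B)" if "(a, base) \<in> E (solo g B)" for a
  proof -
    have "(near e B, base) \<notin> E (solo g B)"
      using 1(1) nf unfolding g unite_iff by (metis E(2,3))
    moreover have "(far e B, base) \<notin> E (solo g B)"
      using 1(1) nf unfolding g unite_iff by (metis E(1,2,3))
    ultimately have "(a, base) \<in> ?R"
      using that unfolding g unite_iff by (metis E(1))
    then show ?thesis unfolding e unite_iff by blast
  qed
  have "(far g B, base) \<in> E (solo e B)"
    using 1(2) nf E(2,3) unfolding e unite_iff by metis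
  then have "{a \<in> A. (a, base) \<in> E (solo g B)} \<subset> {a \<in> A. (a, base) \<in> E (solo e B)}"
    using sub 1(1) far_near_A(1)[OF U(2)] by blast
  then show ?thesis unfolding W_def by (rule psubset_card_mono[rotated]) (use finite_A in simp)
qed

text \<open>Flipping one more crossing cuts off just its far circle. Together with
  \<open>far_far\<close> and \<open>far_not_base\<close>, the circles are the one through the
  basepoint and one for each flipped crossing.\<close>

lemma far_cover:
  assumes "a \<in> A"
  shows "(a, base) \<in> E B \<or> (\<exists>g \<in> Fl B. (a, far g B) \<in> E B)"
proof (induction "card (Fl B)" arbitrary: B)
  case 0
  then have "Fl B = {}" using finite_Fl by simp
  then show ?case using E_root[OF assms base_A, of B] by (simp add: root_def)
next
  case (Suc k)
  then obtain e where e: "e \<in> Fl B" by (metis card.empty ex_in_conv nat.distinct(1))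
  have eU: "e \<in> U B" using e Fl_subset by auto
  have Fl': "Fl (flip e B) = Fl B - {e}" using Fl_flip[OF eU] e by (auto split: if_splits)
  then have "k = card (Fl (flip e B))" using Suc.hyps(2) e finite_Fl by simp
  from Suc.hyps(1)[OF this] consider "(a, base) \<in> E (flip e B)"
    | g where "g \<in> Fl B" "g \<noteq> e" "(a, far g B) \<in> E (flip e B)"
    unfolding Fl' by (auto simp: far_flip[OF eU])
  moreover have U: "E (flip e B) = unite (E B) (near e B) (far e B)"
    using E_unflip[OF e] unite_far_near[of _ e B] by simp
  ultimately show ?case
  proof cases
    case 1
    then show ?thesis using far_not_base[OF e] e unfolding U unite_iff by blast
  next
    case 2
    then show ?thesis using far_far[OF e 2(1)] e unfolding U unite_iff by metis
  qed
qed

text \<open>What a Reidemeister I move leaves over. If changing \<open>e\<close> to B merges its far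
  circle, negative far circles pair with the merged states and positive ones remain; if it splits
  the far circle off, the merged states pair with positive far circles and negative ones
  remain.\<close>

definition crit :: "nat \<Rightarrow> nat set \<Rightarrow> 'a set \<Rightarrow> bool" where
  "crit e B Q \<longleftrightarrow> e \<in> Fl B \<and> (far e B \<in> Q \<longleftrightarrow> e \<notin> B)"

definition noncrit :: "nat set \<Rightarrow> 'a set \<Rightarrow> nat set" where
  "noncrit B Q = {e \<in> U B. \<not> crit e B Q}"

text \<open>Of the two smoothings that differ at a live \<open>e\<close>, the one in which
  \<open>e\<close> is flipped. Far and near circles are taken there, so both states of a pair refer
  to the same two circles.\<close>

definition flipped_state :: "nat \<Rightarrow> nat set \<Rightarrow> nat set" where
  "flipped_state e B = (if e \<in> Fl B then B else flip e B)"

lemma flipped_state: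
  assumes "e \<in> U B"
  shows "e \<in> Fl (flipped_state e B)" "U (flipped_state e B) = U B"
    "far g (flipped_state e B) = far g B" "near g (flipped_state e B) = near g B"
    "W g (flipped_state e B) = W g B" "flipped_state e (flip e B) = flipped_state e B"
    "g \<noteq> e \<Longrightarrow> g \<in> Fl (flipped_state e B) \<longleftrightarrow> g \<in> Fl B"
  using Fl_flip[OF assms] U_flip[OF assms] far_flip[OF assms] W_flip[OF assms]
  by (auto simp: flipped_state_def)

abbreviation far_circle :: "nat \<Rightarrow> nat set \<Rightarrow> 'a set" where
  "far_circle e B \<equiv> cl (flipped_state e B) (far e B)"

abbreviation near_circle :: "nat \<Rightarrow> nat set \<Rightarrow> 'a set" where
  "near_circle e B \<equiv> cl (flipped_state e B) (near e B)"

text \<open>Whether \<open>g\<close> is critical depends on the far circle of \<open>g\<close>,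
  which differs from that of \<open>e\<close>; changes confined to the latter are invisible.\<close>

lemma crit_flip:
  assumes "e \<in> U B" "g \<in> U B" "g \<noteq> e" and agree: "\<And>a. a \<notin> far_circle e B \<Longrightarrow> a \<in> Q \<longleftrightarrow> a \<in> Q'"
  shows "crit g (flip e B) Q' \<longleftrightarrow> crit g B Q"
proof (cases "g \<in> Fl B")
  case True
  then have "far g B \<notin> far_circle e B"
    using far_far[of e "flipped_state e B" g] flipped_state[OF assms(1)] assms(3) by auto
  then show ?thesis
    using agree[of "far g B"] Fl_flip[OF assms(1), of g] assms(3) far_flip[OF assms(1), of g]
    by (auto simp: crit_def in_flip_iff)
next
  case False
  then show ?thesis using Fl_flip[OF assms(1), of g] assms(3) by (simp add: crit_def)
qed

lemma noncrit_flip: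
  assumes "e \<in> U B" and agree: "\<And>a. a \<notin> far_circle e B \<Longrightarrow> a \<in> Q \<longleftrightarrow> a \<in> Q'"
    and "\<not> crit e B Q" "\<not> crit e (flip e B) Q'"
  shows "noncrit (flip e B) Q' = noncrit B Q"
proof -
  have "crit g (flip e B) Q' \<longleftrightarrow> crit g B Q" if "g \<in> U B" for g
    using assms crit_flip[OF assms(1) that _ agree] by (cases "g = e") auto
  then show ?thesis unfolding noncrit_def U_flip[OF assms(1)] by blast
qed

text \<open>The term of the differential that the matching leaves out makes \<open>e\<close>
  critical if \<open>root B\<close> has an A-smoothing at \<open>e\<close>, and not critical
  otherwise. The sum is over the crossings in the position reached by such a step.\<close>

definition weight :: "nat set \<Rightarrow> 'a set \<Rightarrow> nat" where
  "weight B Q = (\<Sum>e \<in> {e \<in> U B. crit e B Q \<longleftrightarrow> e \<notin> root B}. W e B)"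

lemma weight_flip:
  assumes "e \<in> U B" and agree: "\<And>a. a \<notin> far_circle e B \<Longrightarrow> a \<in> Q \<longleftrightarrow> a \<in> Q'"
    and "\<not> crit e B Q" "\<not> crit e (flip e B) Q'"
  shows "weight (flip e B) Q' = weight B Q"
proof -
  have "crit g (flip e B) Q' \<longleftrightarrow> crit g B Q" if "g \<in> U B" for g
    using assms crit_flip[OF assms(1) that _ agree] by (cases "g = e") auto
  then show ?thesis
    unfolding weight_def U_flip[OF assms(1)] root_flip[OF assms(1)] W_flip[OF assms(1)]
    by (intro sum.cong) auto
qed

section \<open>Far and near circles\<close>

lemma cl_disjoint: "(a, b) \<notin> E B \<Longrightarrow> cl B a \<inter> cl B b = {}"
  by (metis E(2,3) IntE Image_singleton_iff all_not_in_conv)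

lemma far_near_circle_disjoint: "e \<in> U B \<Longrightarrow> far_circle e B \<inter> near_circle e B = {}"
  using far_not_near[of e "flipped_state e B"] flipped_state[of e B] cl_disjoint by simp

lemma far_in_far_circle: "far e B \<in> far_circle e B"
  using E(1) by simp

lemma base_notin_far_circle: "e \<in> U B \<Longrightarrow> base \<notin> far_circle e B"
  using far_not_base[of e "flipped_state e B"] flipped_state[of e B] by simp

lemma merged_circle:
  assumes "e \<in> U B" "e \<notin> Fl B"
  shows "cl B (far e B) = far_circle e B \<union> near_circle e B" "cl B (near e B) = far_circle e B \<union> near_circle e B"
    "E (flip e B) \<subseteq> E B"
proof -
  have F: "e \<in> Fl (flip e B)" and fs: "flipped_state e B = flip e B"
    using Fl_flip[OF assms(1), of e] assms by (auto simp: flipped_state_def)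
  have "E B = unite (E (flip e B)) (near e B) (far e B)"
    using E_unflip[OF F] unite_far_near[of _ e B] by simp
  then show "cl B (far e B) = far_circle e B \<union> near_circle e B"
    "cl B (near e B) = far_circle e B \<union> near_circle e B" "E (flip e B) \<subseteq> E B"
    using class_unite[OF equiv_E[of "flip e B"], of "near e B" "far e B"] E(1)[of _ "flip e B"]
    by (auto simp: fs unite_def)
qed

lemma sat_absorb: "sat B Q \<Longrightarrow> a \<in> Q \<Longrightarrow> Q \<union> cl B a = Q"
  using satD[of B Q a] by auto

lemma sat_disjoint: "sat B Q \<Longrightarrow> a \<notin> Q \<Longrightarrow> Q \<inter> cl B a = {}"
  using satD[of B Q a] by auto

lemma far_near_cl: "cl B' (x e) \<union> cl B' (y e) = cl B' (near e B) \<union> cl B' (far e B)"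
  by (metis far_near_cases Un_commute)

lemma far_near_mem: "(x e \<in> Q \<longleftrightarrow> y e \<in> Q) \<longleftrightarrow> (near e B \<in> Q \<longleftrightarrow> far e B \<in> Q)"
  by (metis far_near_cases)

lemma cl_flip_Fl:
  assumes "e \<in> Fl B"
  shows "cl (flip e B) (x e) = cl B (near e B) \<union> cl B (far e B)"
proof -
  have e: "e < n" "(x e, y e) \<notin> E B" using assms U_less by (auto simp: Fl_def)
  have "cl (flip e B) (x e) = cl B (x e) \<union> cl B (y e)"
    using class_merge[OF e, of "x e"] E(1)[of "x e" B] by simp
  then show ?thesis using far_near_cl by simp
qed

text \<open>The leading term at \<open>e\<close>: a merge gives the new circle the sign of the near
  one, the far one being a negative unit, and a split makes the far circle positive and leaves the
  near sign as it was.\<close>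

definition match :: "nat \<Rightarrow> nat set \<Rightarrow> 'a set \<Rightarrow> 'a set" where
  "match e B Q = (if e \<in> Fl B \<and> near e B \<notin> Q then Q else Q \<union> far_circle e B)"

definition unmatch :: "nat \<Rightarrow> nat set \<Rightarrow> 'a set \<Rightarrow> 'a set" where
  "unmatch e B Q = (if e \<in> Fl B \<and> near e B \<in> Q then Q else Q - far_circle e B)"

section \<open>Matching at one live crossing\<close>

lemma match_agree: "a \<notin> far_circle e B \<Longrightarrow> a \<in> Q \<longleftrightarrow> a \<in> match e B Q"
  by (simp add: match_def)

lemma unmatch_agree: "a \<notin> far_circle e B \<Longrightarrow> a \<in> Q \<longleftrightarrow> a \<in> unmatch e B Q"
  by (simp add: unmatch_def)

lemma not_crit_plus: "e \<notin> B \<Longrightarrow> \<not> crit e B Q \<longleftrightarrow> e \<notin> Fl B \<or> far e B \<notin> Q"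
  and not_crit_minus: "e \<in> B \<Longrightarrow> \<not> crit e B Q \<longleftrightarrow> e \<notin> Fl B \<or> far e B \<in> Q"
  by (auto simp: crit_def)

lemma match_props:
  assumes "e \<in> U B" "e \<notin> B" "sat B Q" "\<not> crit e B Q"
  shows "sat (flip e B) (match e B Q)" "\<not> crit e (flip e B) (match e B Q)"
    "unmatch e (flip e B) (match e B Q) = Q"
proof -
  note en = U_less[OF assms(1)]
  have Ff: "e \<in> Fl (flip e B) \<longleftrightarrow> e \<notin> Fl B" using Fl_flip[OF assms(1), of e] by simp
  show "sat (flip e B) (match e B Q)"
  proof (cases "e \<in> Fl B")
    case True
    then have fQ: "far e B \<notin> Q" using assms not_crit_plus by blast
    have xy: "(x e, y e) \<notin> E B" using True by (simp add: Fl_def)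
    have "match e B Q = (if near e B \<in> Q then Q \<union> cl (flip e B) (x e) else Q)"
    proof -
      have "Q \<union> cl (flip e B) (x e) = Q \<union> cl B (far e B)" if "near e B \<in> Q"
        using sat_absorb[OF assms(3) that] unfolding cl_flip_Fl[OF True] by blast
      then show ?thesis
        using True by (auto simp: match_def flipped_state_def)
    qed
    moreover have "x e \<in> Q \<longleftrightarrow> y e \<in> Q" if "near e B \<notin> Q" using that fQ far_near_mem[of e Q B] by simp
    ultimately show ?thesis
      using sat_merge_Un[OF en xy assms(3)] sat_merge_closed[OF en xy assms(3)] by simp
  next
    case False
    then have "sat (flip e B) Q" using sat_mono[OF merged_circle(3)[OF assms(1)] assms(3)] by simp
    then show ?thesis
      using False sat_Un_class[of "flip e B" Q "far e B"] far_near_A[OF assms(1)]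
      by (simp add: match_def flipped_state_def)
  qed
  show "\<not> crit e (flip e B) (match e B Q)"
    using assms(2) Ff far_in_far_circle[of e B] far_flip[OF assms(1)]
    by (auto simp: crit_def match_def in_flip_iff)
  show "unmatch e (flip e B) (match e B Q) = Q"
  proof (cases "e \<in> Fl B")
    case True
    then have "far e B \<notin> Q" using assms not_crit_plus by blast
    then have "Q \<inter> far_circle e B = {}"
      using sat_disjoint[OF assms(3)] True by (simp add: flipped_state_def)
    then show ?thesis
      using True Ff flipped_state(6)[OF assms(1)] far_flip[OF assms(1)]
      by (auto simp: match_def unmatch_def)
  next
    case False
    note m = merged_circle[OF assms(1) False]
    have nn: "near e B \<notin> far_circle e B"
      using far_near_circle_disjoint[OF assms(1)] E(1)[of "near e B" "flipped_state e B"] by blast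
    show ?thesis
    proof (cases "near e B \<in> Q")
      case True
      then have "Q \<union> far_circle e B = Q" using sat_absorb[OF assms(3) True] m(2) by auto
      then show ?thesis
        using True False Ff flipped_state(6)[OF assms(1)] far_flip[OF assms(1)]
        by (simp add: match_def unmatch_def)
    next
      case nQ: False
      then have "Q \<inter> far_circle e B = {}" using sat_disjoint[OF assms(3) nQ] m(2) by auto
      then show ?thesis
        using nQ nn False Ff flipped_state(6)[OF assms(1)] far_flip[OF assms(1)]
        by (auto simp: match_def unmatch_def)
    qed
  qed
qed

lemma unmatch_props:
  assumes "e \<in> U B" "e \<in> B" "sat B Q" "\<not> crit e B Q"
  shows "sat (flip e B) (unmatch e B Q)" "\<not> crit e (flip e B) (unmatch e B Q)"
    "match e (flip e B) (unmatch e B Q) = Q"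
proof -
  note en = U_less[OF assms(1)]
  have Ff: "e \<in> Fl (flip e B) \<longleftrightarrow> e \<notin> Fl B" using Fl_flip[OF assms(1), of e] by simp
  have nn: "near e B \<notin> far_circle e B"
    using far_near_circle_disjoint[OF assms(1)] E(1)[of "near e B" "flipped_state e B"] by blast
  show "sat (flip e B) (unmatch e B Q)"
  proof (cases "e \<in> Fl B")
    case True
    then have fQ: "far e B \<in> Q" using assms not_crit_minus by blast
    have xy: "(x e, y e) \<notin> E B" using True by (simp add: Fl_def)
    have sat': "sat B (unmatch e B Q)"
      using assms(3) sat_Diff_class True by (simp add: unmatch_def flipped_state_def)
    have "near e B \<in> unmatch e B Q \<longleftrightarrow> far e B \<in> unmatch e B Q"
      using True fQ nn far_in_far_circle by (auto simp: unmatch_def)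
    then have "x e \<in> unmatch e B Q \<longleftrightarrow> y e \<in> unmatch e B Q"
      using far_near_mem[of e _ B] by blast
    then show ?thesis using sat_merge_closed[OF en xy sat'] by simp
  next
    case False
    then have "sat (flip e B) Q" using sat_mono[OF merged_circle(3)[OF assms(1)] assms(3)] by simp
    then show ?thesis
      using False sat_Diff_class[of "flip e B" Q "far e B"]
      by (simp add: unmatch_def flipped_state_def)
  qed
  show "\<not> crit e (flip e B) (unmatch e B Q)"
    using assms(2) Ff far_in_far_circle[of e B] far_flip[OF assms(1)]
    by (auto simp: crit_def unmatch_def in_flip_iff)
  show "match e (flip e B) (unmatch e B Q) = Q"
  proof (cases "e \<in> Fl B")
    case True
    then have "far e B \<in> Q" using assms not_crit_minus by blast
    then have "Q \<union> far_circle e B = Q"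
      using sat_absorb[OF assms(3)] True by (simp add: flipped_state_def)
    then show ?thesis
      using True Ff flipped_state(6)[OF assms(1)] far_flip[OF assms(1)]
      by (auto simp: match_def unmatch_def)
  next
    case False
    note m = merged_circle[OF assms(1) False]
    show ?thesis
    proof (cases "near e B \<in> Q")
      case True
      then have "Q \<union> far_circle e B = Q" using sat_absorb[OF assms(3) True] m(2) by auto
      then show ?thesis
        using True nn False Ff flipped_state(6)[OF assms(1)] far_flip[OF assms(1)]
        by (auto simp: match_def unmatch_def)
    next
      case nQ: False
      then have "Q \<inter> far_circle e B = {}" using sat_disjoint[OF assms(3) nQ] m(2) by auto
      then show ?thesis
        using nQ nn False Ff flipped_state(6)[OF assms(1)] far_flip[OF assms(1)]
        by (auto simp: match_def unmatch_def)
    qed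
  qed
qed

text \<open>Besides the matched term, the only possible one makes the near circle positive. It
  arises from splitting a negative circle, or from merging a positive far circle with a negative
  near one.\<close>

lemma resolve_live:
  assumes "e \<in> U B" "e \<notin> B" "sat B Q"
  shows "\<not> crit e B Q \<Longrightarrow> Poly_Mapping.lookup (resolve e (st B Q)) (st (flip e B) (match e B Q)) = 1"
    "s \<in> Poly_Mapping.keys (resolve e (st B Q)) \<Longrightarrow>
      \<not> crit e B Q \<and> s = st (flip e B) (match e B Q) \<or>
      near e B \<notin> Q \<and> (far e B \<in> Q \<longleftrightarrow> e \<in> Fl B) \<and> s = st (flip e B) (Q \<union> near_circle e B)"
proof -
  note en = U_less[OF assms(1)]
  have "(\<not> crit e B Q \<longrightarrow> Poly_Mapping.lookup (resolve e (st B Q)) (st (flip e B) (match e B Q)) = 1) \<and>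
    (s \<in> Poly_Mapping.keys (resolve e (st B Q)) \<longrightarrow>
      \<not> crit e B Q \<and> s = st (flip e B) (match e B Q) \<or>
      near e B \<notin> Q \<and> (far e B \<in> Q \<longleftrightarrow> e \<in> Fl B) \<and> s = st (flip e B) (Q \<union> near_circle e B))"
  proof (cases "e \<in> Fl B")
    case True
    then have xy: "(x e, y e) \<notin> E B" by (simp add: Fl_def)
    have fs: "flipped_state e B = B" using True by (simp add: flipped_state_def)
    note clx = cl_flip_Fl[OF True]
    have r: "resolve e (st B Q) =
      (if near e B \<in> Q \<and> far e B \<in> Q then 0
       else if near e B \<in> Q \<or> far e B \<in> Q then frag_of (st (flip e B) (Q \<union> (cl B (near e B) \<union> cl B (far e B))))
       else frag_of (st (flip e B) Q))"
      unfolding resolve_merge[OF en assms(2) xy assms(3)] clx using far_near_cases[of e B]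
      by (elim disjE conjE) (simp_all only: conj_commute disj_commute)
    have n: "Q \<union> (cl B (near e B) \<union> cl B (far e B)) = Q \<union> cl B (far e B)" if "near e B \<in> Q"
      using sat_absorb[OF assms(3) that] by auto
    have f: "Q \<union> (cl B (near e B) \<union> cl B (far e B)) = Q \<union> cl B (near e B)" if "far e B \<in> Q"
      using sat_absorb[OF assms(3) that] by auto
    show ?thesis
      unfolding r not_crit_plus[OF assms(2)] match_def fs
      using n f True by (cases "near e B \<in> Q"; cases "far e B \<in> Q") auto
  next
    case False
    then have xy: "(x e, y e) \<in> E B" using assms(1) by (simp add: Fl_def)
    have fs: "flipped_state e B = flip e B" using False by (simp add: flipped_state_def)
    have Ff: "e \<in> Fl (flip e B)" using Fl_flip[OF assms(1), of e] False by simp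
    have fn: "far e B \<in> Q \<longleftrightarrow> near e B \<in> Q" "x e \<in> Q \<longleftrightarrow> near e B \<in> Q"
      using satD[OF assms(3) near_eq_far[OF assms(1) False]] satD[OF assms(3) xy] far_near_cases[of e B] by metis+
    have r: "resolve e (st B Q) =
      (if near e B \<in> Q then frag_of (st (flip e B) Q)
       else frag_of (st (flip e B) (Q \<union> cl (flip e B) (near e B)))
          + frag_of (st (flip e B) (Q \<union> cl (flip e B) (far e B))))"
      unfolding resolve_split[OF en assms(2) xy assms(3)] fn(2)
      using far_near_cases[of e B] by (elim disjE conjE) (simp_all only: add.commute)
    have sat': "sat (flip e B) Q" by (rule sat_mono[OF merged_circle(3)[OF assms(1) False] assms(3)])
    have nf: "(near e B, far e B) \<notin> E (flip e B)"
      using far_not_near[OF Ff] far_flip[OF assms(1)] E(2)[of "near e B" "far e B"] by auto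
    have ab: "Q \<union> cl (flip e B) (far e B) = Q" if "near e B \<in> Q"
      using sat_absorb[OF sat'] that fn by simp
    have ne: "st (flip e B) (Q \<union> cl (flip e B) (near e B)) \<noteq> st (flip e B) (Q \<union> cl (flip e B) (far e B))"
      if "near e B \<notin> Q"
    proof
      assume "st (flip e B) (Q \<union> cl (flip e B) (near e B)) = st (flip e B) (Q \<union> cl (flip e B) (far e B))"
      then have "cls (flip e B) (Q \<union> cl (flip e B) (near e B)) = cls (flip e B) (Q \<union> cl (flip e B) (far e B))"
        by (simp add: st_def)
      then have "Q \<union> cl (flip e B) (near e B) = Q \<union> cl (flip e B) (far e B)"
        using sat_Union[OF sat_Un_class[OF sat' far_near_A(1)[OF assms(1)]]]
          sat_Union[OF sat_Un_class[OF sat' far_near_A(2)[OF assms(1)]]] by simp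
      moreover have "near e B \<in> cl (flip e B) (near e B)" using E(1) by simp
      ultimately have "near e B \<in> cl (flip e B) (far e B)" using that by blast
      then show False using nf E(2)[of "far e B" "near e B" "flip e B"] by simp
    qed
    show ?thesis
    proof (cases "near e B \<in> Q")
      case True
      then show ?thesis unfolding r not_crit_plus[OF assms(2)] match_def fs using ab False fn by auto
    next
      case nQ: False
      have "s \<in> Poly_Mapping.keys (resolve e (st B Q)) \<Longrightarrow>
         s = st (flip e B) (Q \<union> cl (flip e B) (near e B)) \<or> s = st (flip e B) (Q \<union> cl (flip e B) (far e B))"
        using nQ unfolding r by (auto simp: in_keys_iff lookup_add lookup_single when_def split: if_splits)
      moreover have "Poly_Mapping.lookup (resolve e (st B Q)) (st (flip e B) (Q \<union> cl (flip e B) (far e B))) = 1"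
        using nQ ne[OF nQ] unfolding r by (simp add: lookup_add lookup_single)
      ultimately show ?thesis
        unfolding not_crit_plus[OF assms(2)] match_def fs using False fn nQ by auto
    qed
  qed
  then show "\<not> crit e B Q \<Longrightarrow> Poly_Mapping.lookup (resolve e (st B Q)) (st (flip e B) (match e B Q)) = 1"
    "s \<in> Poly_Mapping.keys (resolve e (st B Q)) \<Longrightarrow>
      \<not> crit e B Q \<and> s = st (flip e B) (match e B Q) \<or>
      near e B \<notin> Q \<and> (far e B \<in> Q \<longleftrightarrow> e \<in> Fl B) \<and> s = st (flip e B) (Q \<union> near_circle e B)"
    by auto
qed

text \<open>A surgery that makes the near circle positive instead of the far one raises the weight: only
  the crossing whose far circle is that near circle can lose, and it is nested less deeply.\<close>

lemma weight_near:
  assumes "e \<in> U B" "e \<notin> B" "sat B Q" "near e B \<notin> Q" "far e B \<in> Q \<longleftrightarrow> e \<in> Fl B"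
  shows "weight B Q < weight (flip e B) (Q \<union> near_circle e B)"
proof -
  let ?B = "flip e B" and ?Q = "Q \<union> near_circle e B" and ?F = "flipped_state e B"
  have Ff: "e \<in> Fl ?B \<longleftrightarrow> e \<notin> Fl B" using Fl_flip[OF assms(1), of e] by simp
  note fs = flipped_state[OF assms(1)]
  define X where "X = {g \<in> U B. crit g B Q \<longleftrightarrow> g \<notin> root B}"
  define Y where "Y = {g \<in> U B. crit g ?B ?Q \<longleftrightarrow> g \<notin> root B}"
  \<comment> \<open>The crossings whose status can change besides \<open>e\<close>. Their far
    strands share the near circle of \<open>e\<close>, so by \<open>far_far\<close> there is at most
    one.\<close>
  define Z where "Z = {g \<in> Fl ?F. g \<noteq> e \<and> far g B \<in> near_circle e B}"
  have wX: "weight B Q = (\<Sum>g\<in>X. W g B)" by (simp add: weight_def X_def)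
  have wY: "weight ?B ?Q = (\<Sum>g\<in>Y. W g B)"
    by (simp add: weight_def Y_def U_flip[OF assms(1)] root_flip[OF assms(1)] W_flip[OF assms(1)])
  have fin: "finite X" "finite Y" using finite_U by (auto simp: X_def Y_def)
  have far_near': "far e B \<notin> near_circle e B"
    using far_near_circle_disjoint[OF assms(1)] far_in_far_circle[of e B] by blast
  have "crit e B Q \<longleftrightarrow> e \<in> Fl B" using assms(2,5) by (auto simp: crit_def)
  moreover have "crit e ?B ?Q \<longleftrightarrow> e \<notin> Fl B"
    using assms(2,5) far_near' Ff far_flip[OF assms(1)] by (auto simp: crit_def in_flip_iff)
  moreover have "e \<notin> root B \<longleftrightarrow> e \<notin> Fl B" using assms(2) by (simp add: in_root)
  ultimately have e: "e \<notin> X" "e \<in> Y" using assms(1) by (auto simp: X_def Y_def)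
  have "crit g ?B ?Q \<longleftrightarrow> crit g B Q" if "g \<in> U B" "g \<noteq> e" "g \<notin> Z" for g
    using that Fl_flip[OF assms(1), of g] fs(7)[OF that(2)] far_flip[OF assms(1), of g]
    by (auto simp: crit_def in_flip_iff Z_def)
  then have XY: "X - Z \<subseteq> Y - {e}" using e by (auto simp: X_def Y_def)
  have Z: "g = g'" if "g \<in> Z" "g' \<in> Z" for g g'
  proof (rule ccontr)
    assume "g \<noteq> g'"
    have "(near e B, far g B) \<in> E ?F" "(near e B, far g' B) \<in> E ?F" using that by (auto simp: Z_def)
    then have "(far g B, far g' B) \<in> E ?F" by (metis E(2,3))
    then show False using far_far[of g ?F g'] \<open>g \<noteq> g'\<close> that fs by (auto simp: Z_def)
  qed
  have WZ: "W g B < W e B" if "g \<in> Z" for g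
    using W_nested[of e ?F g] that fs by (auto simp: Z_def)
  have "(\<Sum>g\<in>X \<inter> Z. W g B) < W e B"
  proof (cases "X \<inter> Z = {}")
    case True
    then show ?thesis using W_pos by simp
  next
    case False
    then obtain g where g: "g \<in> X \<inter> Z" by blast
    then have "X \<inter> Z = {g}" using Z by blast
    then show ?thesis using WZ[of g, OF IntD2[OF g]] by simp
  qed
  moreover have "(\<Sum>g\<in>X. W g B) = (\<Sum>g\<in>X \<inter> Z. W g B) + (\<Sum>g\<in>X - Z. W g B)"
    by (rule sum.Int_Diff[OF fin(1)])
  moreover have "(\<Sum>g\<in>X - Z. W g B) \<le> (\<Sum>g\<in>Y - {e}. W g B)"
    by (rule sum_mono2) (use XY fin in auto)
  moreover have "(\<Sum>g\<in>Y. W g B) = W e B + (\<Sum>g\<in>Y - {e}. W g B)"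
    using fin(2) e(2) by (simp add: sum.remove)
  ultimately show ?thesis unfolding wX wY by linarith
qed

definition based_states :: "(nat set \<times> 'a set set) set" where
  "based_states = {st B Q | B Q. B \<subseteq> {..<n} \<and> sat B Q \<and> base \<in> Q}"

text \<open>With \<open>k\<close> minus the number of negative crossings this is the Khovanov
  bidegree: sigma is \<open>n - 2 * card B\<close>, and the writhe is \<open>n\<close> minus twice
  that number.\<close>

definition degree :: "int \<Rightarrow> int \<Rightarrow> nat set \<times> 'a set set \<Rightarrow> int \<times> int" where
  "degree k w = (\<lambda>(B, P). (k + int (card B), k + int (card B) + w - (2 * int (card P) - int (card (circ B)))))"

definition undecided :: "nat set \<times> 'a set set \<Rightarrow> nat set" where
  "undecided s = noncrit (fst s) (\<Union> (snd s))"

text \<open>Matching does not change the set of undecided crossings, so both states of a pair select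
  the same crossing and the pairing can be inverted.\<close>

definition first :: "nat set \<times> 'a set set \<Rightarrow> nat" where
  "first s = Min (undecided s)"

definition lower :: "(nat set \<times> 'a set set) set" where
  "lower = {s \<in> based_states. undecided s \<noteq> {} \<and> first s \<notin> fst s}"

definition upper :: "(nat set \<times> 'a set set) set" where
  "upper = {s \<in> based_states. undecided s \<noteq> {} \<and> first s \<in> fst s}"

definition partner :: "nat set \<times> 'a set set \<Rightarrow> nat set \<times> 'a set set" where
  "partner s = st (flip (first s) (fst s)) (match (first s) (fst s) (\<Union> (snd s)))"

definition copartner :: "nat set \<times> 'a set set \<Rightarrow> nat set \<times> 'a set set" where
  "copartner s = st (flip (first s) (fst s)) (unmatch (first s) (fst s) (\<Union> (snd s)))"

text \<open>Ordered lexicographically: the dead crossings come before the weight, which is compared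
  only within a subcube.\<close>

definition state_rank :: "nat set \<times> 'a set set \<Rightarrow> nat \<times> nat" where
  "state_rank s = (N (fst s), weight (fst s) (\<Union> (snd s)))"

section \<open>The matching and its acyclicity\<close>

lemma st_sel: "fst (st B Q) = B" "sat B Q \<Longrightarrow> \<Union> (snd (st B Q)) = Q"
  by (simp_all add: st_def sat_Union)

lemma undecided_st: "sat B Q \<Longrightarrow> undecided (st B Q) = noncrit B Q"
  by (simp add: undecided_def st_sel)

lemma finite_noncrit: "finite (noncrit B Q)"
  using finite_U[of B] by (simp add: noncrit_def)

lemma first_undecided: "sat B Q \<Longrightarrow> undecided (st B Q) \<noteq> {} \<Longrightarrow> first (st B Q) \<in> noncrit B Q"
  using Min_in[OF finite_noncrit] by (simp add: first_def undecided_st)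

lemma st_inject: "sat B Q \<Longrightarrow> sat B' Q' \<Longrightarrow> st B Q = st B' Q' \<Longrightarrow> B = B' \<and> Q = Q'"
proof -
  assume Q: "sat B Q" "sat B' Q'" and eq: "st B Q = st B' Q'"
  have "B = fst (st B Q)" "Q = \<Union> (snd (st B Q))" using st_sel Q by auto
  then show "B = B' \<and> Q = Q'" unfolding eq st_sel(1) st_sel(2)[OF Q(2)] by blast
qed

lemma base_match: "e \<in> U B \<Longrightarrow> base \<in> Q \<longleftrightarrow> base \<in> match e B Q"
  and base_unmatch: "e \<in> U B \<Longrightarrow> base \<in> Q \<longleftrightarrow> base \<in> unmatch e B Q"
  by (rule match_agree[OF base_notin_far_circle], assumption)
    (rule unmatch_agree[OF base_notin_far_circle])

lemma flip_subset: "e < n \<Longrightarrow> B \<subseteq> {..<n} \<Longrightarrow> flip e B \<subseteq> {..<n}"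
  by (auto simp: flip_def)

lemma finite_based_states: "finite based_states"
proof (rule finite_subset)
  show "based_states \<subseteq> Pow {..<n} \<times> (\<Union>B \<in> Pow {..<n}. Pow (circ B))"
    using classes_subset sat_subset by (fastforce simp: based_states_def st_def)
  show "finite (Pow {..<n} \<times> (\<Union>B \<in> Pow {..<n}. Pow (circ B)))" using finite_A by simp
qed

lemma lowerD:
  assumes "s \<in> lower"
  obtains B Q e where "s = st B Q" "B \<subseteq> {..<n}" "sat B Q" "base \<in> Q" "e = first s" "e \<in> U B" "e \<notin> B"
    "\<not> crit e B Q" "partner s = st (flip e B) (match e B Q)"
proof -
  obtain B Q where s: "s = st B Q" "B \<subseteq> {..<n}" "sat B Q" "base \<in> Q"
    using assms by (auto simp: lower_def based_states_def)
  moreover have "undecided s \<noteq> {}" "first s \<notin> B"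
    using assms s(1) by (simp_all add: lower_def st_sel)
  moreover from this have "first s \<in> noncrit B Q" using first_undecided[OF s(3)] s(1) by simp
  ultimately show ?thesis using that[of B Q "first s"] by (simp add: noncrit_def partner_def st_sel)
qed

lemma upperD:
  assumes "s \<in> upper"
  obtains B Q e where "s = st B Q" "B \<subseteq> {..<n}" "sat B Q" "base \<in> Q" "e = first s" "e \<in> U B" "e \<in> B"
    "\<not> crit e B Q" "copartner s = st (flip e B) (unmatch e B Q)"
proof -
  obtain B Q where s: "s = st B Q" "B \<subseteq> {..<n}" "sat B Q" "base \<in> Q"
    using assms by (auto simp: upper_def based_states_def)
  moreover have "undecided s \<noteq> {}" "first s \<in> B"
    using assms s(1) by (simp_all add: upper_def st_sel)
  moreover from this have "first s \<in> noncrit B Q" using first_undecided[OF s(3)] s(1) by simp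
  ultimately show ?thesis using that[of B Q "first s"] by (simp add: noncrit_def copartner_def st_sel)
qed

lemma undecided_match:
  assumes "e \<in> U B" "e \<notin> B" "sat B Q" "\<not> crit e B Q"
  shows "undecided (st (flip e B) (match e B Q)) = undecided (st B Q)"
    "weight (flip e B) (match e B Q) = weight B Q"
  using match_props[OF assms] noncrit_flip[OF assms(1) match_agree assms(4)]
    weight_flip[OF assms(1) match_agree assms(4)] assms(3)
  by (simp_all add: undecided_st)

lemma undecided_unmatch:
  assumes "e \<in> U B" "e \<in> B" "sat B Q" "\<not> crit e B Q"
  shows "undecided (st (flip e B) (unmatch e B Q)) = undecided (st B Q)"
  using unmatch_props[OF assms] noncrit_flip[OF assms(1) unmatch_agree assms(4)] assms(3)
  by (simp add: undecided_st)

lemma partner_lower: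
  assumes "s \<in> lower"
  shows "partner s \<in> upper" "copartner (partner s) = s" "state_rank (partner s) = state_rank s"
proof -
  obtain B Q e where s: "s = st B Q" "B \<subseteq> {..<n}" "sat B Q" "base \<in> Q" "e = first s" "e \<in> U B" "e \<notin> B"
    "\<not> crit e B Q" "partner s = st (flip e B) (match e B Q)" by (rule lowerD[OF assms])
  note m = match_props[OF s(6,7,3,8)]
  have u: "undecided (partner s) = undecided s" unfolding s(9) unfolding s(1) by (rule undecided_match[OF s(6,7,3,8)])
  then have f: "first (partner s) = e" using s(5) by (simp add: first_def)
  show "partner s \<in> upper"
  proof -
    have "partner s \<in> based_states"
      unfolding s(9) based_states_def mem_Collect_eq
      using m(1) base_match[OF s(6), of Q] s(4) flip_subset[OF U_less[OF s(6)] s(2)] by blast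
    moreover have "e \<in> fst (partner s)" using s(7) by (simp add: s(9) st_sel in_flip_iff)
    moreover have "undecided s \<noteq> {}" using assms by (simp add: lower_def)
    ultimately show ?thesis by (simp add: upper_def u f)
  qed
  show "copartner (partner s) = s"
    unfolding copartner_def f unfolding s(9) st_sel(1) st_sel(2)[OF m(1)] flip_flip m(3) by (rule s(1)[symmetric])
  show "state_rank (partner s) = state_rank s"
    using s(3) m(1) undecided_match(2)[OF s(6,7,3,8)] N_flip[OF s(6)]
    unfolding s(9) unfolding s(1) by (simp add: state_rank_def st_sel)
qed

lemma copartner_upper:
  assumes "s \<in> upper"
  shows "copartner s \<in> lower" "partner (copartner s) = s"
proof -
  obtain B Q e where s: "s = st B Q" "B \<subseteq> {..<n}" "sat B Q" "base \<in> Q" "e = first s" "e \<in> U B" "e \<in> B"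
    "\<not> crit e B Q" "copartner s = st (flip e B) (unmatch e B Q)" by (rule upperD[OF assms])
  note m = unmatch_props[OF s(6,7,3,8)]
  have u: "undecided (copartner s) = undecided s" unfolding s(9) unfolding s(1) by (rule undecided_unmatch[OF s(6,7,3,8)])
  then have f: "first (copartner s) = e" using s(5) by (simp add: first_def)
  show "copartner s \<in> lower"
  proof -
    have "copartner s \<in> based_states"
      unfolding s(9) based_states_def mem_Collect_eq
      using m(1) base_unmatch[OF s(6), of Q] s(4) flip_subset[OF U_less[OF s(6)] s(2)] by blast
    moreover have "e \<notin> fst (copartner s)" using s(7) by (simp add: s(9) st_sel in_flip_iff)
    moreover have "undecided s \<noteq> {}" using assms by (simp add: upper_def)
    ultimately show ?thesis by (simp add: lower_def u f)
  qed
  show "partner (copartner s) = s"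
    unfolding partner_def f unfolding s(9) st_sel(1) st_sel(2)[OF m(1)] flip_flip m(3) by (rule s(1)[symmetric])
qed

lemma bij_partner: "bij_betw partner lower upper"
  by (rule bij_betw_byWitness[where f' = copartner]) (use partner_lower copartner_upper in auto)

lemma keys_diff_st:
  assumes "s \<in> Poly_Mapping.keys (diff (frag_of (st B Q)))"
  obtains c where "c < n" "c \<notin> B" "s \<in> Poly_Mapping.keys (resolve c (st B Q))"
proof -
  have "s \<in> (\<Union>c \<in> {..<n} - B. Poly_Mapping.keys (frag_cmul (sgn_at c B) (resolve c (st B Q))))"
    using assms subsetD[OF keys_sum] unfolding diff_st by fast
  then show ?thesis using that by auto
qed

lemma coeff_partner:
  assumes "s \<in> lower"
  shows "\<bar>Poly_Mapping.lookup (diff (frag_of s)) (partner s)\<bar> = 1"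
proof -
  obtain B Q e where s: "s = st B Q" "B \<subseteq> {..<n}" "sat B Q" "base \<in> Q" "e = first s" "e \<in> U B" "e \<notin> B"
    "\<not> crit e B Q" "partner s = st (flip e B) (match e B Q)" by (rule lowerD[OF assms])
  have 0: "Poly_Mapping.lookup (resolve c (st B Q)) (partner s) = 0" if c: "c < n" "c \<notin> B" "c \<noteq> e" for c
  proof (rule ccontr)
    assume "Poly_Mapping.lookup (resolve c (st B Q)) (partner s) \<noteq> 0"
    then have "partner s \<in> Poly_Mapping.keys (resolve c (st B Q))" by (simp add: in_keys_iff)
    then obtain Q' where "partner s = st (flip c B) Q'" using resolve_keys[OF c(1,2) s(3)] by blast
    then have "flip e B = flip c B" unfolding s(9) by (metis st_sel(1))
    then show False using c s(7) by (metis in_flip_iff)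
  qed
  have "Poly_Mapping.lookup (diff (frag_of s)) (partner s) =
      (\<Sum>c \<in> {..<n} - B. if c = e then sgn_at e B else 0)"
    unfolding s(1) diff_st lookup_sum unfolding s(1)[symmetric] lookup_frag_cmul
    by (intro sum.cong refl) (use 0 resolve_live(1)[OF s(6,7,3,8)] s(1,9) in auto)
  also have "\<dots> = sgn_at e B" using U_less[OF s(6)] s(7) by simp
  finally show ?thesis by (simp add: power_abs)
qed

text \<open>Partners have equal rank, so the target of the differential may replace
  \<open>s'\<close>. Leaving the subcube raises \<open>N\<close>, and a near term raises the weight.
  A matched term at another crossing leaves the first undecided crossing with its A-smoothing, so it
  is not in \<open>upper\<close>.\<close>

lemma rank_partner:
  assumes "s \<in> lower" "s' \<in> lower" "s' \<noteq> s" "partner s' \<in> Poly_Mapping.keys (diff (frag_of s))"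
  shows "state_rank s < state_rank s'"
proof -
  obtain B Q e where s: "s = st B Q" "B \<subseteq> {..<n}" "sat B Q" "base \<in> Q" "e = first s" "e \<in> U B" "e \<notin> B"
    "\<not> crit e B Q" "partner s = st (flip e B) (match e B Q)" by (rule lowerD[OF assms(1)])
  define t where "t = partner s'"
  have t: "t \<in> upper" "state_rank t = state_rank s'" "t \<noteq> partner s"
    using partner_lower[OF assms(2)] assms(1-3) bij_partner
    by (auto simp: t_def bij_betw_def inj_on_def)
  obtain c where c: "c < n" "c \<notin> B" "t \<in> Poly_Mapping.keys (resolve c (st B Q))"
    using assms(4) unfolding s(1) t_def[symmetric] by (rule keys_diff_st)
  obtain Q' where Q': "t = st (flip c B) Q'" "sat (flip c B) Q'"
    using resolve_keys[OF c(1,2) s(3) c(3)] by blast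
  have rs: "state_rank s = (N B, weight B Q)" using s(1,3) by (simp add: state_rank_def st_sel)
  have rt: "state_rank t = (N (flip c B), weight (flip c B) Q')" using Q' by (simp add: state_rank_def st_sel)
  have "state_rank s < state_rank t"
  proof (cases "c \<in> U B")
    case False
    then show ?thesis using N_less[OF c(1,2)] by (simp add: rs rt)
  next
    case True
    from resolve_live(2)[OF True c(2) s(3) c(3)] show ?thesis
    proof (elim disjE conjE)
      assume m: "\<not> crit c B Q" "t = st (flip c B) (match c B Q)"
      have "c \<noteq> e" using m t(3) s(9) by auto
      have "undecided t = undecided s" unfolding m(2) s(1) by (rule undecided_match[OF True c(2) s(3) m(1)])
      then have "first t = e" using s(5) by (simp add: first_def)
      then have "first t \<notin> fst t" using \<open>c \<noteq> e\<close> s(7) by (simp add: m(2) st_sel in_flip_iff)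
      then show ?thesis using t(1) by (simp add: upper_def)
    next
      assume nr: "near c B \<notin> Q" "far c B \<in> Q \<longleftrightarrow> c \<in> Fl B" "t = st (flip c B) (Q \<union> near_circle c B)"
      have "Q' = Q \<union> near_circle c B"
      proof -
        have "sat (flip c B) (Q \<union> near_circle c B)"
        proof (cases "c \<in> Fl B")
          case F: True
          have xy: "(x c, y c) \<notin> E B" using F by (simp add: Fl_def)
          have *: "Q \<union> cl (flip c B) (x c) = Q \<union> near_circle c B"
            using sat_absorb[OF s(3), of "far c B"] nr(2) F unfolding cl_flip_Fl[OF F]
            by (auto simp: flipped_state_def)
          show ?thesis using sat_merge_Un[OF c(1) xy s(3)] unfolding * .
        next
          case F: False
          show ?thesis
            using sat_Un_class[OF sat_mono[OF merged_circle(3)[OF True F] s(3)] far_near_A(2)[OF True]] F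
            by (simp add: flipped_state_def)
        qed
        then show ?thesis using st_inject[OF Q'(2)] Q'(1) nr(3) by blast
      qed
      then show ?thesis
        using weight_near[OF True c(2) s(3) nr(1,2)] N_flip[OF True] by (simp add: rs rt)
    qed
  qed
  then show ?thesis using t(2) by simp
qed

lemma keys_diff_based:
  assumes "s \<in> based_states"
  shows "Poly_Mapping.keys (diff (frag_of s)) \<subseteq> {s' \<in> based_states. degree k w s' = degree k w s + (1, 0)}"
proof
  fix s' assume s': "s' \<in> Poly_Mapping.keys (diff (frag_of s))"
  obtain B Q where s: "s = st B Q" "B \<subseteq> {..<n}" "sat B Q" "base \<in> Q"
    using assms by (auto simp: based_states_def)
  obtain c where c: "c < n" "c \<notin> B" "s' \<in> Poly_Mapping.keys (resolve c (st B Q))"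
    using s' unfolding s(1) by (rule keys_diff_st)
  obtain Q' where Q': "s' = st (flip c B) Q'" "sat (flip c B) Q'" "Q \<subseteq> Q'"
    "2 * int (card (cls (flip c B) Q')) - int (card (circ (flip c B))) =
      2 * int (card (cls B Q)) - int (card (circ B)) + 1"
    using resolve_keys[OF c(1,2) s(3) c(3)] by blast
  have "card (flip c B) = Suc (card B)"
    using c(2) finite_subset[OF s(2)] by (simp add: flip_def)
  then have "degree k w s' = degree k w s + (1, 0)"
    using Q'(4) by (simp add: degree_def s(1) Q'(1) st_def)
  moreover have "s' \<in> based_states"
    using Q' s flip_subset[OF c(1) s(2)] by (auto simp: based_states_def)
  ultimately show "s' \<in> {s' \<in> based_states. degree k w s' = degree k w s + (1, 0)}" by simp
qed

lemma acyclic_matching: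
  "acyclic_matching based_states (degree k w) (1, 0) diff lower upper partner state_rank"
proof (rule acyclic_matching.intro)
  show "finite based_states" by (rule finite_based_states)
  show "additive diff" by (rule additive_diff)
  show "lower \<subseteq> based_states" "lower \<inter> upper = {}"
    by (auto simp: lower_def upper_def)
  show "bij_betw partner lower upper" by (rule bij_partner)
  show "diff (diff (frag_of s)) = 0" if "s \<in> based_states" for s
    using that diff_diff by (auto simp: based_states_def)
  show "upper \<subseteq> based_states" by (auto simp: upper_def)
qed (rule keys_diff_based coeff_partner rank_partner; assumption)+

text \<open>The critical states: every live crossing is flipped away from a state with a single circle,
  and the sign of the circle it cuts off is forced.\<close>

definition trees :: "nat set set" where
  "trees = {R. R \<subseteq> {..<n} \<and> Fl R = {}}"

definition all_flipped :: "nat set \<Rightarrow> nat set" where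
  "all_flipped R = flips (U R) R"

text \<open>A live crossing in \<open>R\<close> has an A-smoothing once it is flipped, and then it
  is critical only if its far circle is positive.\<close>

definition critical_plus :: "nat set \<Rightarrow> 'a set" where
  "critical_plus R = cl (all_flipped R) base \<union> (\<Union>e \<in> U R \<inter> R. cl (all_flipped R) (far e R))"

lemma all_flipped:
  assumes "R \<in> trees"
  shows "U (all_flipped R) = U R" "Fl (all_flipped R) = U R" "all_flipped R \<subseteq> {..<n}"
    "root (all_flipped R) = R" "far e (all_flipped R) = far e R" "c \<in> U R \<Longrightarrow> c \<in> all_flipped R \<longleftrightarrow> c \<notin> R"
proof -
  have R: "R \<subseteq> {..<n}" "Fl R = {}" using assms by (auto simp: trees_def)
  note f = flips_live[OF finite_U order_refl, of R]
  show U: "U (all_flipped R) = U R" and F: "Fl (all_flipped R) = U R"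
    using f R by (auto simp: all_flipped_def in_flips)
  show "all_flipped R \<subseteq> {..<n}" using R U_less by (auto simp: all_flipped_def in_flips)
  show r: "root (all_flipped R) = R"
    unfolding root_def F by (auto simp: all_flipped_def in_flips)
  have "root R = R" using R by (simp add: root_def)
  then show "far e (all_flipped R) = far e R" using r by (simp add: far_def solo_def)
  show "c \<in> U R \<Longrightarrow> c \<in> all_flipped R \<longleftrightarrow> c \<notin> R" by (auto simp: all_flipped_def in_flips)
qed

lemma sat_critical_plus:
  assumes "R \<in> trees"
  shows "sat (all_flipped R) (critical_plus R)" "base \<in> critical_plus R"
    "e \<in> U R \<Longrightarrow> far e R \<in> critical_plus R \<longleftrightarrow> e \<in> R"
proof -
  note af = all_flipped[OF assms]
  have "critical_plus R \<subseteq> A"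
    using E_A base_A far_near_A(1)[of _ R] by (auto simp: critical_plus_def)
  then show "sat (all_flipped R) (critical_plus R)"
    unfolding sat_def
  proof (intro conjI allI impI)
    fix a b assume ab: "(a, b) \<in> E (all_flipped R)" "a \<in> critical_plus R"
    then obtain z where "cl (all_flipped R) z \<subseteq> critical_plus R" "(z, a) \<in> E (all_flipped R)"
      by (auto simp: critical_plus_def)
    then show "b \<in> critical_plus R" using E(3)[OF _ ab(1)] by blast
  qed
  show "base \<in> critical_plus R" using E(1) by (simp add: critical_plus_def)
  assume e: "e \<in> U R"
  have "far e R \<notin> cl (all_flipped R) base"
    using far_not_base[of e "all_flipped R"] e af E(2)[of base "far e R" "all_flipped R"] by auto
  moreover have "far e R \<notin> cl (all_flipped R) (far g R)" if "g \<in> U R" "g \<noteq> e" for g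
    using far_far[of g "all_flipped R" e] e that af by simp
  ultimately show "far e R \<in> critical_plus R \<longleftrightarrow> e \<in> R"
    using e E(1)[of "far e R" "all_flipped R"] by (auto simp: critical_plus_def)
qed

definition critical_state :: "nat set \<Rightarrow> nat set \<times> 'a set set" where
  "critical_state R = st (all_flipped R) (critical_plus R)"

lemma sat_eqI:
  assumes "sat B Q" "sat B Q'" "base \<in> Q \<longleftrightarrow> base \<in> Q'" "\<And>e. e \<in> Fl B \<Longrightarrow> far e B \<in> Q \<longleftrightarrow> far e B \<in> Q'"
  shows "Q = Q'"
proof -
  have "a \<in> Q \<longleftrightarrow> a \<in> Q'" if "a \<in> A" for a
    using far_cover[OF that, of B] satD[OF assms(1), of a] satD[OF assms(2), of a] assms(3,4) by blast
  then show ?thesis using sat_subset[OF assms(1)] sat_subset[OF assms(2)] by blast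
qed

text \<open>An unmatched state has no undecided crossing. So every live crossing is flipped, the
  root determines the smoothing, and the signs follow because base and far circles are all the
  circles.\<close>

lemma bij_critical_state: "bij_betw critical_state trees (based_states - lower - upper)"
proof (rule bij_betw_byWitness[where f' = "\<lambda>s. root (fst s)"])
  show "\<forall>R\<in>trees. root (fst (critical_state R)) = R"
    using all_flipped by (simp add: critical_state_def st_sel)
  have crit: "undecided (critical_state R) = {}" if "R \<in> trees" for R
  proof -
    have "crit e (all_flipped R) (critical_plus R)" if "e \<in> U R" for e
      using that all_flipped[OF \<open>R \<in> trees\<close>] sat_critical_plus(3)[OF \<open>R \<in> trees\<close> that] by (simp add: crit_def)
    then show ?thesis
      using that sat_critical_plus(1)[OF that] all_flipped(1)[OF that]
      by (simp add: critical_state_def undecided_st noncrit_def)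
  qed
  show "critical_state ` trees \<subseteq> based_states - lower - upper"
    using crit sat_critical_plus all_flipped(3)
    by (fastforce simp: lower_def upper_def based_states_def critical_state_def)
  have dec: "root (fst s) \<in> trees \<and> critical_state (root (fst s)) = s"
    if s: "s \<in> based_states - lower - upper" for s
  proof -
    obtain B Q where BQ: "s = st B Q" "B \<subseteq> {..<n}" "sat B Q" "base \<in> Q"
      using s by (auto simp: based_states_def)
    have "undecided s = {}" using s by (auto simp: lower_def upper_def)
    then have cr: "crit e B Q" if "e \<in> U B" for e
      using that BQ by (auto simp: undecided_st noncrit_def)
    have FU: "Fl B = U B" using cr Fl_subset by (auto simp: crit_def)
    define R where "R = root B"
    have R: "R \<in> trees"
    proof -
      have "c < n" if "c \<in> R" for c
        using that BQ(2) U_less[of c B] subsetD[OF Fl_subset, of c B]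
        by (auto simp: R_def in_root split: if_splits)
      then show ?thesis using root_live(2)[of B] by (auto simp: trees_def R_def)
    qed
    have af: "all_flipped R = B"
      using root_live(1)[of B] FU by (auto simp: all_flipped_def R_def in_flips in_root)
    have "critical_plus R = Q"
    proof (rule sat_eqI)
      show "sat B (critical_plus R)" using sat_critical_plus(1)[OF R] af by simp
      show "far e B \<in> critical_plus R \<longleftrightarrow> far e B \<in> Q" if "e \<in> Fl B" for e
        using that cr[of e] FU sat_critical_plus(3)[OF R, of e] all_flipped(1)[OF R] all_flipped(5)[OF R, of e]
          all_flipped(6)[OF R, of e] af
        by (auto simp: crit_def)
    qed (use BQ sat_critical_plus(2)[OF R] in auto)
    then show ?thesis using R BQ(1) af by (simp add: critical_state_def R_def[symmetric] st_sel)
  qed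
  then show "\<forall>s\<in>based_states - lower - upper. critical_state (root (fst s)) = s"
    "(\<lambda>s. root (fst s)) ` (based_states - lower - upper) \<subseteq> trees" by auto
qed

text \<open>There is one circle for the basepoint and one for each live crossing; the positive ones
  are the former and those belonging to \<open>R\<close>. The left side is
  \<open>state_tau\<close>.\<close>

lemma card_critical:
  assumes "R \<in> trees"
  shows "2 * int (card (cls (all_flipped R) (critical_plus R))) - int (card (circ (all_flipped R))) =
    1 + int (card (U R \<inter> R)) - int (card (U R - R))"
proof -
  let ?B = "all_flipped R" and ?c = "\<lambda>e. cl (all_flipped R) (far e R)"
  note af = all_flipped[OF assms]
  have inj: "inj_on ?c (U R)"
    using far_far[of _ ?B] af cl_eq_iff by (auto simp: inj_on_def)
  have base: "cl ?B base \<notin> ?c ` U R"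
    using far_not_base[of _ ?B] af cl_eq_iff E(2) by (metis (no_types, lifting) imageE)
  have "circ ?B = insert (cl ?B base) (?c ` U R)"
  proof -
    have "cl ?B a \<in> insert (cl ?B base) (?c ` U R)" if "a \<in> A" for a
      using far_cover[OF that, of ?B] af cl_eq_iff[of ?B a] by auto
    then show ?thesis using base_A far_near_A(1)[of _ R] by auto
  qed
  then have 1: "card (circ ?B) = Suc (card (U R))"
    using base finite_U card_image[OF inj] by simp
  have "cls ?B (critical_plus R) = insert (cl ?B base) (?c ` (U R \<inter> R))"
    unfolding critical_plus_def by (auto simp: image_Un image_UN cls_cl)
  moreover have "cl ?B base \<notin> ?c ` (U R \<inter> R)" using base by blast
  moreover have "card (?c ` (U R \<inter> R)) = card (U R \<inter> R)"
    by (rule card_image) (rule inj_on_subset[OF inj], simp)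
  ultimately have 2: "card (cls ?B (critical_plus R)) = Suc (card (U R \<inter> R))"
    using finite_U by simp
  have "card (U R) = card (U R \<inter> R) + card (U R - R)"
    using card_Int_Diff[OF finite_U] by blast
  then show ?thesis using 1 2 by simp
qed

end

section \<open>Cycles of a permutation\<close>

definition links :: "('a \<times> 'a) set \<Rightarrow> ('a \<times> 'a) set" where
  "links R = (R \<union> R\<inverse>)\<^sup>*"

lemma equiv_links: "equiv UNIV (links R)"
  unfolding links_def
  by (rule equivI) (simp_all add: refl_rtrancl trans_rtrancl sym_rtrancl sym_Un_converse)

lemmas links_refl = equiv_UNIV_D(1)[OF equiv_links]
lemmas links_sym = equiv_UNIV_D(2)[OF equiv_links]
lemmas links_trans = equiv_UNIV_D(3)[OF equiv_links]

lemma links_least: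
  assumes "R \<subseteq> Q" "equiv UNIV Q"
  shows "links R \<subseteq> Q"
proof (rule subrelI)
  note E = equiv_UNIV_D[OF assms(2)]
  fix a b assume "(a, b) \<in> links R"
  then show "(a, b) \<in> Q"
    unfolding links_def
  proof (induction rule: rtrancl_induct)
    case (step b c)
    then have "(b, c) \<in> Q" using assms(1) E(2)[of c b] by blast
    then show ?case using step(3) E(3) by metis
  qed (rule E(1))
qed

lemma links_base: "R \<subseteq> links R"
  by (auto simp: links_def)

lemma links_closed:
  assumes "(a, b) \<in> links R" "\<And>a b. (a, b) \<in> R \<Longrightarrow> a \<in> Z \<longleftrightarrow> b \<in> Z"
  shows "a \<in> Z \<longleftrightarrow> b \<in> Z"
  using assms(1) unfolding links_def
  by (induction rule: rtrancl_induct) (use assms(2) in auto)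

definition graph_of :: "'a set \<Rightarrow> ('a \<Rightarrow> 'a) \<Rightarrow> ('a \<times> 'a) set" where
  "graph_of A f = {(a, f a) | a. a \<in> A}"

text \<open>An injective map of a finite set into itself is onto, so a set closed under
  \<open>f\<close> is also closed under its inverse.\<close>

lemma permutes_closed:
  assumes "f permutes A" "finite A" "Z \<subseteq> A" "\<And>a. a \<in> Z \<Longrightarrow> f a \<in> Z"
  shows "f a \<in> Z \<longleftrightarrow> a \<in> Z"
proof -
  have fin: "finite Z" using assms(2,3) finite_subset by blast
  have "inj f" using assms(1) by (rule permutes_inj)
  then have "f ` Z = Z"
    using endo_inj_surj[OF fin, of f] assms(4) by (auto intro: inj_on_subset)
  then show ?thesis using \<open>inj f\<close> by (metis imageE image_eqI injD)
qed

text \<open>Following \<open>f\<close> from \<open>f p\<close> until \<open>p\<close> or \<open>q\<close> is met gives a cycle of one of the two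
  permutations that contains exactly one of \<open>p\<close>, \<open>q\<close>.\<close>

lemma transpose_links_xor:
  assumes f: "f permutes A" and A: "finite A" and pq: "p \<in> A" "q \<in> A" "p \<noteq> q"
    and g: "g permutes A" "g p = f q" "g q = f p" "\<And>a. a \<noteq> p \<Longrightarrow> a \<noteq> q \<Longrightarrow> g a = f a"
  shows "(p, q) \<in> links (graph_of A g) \<longleftrightarrow> (p, q) \<notin> links (graph_of A f)"
proof -
  \<comment> \<open>The path starts at \<open>f p = g q\<close>: under \<open>f\<close> it continues
    \<open>p\<close>, under \<open>g\<close> it continues \<open>q\<close>.\<close>
  define w where "w j = (f ^^ j) (f p)" for j
  have wA: "w j \<in> A" for j
    by (induction j) (use pq permutes_in_image[OF f] in \<open>auto simp: w_def\<close>)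
  have w_Suc: "w (Suc j) = f (w j)" for j by (simp add: w_def)
  have "\<exists>j. w j = p"
  proof -
    have "finite {y. \<exists>n. y = (f ^^ n) p}"
    proof (rule finite_subset[OF _ A])
      have "(f ^^ n) p \<in> A" for n by (induction n) (use pq permutes_in_image[OF f] in auto)
      then show "{y. \<exists>n. y = (f ^^ n) p} \<subseteq> A" by auto
    qed
    then obtain k where k: "0 < k" "(f ^^ k) p = p"
      using funpow_inj_finite[OF permutes_inj[OF f]] by metis
    then have "w (k - 1) = p" by (metis Suc_pred' funpow_Suc_right o_apply w_def)
    then show ?thesis by blast
  qed
  then have ex: "\<exists>j. w j \<in> {p, q}" by auto
  define k where "k = (LEAST j. w j \<in> {p, q})"
  have k: "w k \<in> {p, q}" unfolding k_def by (rule LeastI_ex[OF ex])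
  have less: "w j \<noteq> p" "w j \<noteq> q" if "j < k" for j
    using not_less_Least[of j "\<lambda>j. w j \<in> {p, q}"] that by (auto simp: k_def)
  define Z where "Z = w ` {..k}"
  have ZA: "Z \<subseteq> A" using wA by (auto simp: Z_def)
  have fst: "w 0 = f p" by (simp add: w_def)
  have ge: "(w 0, w j) \<in> links (graph_of A g)" "(w 0, w j) \<in> links (graph_of A f)" if "j \<le> k" for j
  proof -
    have "(w 0, w j) \<in> links (graph_of A g) \<and> (w 0, w j) \<in> links (graph_of A f)"
      using that
    proof (induction j)
      case 0
      show ?case by (simp add: links_refl)
    next
      case (Suc j)
      then have j: "j < k" by simp
      have "(w j, w (Suc j)) \<in> graph_of A f" "(w j, w (Suc j)) \<in> graph_of A g"
        using wA[of j] g(4)[OF less[OF j]] by (auto simp: graph_of_def w_Suc intro!: exI[of _ "w j"])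
      then have "(w j, w (Suc j)) \<in> links (graph_of A f)" "(w j, w (Suc j)) \<in> links (graph_of A g)"
        by (simp_all add: subsetD[OF links_base])
      then show ?case using Suc links_trans by (meson Suc_leD)
    qed
    then show "(w 0, w j) \<in> links (graph_of A g)" "(w 0, w j) \<in> links (graph_of A f)" by auto
  qed
  have pf: "(p, w 0) \<in> links (graph_of A f)" and qg: "(q, w 0) \<in> links (graph_of A g)"
    using links_base[of "graph_of A f"] links_base[of "graph_of A g"] pq g(3)
    by (auto simp: graph_of_def fst)
  have step: "h a \<in> Z \<longleftrightarrow> a \<in> Z"
    if h: "h permutes A" "\<And>j. j < k \<Longrightarrow> h (w j) = w (Suc j)" "h (w k) = w 0" for h a
  proof (rule permutes_closed[OF h(1) A ZA])
    fix a assume "a \<in> Z"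
    then obtain j where j: "j \<le> k" "a = w j" by (auto simp: Z_def)
    show "h a \<in> Z"
    proof (cases "j = k")
      case True
      then show ?thesis using h(3) j by (auto simp: Z_def)
    next
      case False
      then have "j < k" using j(1) by simp
      then show ?thesis using h(2)[of j] j(2) by (auto simp: Z_def)
    qed
  qed
  have wk: "w k \<in> Z" by (auto simp: Z_def)
  show ?thesis
  proof (cases "w k = p")
    case True
    \<comment> \<open>The path closes up at \<open>p\<close>: it is a whole cycle of
      \<open>f\<close> that misses \<open>q\<close>, while \<open>g\<close> enters it from
      \<open>q\<close>.\<close>
    have "(p, q) \<in> links (graph_of A g)"
      using ge(1)[of k] qg True links_sym links_trans by (metis order_refl)
    moreover have "q \<notin> Z"
    proof
      assume "q \<in> Z"
      then obtain j where "j \<le> k" "w j = q" by (auto simp: Z_def)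
      then show False using True less(2)[of j] pq(3) by (cases "j = k") auto
    qed
    moreover have "f a \<in> Z \<longleftrightarrow> a \<in> Z" for a
      by (rule step[OF f]) (use True in \<open>auto simp: w_Suc fst\<close>)
    ultimately show ?thesis
      using links_closed[of p q "graph_of A f" Z] wk True by (auto simp: graph_of_def)
  next
    case False
    then have wq: "w k = q" using k by auto
    \<comment> \<open>Now the path is a whole cycle of \<open>g\<close> that misses
      \<open>p\<close>, while \<open>f\<close> enters it from \<open>p\<close>.\<close>
    have "(p, q) \<in> links (graph_of A f)"
      using ge(2)[of k] pf wq links_trans by (metis order_refl)
    moreover have "p \<notin> Z"
    proof
      assume "p \<in> Z"
      then obtain j where "j \<le> k" "w j = p" by (auto simp: Z_def)
      then show False using False less(1)[of j] by (cases "j = k") auto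
    qed
    moreover have "g a \<in> Z \<longleftrightarrow> a \<in> Z" for a
      by (rule step[OF g(1)]) (use g(3,4) less wq in \<open>auto simp: w_Suc fst\<close>)
    ultimately show ?thesis
      using links_closed[of p q "graph_of A g" Z] wk wq by (auto simp: graph_of_def)
  qed
qed

text \<open>Once \<open>p\<close> and \<open>q\<close> are united, exchanging their images goes
  unnoticed, so the united cycles of \<open>f\<close> contain each step of \<open>g\<close>. The
  roles of \<open>f\<close> and \<open>g\<close> are symmetric.\<close>

lemma transpose_links_unite:
  assumes f: "f permutes A" and A: "finite A" and pq: "p \<in> A" "q \<in> A" "p \<noteq> q"
    and g: "g permutes A" "g p = f q" "g q = f p" "\<And>a. a \<noteq> p \<Longrightarrow> a \<noteq> q \<Longrightarrow> g a = f a"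
  shows "unite (links (graph_of A g)) p q = unite (links (graph_of A f)) p q"
proof -
  have *: "unite (links (graph_of A g)) p q \<subseteq> unite (links (graph_of A f)) p q"
    if gf: "g p = f q" "g q = f p" "\<And>a. a \<noteq> p \<Longrightarrow> a \<noteq> q \<Longrightarrow> g a = f a" for f g :: "'a \<Rightarrow> 'a"
  proof (rule unite_least[OF equiv_unite[OF equiv_links]])
    note E = equiv_UNIV_D[OF equiv_unite[OF equiv_links[of "graph_of A f"], of p q]]
    show pq': "(p, q) \<in> unite (links (graph_of A f)) p q"
      by (simp add: unite_iff links_refl)
    have base: "(a, f a) \<in> unite (links (graph_of A f)) p q" if "a \<in> A" for a
      using subsetD[OF links_base, of "(a, f a)" "graph_of A f"] that by (auto simp: graph_of_def unite_iff)
    show "links (graph_of A g) \<subseteq> unite (links (graph_of A f)) p q"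
    proof (rule links_least[OF _ equiv_unite[OF equiv_links]])
      have "(a, g a) \<in> unite (links (graph_of A f)) p q" if "a \<in> A" for a
        using gf base[OF that] base[OF pq(1)] base[OF pq(2)] pq' E(2,3) by metis
      then show "graph_of A g \<subseteq> unite (links (graph_of A f)) p q" by (auto simp: graph_of_def)
    qed
  qed
  have "f p = g q" "f q = g p" "\<And>a. a \<noteq> p \<Longrightarrow> a \<noteq> q \<Longrightarrow> f a = g a" using g by auto
  then show ?thesis using *[of g f, OF g(2-4)] *[of f g] by blast
qed

section \<open>The circles of a checkerboard coloured diagram\<close>

lemma generated_classes_links: "generated_classes V R = V // links R"
  by (simp add: generated_classes_def links_def)

locale coloured_diagram =
  fixes K :: knot_code and S :: "region set"
  assumes diagram: "knot_diagram K" and colouring: "checkerboard K S"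
begin

abbreviation "nc \<equiv> crossings K"

abbreviation "same_region \<equiv> links (corner_relation K)"

section \<open>Arcs and their ends at the crossings\<close>

lemma times:
  assumes "c < nc"
  shows "under_time K c < 2 * nc" "over_time K c < 2 * nc"
proof -
  have "case_sum (under_time K) (over_time K) ` ({..<nc} <+> {..<nc}) = {..<2 * nc}"
    using diagram by (simp add: knot_diagram_def bij_betw_def)
  then show "under_time K c < 2 * nc" "over_time K c < 2 * nc"
    using assms by (force simp: image_iff set_eq_iff)+
qed

lemma times_inj:
  assumes "c < nc" "c' < nc"
  shows "under_time K c = under_time K c' \<longleftrightarrow> c = c'" "over_time K c = over_time K c' \<longleftrightarrow> c = c'"
    "under_time K c \<noteq> over_time K c'"
proof -
  have inj: "inj_on (case_sum (under_time K) (over_time K)) ({..<nc} <+> {..<nc})"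
    using diagram by (simp add: knot_diagram_def bij_betw_def)
  show "under_time K c = under_time K c' \<longleftrightarrow> c = c'" "over_time K c = over_time K c' \<longleftrightarrow> c = c'"
    "under_time K c \<noteq> over_time K c'"
    using inj_onD[OF inj, of "Inl c" "Inl c'"] inj_onD[OF inj, of "Inr c" "Inr c'"]
      inj_onD[OF inj, of "Inl c" "Inr c'"] assms by auto
qed

lemma times_surj:
  assumes "t < 2 * nc"
  obtains c where "c < nc" "t = under_time K c" | c where "c < nc" "t = over_time K c"
proof -
  have "t \<in> case_sum (under_time K) (over_time K) ` ({..<nc} <+> {..<nc})"
    using diagram assms by (simp add: knot_diagram_def bij_betw_def)
  then show ?thesis using that by auto
qed

lemma arcs_eq: "0 < nc \<Longrightarrow> arcs K = {..<2 * nc}"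
  by (auto simp: arcs_def)

lemma arc_at_in: "c < nc \<Longrightarrow> arc_at K c q \<in> arcs K"
  using times[of c] by (auto simp: arc_at_def next_arc_def arcs_def)

lemma next_arc_inj:
  assumes "s < 2 * nc" "t < 2 * nc" "next_arc K s = next_arc K t"
  shows "s = t"
proof -
  have "Suc s = Suc t" if "Suc s < 2 * nc" "Suc t < 2 * nc"
    using assms that by (simp add: next_arc_def)
  then show ?thesis
    using assms by (cases "Suc s < 2 * nc"; cases "Suc t < 2 * nc") (auto simp: next_arc_def not_less le_Suc_eq)
qed

lemma next_arc_surj:
  assumes "t < 2 * nc"
  obtains s where "s < 2 * nc" "next_arc K s = t"
proof (cases t)
  case 0
  then show ?thesis using that[of "2 * nc - 1"] assms by (simp add: next_arc_def)
next
  case (Suc s)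
  then show ?thesis using that[of s] assms by (simp add: next_arc_def)
qed

definition passage :: "nat \<Rightarrow> nat \<Rightarrow> nat" where
  "passage c q = (if even q then under_time K c else over_time K c)"

lemma arc_at_passage:
  assumes "q < 4"
  shows "arc_at K c q = (if outgoing K c q then next_arc K (passage c q) else passage c q)"
proof -
  have "q \<in> {0, 1, 2, 3}" using assms by auto
  then show ?thesis by (auto simp: arc_at_def outgoing_def passage_def split: if_splits)
qed

lemma passage_inj:
  assumes "c < nc" "c' < nc" "q < 4" "q' < 4" "outgoing K c q = outgoing K c' q'" "passage c q = passage c' q'"
  shows "c = c' \<and> q = q'"
proof -
  have q: "q \<in> {0, 1, 2, 3}" "q' \<in> {0, 1, 2, 3}" using assms by auto
  show ?thesis
    using q assms(5,6) times_inj[OF assms(1,2)] times_inj(3)[OF assms(2,1)]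
    by (auto simp: passage_def outgoing_def split: if_splits)
qed

lemma passage_surj:
  assumes "t < 2 * nc"
  shows "\<exists>c q. c < nc \<and> q < 4 \<and> outgoing K c q = b \<and> passage c q = t"
proof -
  have *: "\<exists>q<4. even q \<and> outgoing K c q = b" "\<exists>q<4. odd q \<and> outgoing K c q = b" for c
  proof -
    show "\<exists>q<4. even q \<and> outgoing K c q = b"
      by (rule exI[of _ "if b then 2 else 0"]) (auto simp: outgoing_def)
    show "\<exists>q<4. odd q \<and> outgoing K c q = b"
      by (rule exI[of _ "if b = pos_crossing K c then 1 else 3"]) (auto simp: outgoing_def)
  qed
  from assms show ?thesis
  proof (rule times_surj)
    fix c assume "c < nc" "t = under_time K c"
    then show ?thesis using *(1)[of c] by (auto simp: passage_def)
  next
    fix c assume "c < nc" "t = over_time K c"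
    then show ?thesis using *(2)[of c] by (auto simp: passage_def)
  qed
qed

lemma end_unique:
  assumes "c < nc" "c' < nc" "q < 4" "q' < 4" "outgoing K c q = outgoing K c' q'" "arc_at K c q = arc_at K c' q'"
  shows "c = c' \<and> q = q'"
proof -
  have "passage c q < 2 * nc" "passage c' q' < 2 * nc" using times assms(1,2) by (auto simp: passage_def)
  then have "passage c q = passage c' q'"
    using assms(5,6) next_arc_inj by (auto simp: arc_at_passage[OF assms(3)] arc_at_passage[OF assms(4)] split: if_splits)
  then show ?thesis using passage_inj assms by blast
qed

lemma end_exists:
  assumes "a \<in> arcs K" "0 < nc"
  shows "\<exists>c q. c < nc \<and> q < 4 \<and> outgoing K c q = b \<and> arc_at K c q = a"
proof -
  have a: "a < 2 * nc" using assms arcs_eq by auto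
  show ?thesis
  proof (cases b)
    case True
    obtain s where s: "s < 2 * nc" "next_arc K s = a" using next_arc_surj[OF a] .
    then show ?thesis using passage_surj[OF s(1), of b] True by (metis arc_at_passage)
  next
    case False
    then show ?thesis using passage_surj[OF a, of b] by (metis arc_at_passage)
  qed
qed

section \<open>Regions and shading\<close>

lemma regions_eq: "regions K = (arcs K \<times> UNIV) // same_region"
  by (simp add: regions_def generated_classes_links)

lemma region_of_side:
  assumes "a \<in> arcs K"
  shows "region_of_side K (a, b) = same_region `` {(a, b)}" "region_of_side K (a, b) \<in> regions K"
    "(a, b) \<in> region_of_side K (a, b)"
proof -
  let ?R = "same_region `` {(a, b)}"
  have R: "?R \<in> regions K" "(a, b) \<in> ?R"
    using assms by (auto simp: regions_eq quotient_def links_refl)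
  moreover have "R' = ?R" if R': "R' \<in> regions K" "(a, b) \<in> R'" for R'
  proof -
    obtain z where z: "R' = same_region `` {z}" using R'(1) by (auto simp: regions_eq quotient_def)
    then show ?thesis using R'(2) class_eq_iff[OF equiv_links, of "corner_relation K" z "(a, b)"] by auto
  qed
  ultimately show e: "region_of_side K (a, b) = ?R"
    unfolding region_of_side_def by (intro the_equality) blast+
  show "region_of_side K (a, b) \<in> regions K" "(a, b) \<in> region_of_side K (a, b)" unfolding e using R by auto
qed

lemma region_of_side_eq_iff:
  "a \<in> arcs K \<Longrightarrow> a' \<in> arcs K \<Longrightarrow>
    region_of_side K (a, b) = region_of_side K (a', b') \<longleftrightarrow> ((a, b), (a', b')) \<in> same_region"
  by (simp add: region_of_side class_eq_iff[OF equiv_links])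

lemma region_exists:
  assumes "R \<in> regions K"
  obtains a b where "a \<in> arcs K" "R = region_of_side K (a, b)"
  using assms region_of_side(1) that by (auto simp: regions_eq quotient_def)

lemma sides: "a \<in> arcs K \<Longrightarrow> region_of_side K (a, \<not> b) \<in> S \<longleftrightarrow> region_of_side K (a, b) \<notin> S"
  using colouring by (cases b) (auto simp: checkerboard_def)

abbreviation "shaded c q \<equiv> region_at K c q \<in> S"

lemma region_at_next:
  assumes "c < nc" "q < 4"
  shows "region_at K c q = region_of_side K (arc_at K c ((q + 1) mod 4), \<not> outgoing K c ((q + 1) mod 4))"
  unfolding region_at_def region_of_side_eq_iff[OF arc_at_in[OF assms(1)] arc_at_in[OF assms(1)]]
proof (rule subsetD[OF links_base])
  show "((arc_at K c q, outgoing K c q),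
      (arc_at K c ((q + 1) mod 4), \<not> outgoing K c ((q + 1) mod 4))) \<in> corner_relation K"
    using assms unfolding corner_relation_def mem_Collect_eq by (intro exI[of _ c] exI[of _ q]) simp
qed

lemma shaded_next:
  assumes "c < nc" "q < 4"
  shows "shaded c ((q + 1) mod 4) \<longleftrightarrow> \<not> shaded c q"
  unfolding region_at_next[OF assms] using sides[OF arc_at_in[OF assms(1)]]
  by (simp add: region_at_def)

lemma shaded_cases:
  assumes "c < nc"
  shows "shaded c 2 \<longleftrightarrow> shaded c 0" "shaded c 1 \<longleftrightarrow> \<not> shaded c 0" "shaded c 3 \<longleftrightarrow> \<not> shaded c 0"
proof -
  have "shaded c 1 \<longleftrightarrow> \<not> shaded c 0" using shaded_next[OF assms, of 0] by simp
  moreover have "shaded c 2 \<longleftrightarrow> \<not> shaded c 1"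
    using shaded_next[OF assms, of 1] by (simp add: numeral_2_eq_2)
  moreover have "shaded c 3 \<longleftrightarrow> \<not> shaded c 2" using shaded_next[OF assms, of 2] by simp
  ultimately show "shaded c 2 \<longleftrightarrow> shaded c 0" "shaded c 1 \<longleftrightarrow> \<not> shaded c 0" "shaded c 3 \<longleftrightarrow> \<not> shaded c 0"
    by simp_all
qed

definition left_shaded :: "nat \<Rightarrow> bool" where
  "left_shaded a \<longleftrightarrow> region_of_side K (a, True) \<in> S"

lemma shaded_end: "c < nc \<Longrightarrow> shaded c q \<longleftrightarrow> (outgoing K c q \<longleftrightarrow> left_shaded (arc_at K c q))"
  using sides[OF arc_at_in[of c q], of True] by (cases "outgoing K c q") (auto simp: region_at_def left_shaded_def)

text \<open>Every arc is directed so that the shaded region is on its left. It then leaves a crossing at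
  an end whose left corner is shaded, so every smoothing respects these directions.\<close>

lemma shaded_end_unique:
  assumes "c < nc" "c' < nc" "q < 4" "q' < 4" "shaded c q = shaded c' q'" "arc_at K c q = arc_at K c' q'"
  shows "c = c' \<and> q = q'"
  using end_unique[OF assms(1-4) _ assms(6)] assms(5,6) shaded_end[OF assms(1)] shaded_end[OF assms(2)] by auto

lemma shaded_end_exists:
  assumes "a \<in> arcs K" "0 < nc"
  shows "\<exists>c q. c < nc \<and> q < 4 \<and> shaded c q = b \<and> arc_at K c q = a"
  using end_exists[OF assms, of "b = left_shaded a"] shaded_end by (metis (full_types))

text \<open>The end to which the smoothing joins end \<open>q\<close>: A pairs 0 with 1 and 2 with
  3, B pairs 1 with 2 and 3 with 0. Both pair ends of different parity, hence of different
  shading.\<close>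

definition mate :: "nat set \<Rightarrow> nat \<Rightarrow> nat \<Rightarrow> nat" where
  "mate B c q = (if c \<in> B then 3 - q else if even q then q + 1 else q - 1)"

lemma mate:
  assumes "c < nc" "q < 4"
  shows "mate B c q < 4" "mate B c (mate B c q) = q" "shaded c (mate B c q) \<longleftrightarrow> \<not> shaded c q"
proof -
  have "q \<in> {0, 1, 2, 3}" using assms by auto
  then show "mate B c q < 4" "mate B c (mate B c q) = q" "shaded c (mate B c q) \<longleftrightarrow> \<not> shaded c q"
    using shaded_cases[OF assms(1)] by (elim insertE emptyE; simp add: mate_def)+
qed

text \<open>The next arc on the circle when the shaded region is kept on the left: an arc arrives at
  the end whose left corner is unshaded. The default \<open>a\<close> makes this a permutation of
  all numbers and also covers the round circle.\<close>

definition succ :: "nat set \<Rightarrow> nat \<Rightarrow> nat" where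
  "succ B a = (if a \<in> arcs K \<and> 0 < nc
     then THE b. \<exists>c q. c < nc \<and> q < 4 \<and> \<not> shaded c q \<and> arc_at K c q = a \<and> b = arc_at K c (mate B c q) else a)"

lemma succ_arc_at:
  assumes "c < nc" "q < 4" "\<not> shaded c q"
  shows "succ B (arc_at K c q) = arc_at K c (mate B c q)"
proof -
  have "c' = c \<and> q' = q"
    if "c' < nc" "q' < 4" "\<not> shaded c' q'" "arc_at K c' q' = arc_at K c q" for c' q'
    using shaded_end_unique[of c' c q' q] that assms by simp
  then show ?thesis
    using assms arc_at_in[OF assms(1), of q] unfolding succ_def by (auto intro!: the_equality)
qed

lemma unshaded_end:
  assumes "a \<in> arcs K" "0 < nc"
  obtains c q where "c < nc" "q < 4" "\<not> shaded c q" "arc_at K c q = a" "\<forall>B. succ B a = arc_at K c (mate B c q)"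
  using shaded_end_exists[OF assms, of False] succ_arc_at that by metis

lemma succ_permutes: "succ B permutes arcs K"
proof (rule inj_imp_permutes)
  show "finite (arcs K)" by (simp add: arcs_def)
  show "succ B a = a" if "a \<notin> arcs K" for a using that by (simp add: succ_def)
  show "succ B a \<in> arcs K" if a: "a \<in> arcs K" for a
  proof (cases "0 < nc")
    case True
    then obtain c q where "c < nc" "succ B a = arc_at K c (mate B c q)" using unshaded_end[OF a] by metis
    then show ?thesis using arc_at_in by simp
  qed (use a in \<open>simp add: succ_def\<close>)
  show "inj_on (succ B) (arcs K)"
  proof (rule inj_onI)
    fix a b assume ab: "a \<in> arcs K" "b \<in> arcs K" "succ B a = succ B b"
    show "a = b"
    proof (cases "0 < nc")
      case True
      obtain c q where c: "c < nc" "q < 4" "\<not> shaded c q" "arc_at K c q = a" "\<forall>B. succ B a = arc_at K c (mate B c q)"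
        by (rule unshaded_end[OF ab(1) True])
      obtain e r where e: "e < nc" "r < 4" "\<not> shaded e r" "arc_at K e r = b" "\<forall>B. succ B b = arc_at K e (mate B e r)"
        by (rule unshaded_end[OF ab(2) True])
      have "shaded c (mate B c q) = shaded e (mate B e r)"
        using mate(3)[OF c(1,2), of B] mate(3)[OF e(1,2), of B] c(3) e(3) by simp
      moreover have "arc_at K c (mate B c q) = arc_at K e (mate B e r)"
        using ab(3) c(5) e(5) by metis
      ultimately have "c = e \<and> mate B c q = mate B e r"
        by (rule shaded_end_unique[OF c(1) e(1) mate(1)[OF c(1,2)] mate(1)[OF e(1,2)]])
      then show ?thesis using mate(2)[OF c(1,2), of B] mate(2)[OF e(1,2), of B] c(4) e(4) by metis
    qed (use ab in \<open>simp add: succ_def\<close>)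
  qed
qed

lemma smoothing_iff:
  "(a, b) \<in> smoothing K B \<longleftrightarrow>
    (\<exists>c<nc. \<exists>q\<in>(if c \<in> B then {1, 3} else {0, 2}). a = arc_at K c q \<and> b = arc_at K c (mate B c q))"
proof -
  have "(a, b) \<in> smoothing K B \<longleftrightarrow> (\<exists>c<nc.
      (c \<notin> B \<and> (a = arc_at K c 0 \<and> b = arc_at K c 1 \<or> a = arc_at K c 2 \<and> b = arc_at K c 3)) \<or>
      (c \<in> B \<and> (a = arc_at K c 1 \<and> b = arc_at K c 2 \<or> a = arc_at K c 3 \<and> b = arc_at K c 0)))"
    unfolding smoothing_def by blast
  also have "\<dots> \<longleftrightarrow>
    (\<exists>c<nc. \<exists>q\<in>(if c \<in> B then {1, 3} else {0, 2}). a = arc_at K c q \<and> b = arc_at K c (mate B c q))"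
    by (rule ex_cong1) (simp add: mate_def)
  finally show ?thesis .
qed

lemma smoothingI:
  "c < nc \<Longrightarrow> q \<in> (if c \<in> B then {1, 3} else {0, 2}) \<Longrightarrow>
    (arc_at K c q, arc_at K c (mate B c q)) \<in> smoothing K B"
  unfolding smoothing_iff by blast

lemma smoothingE:
  assumes "(a, b) \<in> smoothing K B"
  obtains c q where "c < nc" "q < 4" "a = arc_at K c q" "b = arc_at K c (mate B c q)"
proof -
  obtain c q where "c < nc" "q \<in> (if c \<in> B then {1, 3} else {0, 2})" "a = arc_at K c q" "b = arc_at K c (mate B c q)"
    using assms unfolding smoothing_iff by blast
  then show ?thesis using that[of c q] by (auto split: if_splits)
qed

lemma smoothing_mate:
  assumes "c < nc" "q < 4"
  shows "(arc_at K c q, arc_at K c (mate B c q)) \<in> links (smoothing K B)"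
proof -
  have "q \<in> {0, 1, 2, 3}" using assms by auto
  then have "q \<in> (if c \<in> B then {1, 3} else {0, 2}) \<or> mate B c q \<in> (if c \<in> B then {1, 3} else {0, 2})"
    by (auto simp: mate_def)
  then have "(arc_at K c q, arc_at K c (mate B c q)) \<in> smoothing K B \<or>
      (arc_at K c (mate B c q), arc_at K c q) \<in> smoothing K B"
    using smoothingI[OF assms(1), of q B] smoothingI[OF assms(1), of "mate B c q" B] mate(2)[OF assms, of B]
    by metis
  then show ?thesis by (metis links_sym subsetD[OF links_base])
qed

text \<open>Each pair of ends joined at a crossing has one arriving end, so it is a step of
  \<open>succ\<close>, forwards or backwards.\<close>

lemma links_smoothing:
  assumes "0 < nc"
  shows "links (smoothing K B) = links (graph_of (arcs K) (succ B))"
proof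
  let ?L = "links (graph_of (arcs K) (succ B))"
  have L: "(arc_at K c q, arc_at K c (mate B c q)) \<in> ?L" if "c < nc" "q < 4" "\<not> shaded c q" for c q
    using links_base[of "graph_of (arcs K) (succ B)"] arc_at_in[OF that(1), of q] succ_arc_at[OF that, of B]
    by (auto simp: graph_of_def)
  show "links (smoothing K B) \<subseteq> ?L"
  proof (rule links_least[OF _ equiv_links], rule subrelI)
    fix a b assume "(a, b) \<in> smoothing K B"
    then obtain c q where c: "c < nc" "q < 4" "a = arc_at K c q" "b = arc_at K c (mate B c q)"
      by (rule smoothingE)
    show "(a, b) \<in> ?L"
    proof (cases "shaded c q")
      case True
      then have "(b, a) \<in> ?L" using L[of c "mate B c q"] mate[OF c(1,2), of B] c by simp
      then show ?thesis by (rule links_sym)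
    qed (use L c in simp)
  qed
  show "?L \<subseteq> links (smoothing K B)"
  proof (rule links_least[OF _ equiv_links], rule subrelI)
    fix a b assume "(a, b) \<in> graph_of (arcs K) (succ B)"
    then have ab: "a \<in> arcs K" "b = succ B a" by (auto simp: graph_of_def)
    obtain c q where "c < nc" "q < 4" "\<not> shaded c q" "arc_at K c q = a" "\<forall>B. succ B a = arc_at K c (mate B c q)"
      by (rule unshaded_end[OF ab(1) assms])
    then show "(a, b) \<in> links (smoothing K B)" using smoothing_mate[of c q B] ab by simp
  qed
qed

lemma unite_cong:
  assumes "equiv UNIV R" "(p, p') \<in> R" "(q, q') \<in> R"
  shows "unite R p q = unite R p' q'"
proof -
  note E = equiv_UNIV_D[OF assms(1)]
  have "(a, b) \<in> unite R p q \<longleftrightarrow> (a, b) \<in> unite R p' q'" for a b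
    unfolding unite_iff using E(2,3) assms(2,3) by metis
  then show ?thesis by auto
qed

lemma link_cong:
  assumes "equiv UNIV R" "(p, p') \<in> R" "(q, q') \<in> R"
  shows "(p, q) \<in> R \<longleftrightarrow> (p', q') \<in> R"
  using equiv_UNIV_D(2,3)[OF assms(1)] assms(2,3) by metis

lemma surgery_links:
  assumes c: "c < nc"
  shows "unite (links (smoothing K (flip c B))) (arc_at K c 0) (arc_at K c 2) =
      unite (links (smoothing K B)) (arc_at K c 0) (arc_at K c 2)" (is ?unite)
    and "(arc_at K c 0, arc_at K c 2) \<in> links (smoothing K (flip c B)) \<longleftrightarrow>
      (arc_at K c 0, arc_at K c 2) \<notin> links (smoothing K B)" (is ?xor)
proof -
  have n: "0 < nc" using c by simp
  \<comment> \<open>The two ends at which arcs arrive at \<open>c\<close>. Flipping \<open>c\<close>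
    exchanges their successors and no others.\<close>
  define r r' where "r = (if shaded c 0 then 1 else (0::nat))" and "r' = (if shaded c 0 then 3 else (2::nat))"
  define p q where "p = arc_at K c r" and "q = arc_at K c r'"
  have r: "r < 4" "r' < 4" "\<not> shaded c r" "\<not> shaded c r'"
    using shaded_cases[OF c] by (auto simp: r_def r'_def)
  have pq: "p \<in> arcs K" "q \<in> arcs K" using arc_at_in[OF c] by (auto simp: p_def q_def)
  have "p \<noteq> q"
    using shaded_end_unique[OF c c r(1,2)] r(3,4) by (auto simp: p_def q_def r_def r'_def split: if_splits)
  have s: "succ B p = arc_at K c (mate B c r)" "succ B q = arc_at K c (mate B c r')" for B
    using succ_arc_at[OF c r(1,3)] succ_arc_at[OF c r(2,4)] by (auto simp: p_def q_def)
  have m: "mate (flip c B) c r = mate B c r'" "mate (flip c B) c r' = mate B c r"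
    by (auto simp: mate_def r_def r'_def flip_def)
  have g: "succ (flip c B) p = succ B q" "succ (flip c B) q = succ B p" unfolding s m by auto
  have other: "succ (flip c B) a = succ B a" if "a \<noteq> p" "a \<noteq> q" for a
  proof (cases "a \<in> arcs K")
    case True
    obtain e t where e: "e < nc" "t < 4" "\<not> shaded e t" "arc_at K e t = a" "\<forall>B. succ B a = arc_at K e (mate B e t)"
      by (rule unshaded_end[OF True n])
    have "e \<noteq> c"
    proof
      assume "e = c"
      moreover have "t \<in> {0, 1, 2, 3}" using e(2) by auto
      ultimately have "t = r \<or> t = r'" using e(3) shaded_cases[OF c] by (auto simp: r_def r'_def split: if_splits)
      then show False using that e(4) \<open>e = c\<close> by (auto simp: p_def q_def)
    qed
    then show ?thesis by (simp add: e(5) mate_def in_flip_iff)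
  qed (simp add: succ_def)
  have fin: "finite (arcs K)" by (simp add: arcs_def)
  note U = transpose_links_unite[OF succ_permutes fin pq \<open>p \<noteq> q\<close> succ_permutes g other]
  note X = transpose_links_xor[OF succ_permutes fin pq \<open>p \<noteq> q\<close> succ_permutes g other]
  \<comment> \<open>The arriving ends may be 1 and 3. Each smoothing then still places them, in some
    order, on the circles through the ends 0 and 2.\<close>
  have xy: "(p, arc_at K c 0) \<in> links (smoothing K B) \<and> (q, arc_at K c 2) \<in> links (smoothing K B) \<or>
      (q, arc_at K c 0) \<in> links (smoothing K B) \<and> (p, arc_at K c 2) \<in> links (smoothing K B)" for B
  proof (cases "shaded c 0")
    case True
    then show ?thesis
      using smoothing_mate[OF c, of 1 B] smoothing_mate[OF c, of 3 B]
      by (cases "c \<in> B") (auto simp: p_def q_def r_def r'_def mate_def)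
  next
    case False
    then show ?thesis by (simp add: p_def q_def r_def r'_def links_refl)
  qed
  have u: "unite (links (smoothing K B)) (arc_at K c 0) (arc_at K c 2) = unite (links (smoothing K B)) p q" for B
    using xy[of B] unite_cong[OF equiv_links, of p "arc_at K c 0" "smoothing K B" q "arc_at K c 2"]
      unite_cong[OF equiv_links, of q "arc_at K c 0" "smoothing K B" p "arc_at K c 2"]
      unite_commute[of "links (smoothing K B)" q p] by metis
  have l: "(arc_at K c 0, arc_at K c 2) \<in> links (smoothing K B) \<longleftrightarrow> (p, q) \<in> links (smoothing K B)" for B
    using xy[of B] link_cong[OF equiv_links, of p "arc_at K c 0" "smoothing K B" q "arc_at K c 2"]
      link_cong[OF equiv_links, of q "arc_at K c 0" "smoothing K B" p "arc_at K c 2"]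
      links_sym by metis
  show ?unite unfolding u using U unfolding links_smoothing[OF n] .
  show ?xor unfolding l using X unfolding links_smoothing[OF n] .
qed

lemma smoothing_arcs:
  assumes "(a, b) \<in> links (smoothing K B)" "a \<in> arcs K"
  shows "b \<in> arcs K"
  using links_closed[OF assms(1), of "arcs K"] assms(2) arc_at_in by (auto elim!: smoothingE)

sublocale circle_system nc "arcs K" "\<lambda>B. links (smoothing K B)" "\<lambda>c. arc_at K c 0" "\<lambda>c. arc_at K c 2" 0
proof
  show "finite (arcs K)" "0 \<in> arcs K" by (auto simp: arcs_def)
qed (use arc_at_in equiv_links smoothing_arcs surgery_links in blast)+

lemma circles_eq: "circles K B = circ B"
  by (auto simp: circles_def generated_classes_links quotient_def)

lemma resolve_map_eq: "resolve_map K = resolve"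
  by (intro ext) (simp add: resolve_map_def resolve_def circles_eq)

end

section \<open>Cycles, spanning trees and activities\<close>

lemma links_mono: "R \<subseteq> R' \<Longrightarrow> links R \<subseteq> links R'"
  unfolding links_def by (rule rtrancl_mono) auto

lemma links_insert: "links (insert (p, q) R) = unite (links R) p q"
proof
  have "(p, q) \<in> unite (links R) p q" by (simp add: unite_iff links_refl)
  moreover have "R \<subseteq> unite (links R) p q" using links_base[of R] by (auto simp: unite_def)
  ultimately show "links (insert (p, q) R) \<subseteq> unite (links R) p q"
    by (intro links_least equiv_unite equiv_links) simp
  have "(p, q) \<in> links (insert (p, q) R)" by (rule subsetD[OF links_base]) simp
  then show "unite (links R) p q \<subseteq> links (insert (p, q) R)"
    by (intro unite_least equiv_links links_mono) auto
qed

locale multigraph =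
  fixes G :: "('v, 'e::linorder) signed_graph" and u v :: "'e \<Rightarrow> 'v"
  assumes finite_edges: "finite (edges G)" and finite_verts: "finite (verts G)"
    and ends: "\<And>e. e \<in> edges G \<Longrightarrow> ends G e = {u e, v e}"
    and ends_verts: "\<And>e. e \<in> edges G \<Longrightarrow> u e \<in> verts G" "\<And>e. e \<in> edges G \<Longrightarrow> v e \<in> verts G"
begin

definition L :: "'e set \<Rightarrow> ('v \<times> 'v) set" where
  "L T = links ((\<lambda>e. (u e, v e)) ` T)"

section \<open>Connectivity, cycles and spanning trees\<close>

lemma equiv_L: "equiv UNIV (L T)"
  unfolding L_def by (rule equiv_links)

lemmas L_eq = equiv_UNIV_D[OF equiv_L]

lemma L_insert: "L (insert e T) = unite (L T) (u e) (v e)"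
  by (simp add: L_def links_insert)

lemma L_mono: "T \<subseteq> T' \<Longrightarrow> L T \<subseteq> L T'"
  unfolding L_def by (intro links_mono image_mono)

lemma L_monoD: "(a, b) \<in> L T \<Longrightarrow> T \<subseteq> T' \<Longrightarrow> (a, b) \<in> L T'"
  using L_mono by blast

lemma L_edge: "e \<in> T \<Longrightarrow> (u e, v e) \<in> L T"
  unfolding L_def by (rule subsetD[OF links_base]) simp

lemma L_least: "(\<And>e. e \<in> T' \<Longrightarrow> (u e, v e) \<in> L T) \<Longrightarrow> L T' \<subseteq> L T"
  unfolding L_def by (rule links_least[OF _ equiv_links]) auto

lemma linked_eq_L:
  assumes "T \<subseteq> edges G"
  shows "linked G T a b \<longleftrightarrow> (a, b) \<in> L T"
proof -
  have "(\<exists>e \<in> T. ends G e = {a, b}) \<longleftrightarrow> (\<exists>e \<in> T. (a, b) = (u e, v e) \<or> (b, a) = (u e, v e))" for a b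
    using ends assms by (intro bex_cong refl) (auto simp: doubleton_eq_iff subset_iff)
  then have "{(a, b). \<exists>e \<in> T. ends G e = {a, b}} = (\<lambda>e. (u e, v e)) ` T \<union> ((\<lambda>e. (u e, v e)) ` T)\<inverse>"
    by auto
  then show ?thesis by (simp add: linked_def L_def links_def)
qed

text \<open>The exchange property of the graphic matroid: a connection between the ends of
  \<open>g\<close> that needs \<open>e\<close> runs through \<open>e\<close>, so \<open>g\<close>
  can replace \<open>e\<close>.\<close>

lemma exchange:
  assumes "(u g, v g) \<in> L (insert e P)" "(u g, v g) \<notin> L P"
  shows "(u e, v e) \<in> L (insert g P)"
proof -
  have "(u g, u e) \<in> L P \<and> (v e, v g) \<in> L P \<or> (u g, v e) \<in> L P \<and> (u e, v g) \<in> L P"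
    using assms unfolding L_insert unite_iff by blast
  then show ?thesis unfolding L_insert unite_iff by (metis L_eq(2))
qed

lemma pair_links:
  assumes "{a, b} = {u e, v e}" "(a, b) \<in> L T \<or> (b, a) \<in> L T"
  shows "(u e, v e) \<in> L T"
  using assms L_eq(2)[of a b T] L_eq(2)[of b a T] by (auto simp: doubleton_eq_iff)

lemma cycle_links:
  assumes "is_cycle G C" "e \<in> C"
  shows "(u e, v e) \<in> L (C - {e})"
proof -
  obtain vs es where c: "es \<noteq> []" "length vs = length es" "distinct es" "set es \<subseteq> edges G" "C = set es"
    "\<forall>i < length es. ends G (es ! i) = {vs ! i, vs ! ((i + 1) mod length vs)}"
    using assms(1) unfolding is_cycle_def by blast
  define m where "m = length es"
  have m: "0 < m" using c by (simp add: m_def)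
  obtain i where i: "i < m" "e = es ! i" using assms(2) c by (auto simp: in_set_conv_nth m_def)
  have pair: "{vs ! k, vs ! ((k + 1) mod m)} = {u (es ! k), v (es ! k)}" if "k < m" for k
  proof -
    have "es ! k \<in> edges G" using nth_mem[of k es] that c(4) by (auto simp: m_def)
    from ends[OF this] show ?thesis using c(2) c(6)[rule_format, of k] that by (simp add: m_def)
  qed
  have edge: "(vs ! k, vs ! ((k + 1) mod m)) \<in> L (C - {e})" if "k < m" "k \<noteq> i" for k
  proof -
    have k: "es ! k \<in> C - {e}"
      using that i c nth_eq_iff_index_eq[OF c(3), of k i] by (auto simp: m_def)
    show ?thesis
      using pair[OF that(1)] L_edge[OF k] L_eq(2)[OF L_edge[OF k]] by (auto simp: doubleton_eq_iff)
  qed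
  \<comment> \<open>The long way round the cycle: it starts at the vertex after \<open>e\<close> and
    avoids the index \<open>i\<close> for \<open>m - 1\<close> steps.\<close>
  have path: "(vs ! ((i + 1) mod m), vs ! ((i + 1 + k) mod m)) \<in> L (C - {e})" if "k < m" for k
    using that
  proof (induction k)
    case 0
    then show ?case by (simp add: L_eq(1))
  next
    case (Suc k)
    define j where "j = (i + 1 + k) mod m"
    have "j = (if i + 1 + k < m then i + 1 + k else i + 1 + k - m)"
      using i(1) Suc.prems by (simp add: j_def le_mod_geq)
    then have "j \<noteq> i" using Suc.prems by (simp split: if_splits)
    moreover have "j < m" using m by (simp add: j_def)
    ultimately have "(vs ! j, vs ! ((j + 1) mod m)) \<in> L (C - {e})" by (intro edge)
    moreover have "(j + 1) mod m = (i + 1 + Suc k) mod m" by (simp add: j_def mod_simps)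
    moreover have "(vs ! ((i + 1) mod m), vs ! j) \<in> L (C - {e})" using Suc by (simp add: j_def)
    ultimately show ?case using L_eq(3)[of "vs ! ((i + 1) mod m)" "vs ! j"] by simp
  qed
  have "(i + 1 + (m - 1)) mod m = i" using i m by simp
  then have "(vs ! ((i + 1) mod m), vs ! i) \<in> L (C - {e})" using path[of "m - 1"] m by simp
  then show ?thesis using pair_links[of "vs ! i" "vs ! ((i + 1) mod m)" e] pair[OF i(1)] i(2) by simp
qed

lemma cycle_exists:
  assumes "(u f, v f) \<in> L T" "T \<subseteq> edges G" "f \<in> edges G" "f \<notin> T"
  shows "\<exists>C. is_cycle G C \<and> C \<subseteq> insert f T"
proof -
  let ?r = "\<lambda>a b. \<exists>e \<in> T. ends G e = {a, b}"
  have "?r\<^sup>*\<^sup>* (u f) (v f)"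
    using assms(1) unfolding linked_eq_L[OF assms(2), symmetric] linked_def
    by (simp add: rtranclp_rtrancl_eq)
  then obtain ys where "rtrancl_path ?r (u f) ys (v f)" using rtranclp_eq_rtrancl_path[of ?r] by blast
  then obtain xs where xs: "rtrancl_path ?r (u f) xs (v f)" "distinct (u f # xs)"
    by (rule rtrancl_path_distinct)
  define vs where "vs = u f # xs"
  define k where "k = length xs"
  have step: "\<exists>e. e \<in> T \<and> ends G e = {vs ! i, vs ! Suc i}" if "i < k" for i
    using rtrancl_path_nth[OF xs(1)] that by (auto simp: vs_def k_def)
  \<comment> \<open>The edges of a simple path, with \<open>f\<close> at the last index
    \<open>k\<close> to close it up.\<close>
  define edge where "edge i = (if i = k then f else SOME e. e \<in> T \<and> ends G e = {vs ! i, vs ! Suc i})" for i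
  have edge: "edge i \<in> T" "ends G (edge i) = {vs ! i, vs ! Suc i}" if "i < k" for i
    using someI_ex[OF step[OF that]] that by (auto simp: edge_def)
  define es where "es = map edge [0..<Suc k]"
  have len: "length vs = Suc k" "length es = Suc k" by (simp_all add: vs_def k_def es_def)
  have es_nth: "es ! i = edge i" if "i \<le> k" for i
    using that nth_map[of i "[0..<Suc k]" edge] by (simp add: es_def del: upt_Suc)
  have dvs: "distinct vs" using xs(2) by (simp add: vs_def)
  have nth_vs: "vs ! i = vs ! j \<longleftrightarrow> i = j" if "i \<le> k" "j \<le> k" for i j
    using nth_eq_iff_index_eq[OF dvs, of i j] that len by simp
  have "inj_on edge {0..<Suc k}"
  proof (rule inj_onI)
    fix i j assume ij: "i \<in> {0..<Suc k}" "j \<in> {0..<Suc k}" "edge i = edge j"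
    have "edge i \<noteq> f" if "i < k" for i using edge(1)[OF that] assms(4) by auto
    moreover have "edge k = f" by (simp add: edge_def)
    ultimately consider "i = k" "j = k" | "i < k" "j < k"
      using ij by (metis atLeastLessThan_iff less_SucE)
    then show "i = j"
    proof cases
      case 2
      then have "{vs ! i, vs ! Suc i} = {vs ! j, vs ! Suc j}" using edge(2) ij(3) by metis
      then have "vs ! i = vs ! j \<or> vs ! i = vs ! Suc j \<and> vs ! Suc i = vs ! j" by (auto simp: doubleton_eq_iff)
      then show ?thesis using nth_vs[of i j] nth_vs[of i "Suc j"] nth_vs[of "Suc i" j] 2 by auto
    qed simp
  qed
  then have des: "distinct es" by (simp add: es_def distinct_map del: upt_Suc)
  have last: "vs ! k = v f"
  proof (cases xs)
    \<comment> \<open>An empty path means that \<open>f\<close> is a loop, which is a cycle with one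
      vertex.\<close>
    case Nil
    then have "u f = v f" using xs(1) by (auto elim: rtrancl_path.cases)
    then show ?thesis using Nil by (simp add: vs_def k_def)
  next
    case (Cons a list)
    then have "xs \<noteq> []" by simp
    then show ?thesis using rtrancl_path_last[OF xs(1)] by (simp add: vs_def k_def last_conv_nth nth_Cons')
  qed
  have ends_es: "ends G (es ! i) = {vs ! i, vs ! ((i + 1) mod length vs)}" if "i < length es" for i
  proof (cases "i = k")
    case True
    then show ?thesis using ends[OF assms(3)] last len es_nth[of k] by (auto simp: edge_def vs_def)
  next
    case False
    then have "i < k" using that len by simp
    then show ?thesis using edge(2)[of i] len es_nth[of i] by simp
  qed
  have es_sub: "set es \<subseteq> insert f T"
  proof
    fix e assume "e \<in> set es"
    then obtain i where "i \<le> k" "e = edge i" using len es_nth by (auto simp: in_set_conv_nth less_Suc_eq_le)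
    then show "e \<in> insert f T" using edge(1)[of i] by (cases "i = k") (auto simp: edge_def)
  qed
  have "set vs \<subseteq> verts G"
  proof
    fix a assume "a \<in> set vs"
    then obtain i where i: "i < length es" "a = vs ! i" using len by (auto simp: in_set_conv_nth)
    have g: "es ! i \<in> edges G" using subsetD[OF es_sub nth_mem[OF i(1)]] assms(2,3) by auto
    have "a \<in> ends G (es ! i)" using ends_es[OF i(1)] i(2) by simp
    then show "a \<in> verts G" using ends[OF g] ends_verts[OF g] by auto
  qed
  moreover have "set es \<subseteq> edges G" using es_sub assms(2,3) by auto
  moreover have "es \<noteq> []" "length vs = length es" using len by auto
  ultimately have "is_cycle G (set es)"
    unfolding is_cycle_def using dvs des ends_es by blast
  then show ?thesis using es_sub by blast
qed

lemma spanning_tree_iff: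
  "spanning_tree G T \<longleftrightarrow> T \<subseteq> edges G \<and> (\<forall>a \<in> verts G. \<forall>b \<in> verts G. (a, b) \<in> L T) \<and>
     (\<forall>e \<in> T. (u e, v e) \<notin> L (T - {e}))"
proof (cases "T \<subseteq> edges G")
  case True
  have "(\<forall>C \<subseteq> T. \<not> is_cycle G C) \<longleftrightarrow> (\<forall>e \<in> T. (u e, v e) \<notin> L (T - {e}))"
  proof
    assume no: "\<forall>C \<subseteq> T. \<not> is_cycle G C"
    show "\<forall>e \<in> T. (u e, v e) \<notin> L (T - {e})"
    proof (intro ballI notI)
      fix e assume e: "e \<in> T" "(u e, v e) \<in> L (T - {e})"
      then obtain C where "is_cycle G C" "C \<subseteq> insert e (T - {e})" using cycle_exists[of e "T - {e}"] True by auto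
      then show False using no e(1) by (simp add: insert_absorb)
    qed
  next
    assume no: "\<forall>e \<in> T. (u e, v e) \<notin> L (T - {e})"
    show "\<forall>C \<subseteq> T. \<not> is_cycle G C"
    proof (intro allI impI notI)
      fix C assume C: "C \<subseteq> T" "is_cycle G C"
      then obtain e where e: "e \<in> C" unfolding is_cycle_def by (metis ex_in_conv set_empty)
      have "C - {e} \<subseteq> T - {e}" using C(1) by auto
      then show False using L_monoD[OF cycle_links[OF C(2) e]] no e C(1) by blast
    qed
  qed
  then show ?thesis using True by (simp add: spanning_tree_def linked_eq_L)
qed (simp add: spanning_tree_def)

definition above :: "'e set \<Rightarrow> 'e \<Rightarrow> 'e set" where
  "above H e = H \<inter> {e<..}"

definition below :: "'e \<Rightarrow> 'e set" where
  "below e = edges G \<inter> {..<e}"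

definition ext :: "'e set \<Rightarrow> 'e \<Rightarrow> bool" where
  "ext H e \<longleftrightarrow> (u e, v e) \<in> L (above H e)"

definition int_live :: "'e set \<Rightarrow> 'e \<Rightarrow> bool" where
  "int_live H e \<longleftrightarrow> (u e, v e) \<notin> L (above H e \<union> below e)"

text \<open>Activity is defined for all sets of edges, in such a way that changing a live edge does not
  affect the activity of any edge. The classes of sets that differ in live edges only are
  then intervals around the spanning trees.\<close>

definition live :: "'e set \<Rightarrow> 'e set" where
  "live H = {e \<in> edges G. ext H e \<or> int_live H e}"

section \<open>Live edges\<close>

lemma int_not_ext: "int_live H e \<Longrightarrow> \<not> ext H e"
  using L_monoD[of "u e" "v e" "above H e" "above H e \<union> below e"] unfolding int_live_def ext_def by blast

lemma above_below: "H \<subseteq> edges G \<Longrightarrow> H - {e} \<subseteq> above H e \<union> below e"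
  unfolding above_def below_def by (auto simp: not_less le_less)

text \<open>Only \<open>g < e\<close> matters. If \<open>e\<close> is externally live, its ends are
  already linked by the edges above it, which are all present, so \<open>e\<close> adds nothing. If
  it is internally live, its ends stay apart even with \<open>g\<close> and everything below
  \<open>e\<close> added, so by \<open>exchange\<close> it cannot help to link \<open>g\<close>.
  Taking \<open>X\<close> empty or \<open>below g\<close> covers both kinds of liveness of
  \<open>g\<close>.\<close>

lemma live_flip_aux:
  assumes "e \<in> live H" "g \<in> edges G" "H \<subseteq> edges G" "X \<subseteq> below g"
  shows "(u g, v g) \<in> L (above (flip e H) g \<union> X) \<longleftrightarrow> (u g, v g) \<in> L (above H g \<union> X)"
proof (cases "g < e")
  case False
  then have "above (flip e H) g = above H g" by (auto simp: above_def in_flip_iff)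
  then show ?thesis by simp
next
  case True
  define P where "P = above (H - {e}) g \<union> X"
  have above: "above H g \<union> X = P \<or> above H g \<union> X = insert e P"
    "above (flip e H) g \<union> X = P \<or> above (flip e H) g \<union> X = insert e P"
    using True by (auto simp: P_def above_def flip_def)
  have "(u g, v g) \<in> L (insert e P) \<longleftrightarrow> (u g, v g) \<in> L P"
  proof (cases "ext H e")
    case ext: True
    have "above H e \<subseteq> P" using True by (auto simp: P_def above_def)
    then have "(u e, v e) \<in> L P" using ext L_monoD unfolding ext_def by blast
    then show ?thesis using unite_absorb[OF equiv_L] by (simp add: L_insert)
  next
    case False
    then have int: "(u e, v e) \<notin> L (above H e \<union> below e)"
      using assms(1) by (simp add: live_def int_live_def)
    have "P \<subseteq> (H - {e}) \<union> below e" using True assms(4) by (auto simp: P_def above_def below_def)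
    moreover have "g \<in> below e" using True assms(2) by (simp add: below_def)
    ultimately have "insert g P \<subseteq> above H e \<union> below e" using above_below[OF assms(3), of e] by blast
    then have "(u e, v e) \<notin> L (insert g P)" using int L_monoD by blast
    then show ?thesis using exchange[of g e P] L_monoD[of "u g" "v g" P "insert e P"] by blast
  qed
  then show ?thesis using above by metis
qed

lemma live_flip:
  assumes "e \<in> live H" "H \<subseteq> edges G"
  shows "g \<in> edges G \<Longrightarrow> ext (flip e H) g \<longleftrightarrow> ext H g" "live (flip e H) = live H"
proof -
  have ext: "ext (flip e H) g \<longleftrightarrow> ext H g" if "g \<in> edges G" for g
    using live_flip_aux[OF assms(1) that assms(2), of "{}"] by (simp add: ext_def)
  then show "g \<in> edges G \<Longrightarrow> ext (flip e H) g \<longleftrightarrow> ext H g" .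
  have "int_live (flip e H) g \<longleftrightarrow> int_live H g" if "g \<in> edges G" for g
    using live_flip_aux[OF assms(1) that assms(2), of "below g"] by (simp add: int_live_def)
  then show "live (flip e H) = live H" using ext unfolding live_def by blast
qed

text \<open>Liveness of \<open>e\<close> looks at \<open>H\<close> only above \<open>e\<close>.
  Hence changing \<open>c\<close> can alter the liveness of smaller edges only, which the order of
  the subcubes relies on.\<close>

lemma live_above:
  assumes "c \<le> e"
  shows "e \<in> live (flip c H) \<longleftrightarrow> e \<in> live H"
proof -
  have "above (flip c H) e = above H e" using assms by (auto simp: above_def in_flip_iff)
  then show ?thesis by (simp add: live_def ext_def int_live_def)
qed

definition unflipped :: "'e set \<Rightarrow> bool" where
  "unflipped H \<longleftrightarrow> (\<forall>e \<in> live H. e \<in> H \<longleftrightarrow> \<not> ext H e)"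

text \<open>The lowest edge of a cycle in \<open>H\<close> would be externally live and in
  \<open>H\<close>. An edge not linked by \<open>H\<close> and the edges below it would be
  internally live and missing; hence, upwards from the lowest edge, all ends are linked by
  \<open>H\<close>. Conversely, tree edges are never externally live and other edges never
  internally live.\<close>

lemma unflipped_iff_spanning_tree:
  assumes "H \<subseteq> edges G" and connected: "\<And>a b. a \<in> verts G \<Longrightarrow> b \<in> verts G \<Longrightarrow> (a, b) \<in> L (edges G)"
  shows "unflipped H \<longleftrightarrow> spanning_tree G H"
proof
  assume un: "unflipped H"
  have "\<not> is_cycle G C" if "C \<subseteq> H" for C
  proof
    assume C: "is_cycle G C"
    then have fin: "finite C" "C \<noteq> {}" by (auto simp: is_cycle_def)
    define e where "e = Min C"
    have e: "e \<in> C" "\<And>g. g \<in> C \<Longrightarrow> e \<le> g" using fin by (auto simp: e_def)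
    have "C - {e} \<subseteq> above H e" using e(2) that by (force simp: above_def)
    then have "ext H e" using L_monoD[OF cycle_links[OF C e(1)]] unfolding ext_def by blast
    then show False using un e(1) that assms(1) by (auto simp: unflipped_def live_def)
  qed
  moreover have "(a, b) \<in> L H" if "a \<in> verts G" "b \<in> verts G" for a b
  proof -
    have all: "(u e, v e) \<in> L (H \<union> below e)" if e: "e \<in> edges G" for e
    proof (rule ccontr)
      assume n: "(u e, v e) \<notin> L (H \<union> below e)"
      then have "e \<notin> H" using L_edge[of e "H \<union> below e"] by blast
      have "above H e \<union> below e \<subseteq> H \<union> below e" by (auto simp: above_def)
      then have "int_live H e" using n L_monoD unfolding int_live_def by blast
      then show False using un int_not_ext e \<open>e \<notin> H\<close> by (auto simp: unflipped_def live_def)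
    qed
    have "(u e, v e) \<in> L H" if "e \<in> edges G" for e
      using that
    proof (induction "card (below e)" arbitrary: e rule: less_induct)
      case less
      have "(u g, v g) \<in> L H" if g: "g \<in> H \<union> below e" for g
      proof (cases "g \<in> H")
        case False
        then have "g < e" "g \<in> edges G" using g by (auto simp: below_def)
        then have "below g \<subset> below e" by (auto simp: below_def)
        then have "card (below g) < card (below e)"
          by (rule psubset_card_mono[rotated]) (simp add: below_def finite_edges)
        then show ?thesis using less.hyps \<open>g \<in> edges G\<close> by blast
      qed (rule L_edge)
      then have "L (H \<union> below e) \<subseteq> L H" by (rule L_least)
      then show ?case using all[OF less.prems] by blast
    qed
    then have "L (edges G) \<subseteq> L H" by (rule L_least)
    then show ?thesis using connected[OF that] by blast
  qed
  ultimately show "spanning_tree G H"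
    using assms(1) by (simp add: spanning_tree_def linked_eq_L)
next
  assume "spanning_tree G H"
  then have t: "\<And>a b. a \<in> verts G \<Longrightarrow> b \<in> verts G \<Longrightarrow> (a, b) \<in> L H" "\<And>e. e \<in> H \<Longrightarrow> (u e, v e) \<notin> L (H - {e})"
    unfolding spanning_tree_iff by auto
  show "unflipped H"
    unfolding unflipped_def
  proof
    fix e assume e: "e \<in> live H"
    then have eG: "e \<in> edges G" by (simp add: live_def)
    have "\<not> ext H e" if "e \<in> H"
      using t(2)[OF that] L_monoD[of "u e" "v e" "above H e" "H - {e}"] unfolding ext_def above_def by auto
    moreover have "ext H e" if "e \<notin> H"
    proof -
      have "H \<subseteq> above H e \<union> below e" using above_below[OF assms(1), of e] that by auto
      then have "\<not> int_live H e" using L_monoD[OF t(1)[OF ends_verts[OF eG]]] unfolding int_live_def by blast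
      then show ?thesis using e by (simp add: live_def)
    qed
    ultimately show "e \<in> H \<longleftrightarrow> \<not> ext H e" by blast
  qed
qed

text \<open>Both sides say that no edge below \<open>e\<close> reconnects the two parts of
  \<open>T - {e}\<close>; the lower edges which do are those of \<open>cut G T e\<close>.\<close>

lemma internally_active_iff:
  assumes "spanning_tree G T"
  shows "internally_active G T e \<longleftrightarrow> e \<in> T \<and> e \<in> live T"
proof (cases "e \<in> T")
  case True
  have T: "T \<subseteq> edges G" "\<And>a b. a \<in> verts G \<Longrightarrow> b \<in> verts G \<Longrightarrow> (a, b) \<in> L T" "(u e, v e) \<notin> L (T - {e})"
    using assms True unfolding spanning_tree_iff by auto
  have set: "above T e \<union> below e = (T - {e}) \<union> below e"
    using above_below[OF T(1), of e] by (auto simp: above_def)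
  have cut: "g \<in> cut G T e \<longleftrightarrow> g \<in> edges G \<and> (u g, v g) \<notin> L (T - {e})" for g
  proof -
    have lk: "linked G (T - {e}) a b \<longleftrightarrow> (a, b) \<in> L (T - {e})" for a b using T(1) by (intro linked_eq_L) auto
    show ?thesis
    proof (cases "g \<in> edges G")
      case True
      have "(a, b) \<in> L (T - {e}) \<longleftrightarrow> (u g, v g) \<in> L (T - {e})" if "{u g, v g} = {a, b}" for a b
        using that L_eq(2)[of "u g" "v g" "T - {e}"] L_eq(2)[of "v g" "u g" "T - {e}"]
        by (auto simp: doubleton_eq_iff)
      then show ?thesis unfolding cut_def mem_Collect_eq lk ends[OF True] using True by blast
    qed (simp add: cut_def)
  qed
  have "(\<forall>g \<in> cut G T e. e \<le> g) \<longleftrightarrow> (u e, v e) \<notin> L (above T e \<union> below e)"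
  proof
    assume low: "\<forall>g \<in> cut G T e. e \<le> g"
    have "(u g, v g) \<in> L (T - {e})" if g: "g \<in> (T - {e}) \<union> below e" for g
      using low g cut[of g] L_edge[of g "T - {e}"] by (auto simp: below_def)
    then have "L ((T - {e}) \<union> below e) \<subseteq> L (T - {e})" by (rule L_least)
    then show "(u e, v e) \<notin> L (above T e \<union> below e)" using T(3) unfolding set by blast
  next
    assume n: "(u e, v e) \<notin> L (above T e \<union> below e)"
    show "\<forall>g \<in> cut G T e. e \<le> g"
    proof (intro ballI, rule ccontr)
      fix g assume g: "g \<in> cut G T e" "\<not> e \<le> g"
      then have gG: "g \<in> edges G" "(u g, v g) \<notin> L (T - {e})" using cut by auto
      have "(u g, v g) \<in> L (insert e (T - {e}))" using T(2) ends_verts gG(1) True by (simp add: insert_absorb)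
      then have "(u e, v e) \<in> L (insert g (T - {e}))" using exchange gG(2) by blast
      moreover have "insert g (T - {e}) \<subseteq> above T e \<union> below e" unfolding set using g gG by (auto simp: below_def)
      ultimately show False using n L_monoD by blast
    qed
  qed
  moreover have "\<not> ext T e"
    using T(3) L_monoD[of "u e" "v e" "above T e" "T - {e}"] unfolding ext_def above_def by auto
  ultimately show ?thesis
    using True T(1) by (auto simp: internally_active_def live_def int_live_def)
qed (simp add: internally_active_def)

text \<open>The right side does not mention \<open>C\<close>, so the fundamental cycle is unique, as
  the definite description in \<open>cyc\<close> requires.\<close>

lemma cyc_eq:
  assumes "spanning_tree G T" "f \<in> edges G - T" "is_cycle G C" "C \<subseteq> insert f T"
  shows "C = insert f {e \<in> T. (u f, v f) \<notin> L (T - {e})}"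
proof -
  have T: "\<And>e. e \<in> T \<Longrightarrow> (u e, v e) \<notin> L (T - {e})"
    using assms(1) unfolding spanning_tree_iff by blast
  have f: "f \<in> C" using assms(1,3,4) unfolding spanning_tree_def by blast
  have fC: "(u f, v f) \<in> L (C - {f})" by (rule cycle_links[OF assms(3) f])
  have "e \<in> C \<longleftrightarrow> (u f, v f) \<notin> L (T - {e})" if e: "e \<in> T" for e
  proof
    assume "e \<in> C"
    then have eC: "(u e, v e) \<in> L (C - {e})" by (rule cycle_links[OF assms(3)])
    show "(u f, v f) \<notin> L (T - {e})"
    proof
      assume ft: "(u f, v f) \<in> L (T - {e})"
      have "(u g, v g) \<in> L (T - {e})" if "g \<in> C - {e}" for g
        using that assms(4) L_edge[of g "T - {e}"] ft by (cases "g = f") auto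
      then have "L (C - {e}) \<subseteq> L (T - {e})" by (rule L_least)
      then show False using eC T[OF e] by blast
    qed
  next
    assume n: "(u f, v f) \<notin> L (T - {e})"
    show "e \<in> C"
    proof (rule ccontr)
      assume "e \<notin> C"
      then have "C - {f} \<subseteq> T - {e}" using assms(4) by auto
      then show False using L_monoD[OF fC] n by blast
    qed
  qed
  then show ?thesis using f assms(2,4) by auto
qed

text \<open>If the tree edges above \<open>e\<close> link its ends, they contain a path that
  together with \<open>e\<close> is the fundamental cycle, by uniqueness; so \<open>e\<close> is its
  lowest edge.\<close>

lemma externally_active_iff:
  assumes "spanning_tree G T"
  shows "externally_active G T e \<longleftrightarrow> e \<in> edges G - T \<and> e \<in> live T"
proof (cases "e \<in> edges G - T")
  case True
  have T: "T \<subseteq> edges G" "\<And>a b. a \<in> verts G \<Longrightarrow> b \<in> verts G \<Longrightarrow> (a, b) \<in> L T"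
    using assms unfolding spanning_tree_iff by auto
  have eT: "(u e, v e) \<in> L T" using T(2) ends_verts True by auto
  obtain C where C: "is_cycle G C" "C \<subseteq> insert e T"
    using cycle_exists[OF eT T(1)] True by auto
  have cyc: "cyc G T e = C"
    unfolding cyc_def
  proof (rule the_equality)
    show "C' = C" if "is_cycle G C' \<and> C' \<subseteq> insert e T" for C'
      using cyc_eq[OF assms True, of C'] cyc_eq[OF assms True C] that by simp
  qed (use C in blast)
  have "(\<forall>g \<in> C. e \<le> g) \<longleftrightarrow> ext T e"
  proof
    assume low: "\<forall>g \<in> C. e \<le> g"
    have "e \<in> C" using cyc_eq[OF assms True C] by blast
    moreover have "C - {e} \<subseteq> above T e" using low C(2) by (force simp: above_def)
    ultimately show "ext T e" using L_monoD[OF cycle_links[OF C(1)]] unfolding ext_def by blast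
  next
    assume ext: "ext T e"
    have "above T e \<subseteq> edges G" "e \<notin> above T e" using T(1) by (auto simp: above_def)
    then obtain C' where C': "is_cycle G C'" "C' \<subseteq> insert e (above T e)"
      using cycle_exists[of e "above T e"] ext True unfolding ext_def by auto
    then have "C' \<subseteq> insert e T" by (auto simp: above_def)
    then have "C' = C" using cyc_eq[OF assms True C'(1)] cyc_eq[OF assms True C] by simp
    then show "\<forall>g \<in> C. e \<le> g" using C'(2) by (auto simp: above_def)
  qed
  moreover have "\<not> int_live T e"
    using above_below[OF T(1), of e] True L_monoD[OF eT] unfolding int_live_def by auto
  ultimately show ?thesis using True by (auto simp: externally_active_def cyc live_def)
qed (auto simp: externally_active_def)

definition components :: "'e set \<Rightarrow> nat" where
  "components H = card ((\<lambda>a. L H `` {a}) ` verts G)"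

lemma components_insert:
  assumes "e \<in> edges G"
  shows "components H = components (insert e H) + (if (u e, v e) \<in> L H then 0 else 1)"
proof (cases "(u e, v e) \<in> L H")
  case True
  then have "L (insert e H) = L H" unfolding L_insert by (rule unite_absorb[OF equiv_L])
  then show ?thesis using True by (simp add: components_def)
next
  case False
  then show ?thesis
    using card_class_unite[OF equiv_L finite_verts False ends_verts[OF assms]]
    by (simp add: components_def L_insert)
qed

lemma components_empty: "components {} = card (verts G)"
proof -
  have "L {} = Id" by (simp add: L_def links_def)
  then show ?thesis by (simp add: components_def card_image inj_on_def)
qed

text \<open>Added one at a time, the edges of a forest always join different components.\<close>

lemma components_forest:
  assumes "H \<subseteq> edges G" "\<And>e. e \<in> H \<Longrightarrow> (u e, v e) \<notin> L (H - {e})"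
  shows "components H + card H = card (verts G)"
proof -
  have "components H' + card H' = card (verts G)" if "finite H'" "H' \<subseteq> H" for H'
    using that
  proof (induction H' rule: finite_induct)
    case empty
    then show ?case by (simp add: components_empty)
  next
    case (insert e H')
    then have "H' \<subseteq> H - {e}" by blast
    then have "(u e, v e) \<notin> L H'" using assms(2)[of e] insert.prems L_monoD by blast
    then show ?case using insert components_insert[of e H'] assms(1) by auto
  qed
  then show ?thesis using assms(1) finite_edges finite_subset by blast
qed

end

section \<open>The Tait graph of a planar diagram\<close>

context coloured_diagram
begin

definition shade :: "nat \<Rightarrow> region" where
  "shade a = region_of_side K (a, left_shaded a)"

definition unshade :: "nat \<Rightarrow> region" where
  "unshade a = region_of_side K (a, \<not> left_shaded a)"

text \<open>Whichever two corners at \<open>c\<close> are shaded, the arcs at the ends 0 and 2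
  border one each. The ends of the Tait edge thus correspond to the two strands used in the circle
  system.\<close>

definition tu :: "nat \<Rightarrow> region" where "tu c = shade (arc_at K c 0)"
definition tv :: "nat \<Rightarrow> region" where "tv c = shade (arc_at K c 2)"

abbreviation "T \<equiv> tait_graph K S"

section \<open>The two sides of an arc\<close>

lemma shade_in: "a \<in> arcs K \<Longrightarrow> shade a \<in> S" and unshade_in: "a \<in> arcs K \<Longrightarrow> unshade a \<in> regions K - S"
  using sides[of a True] region_of_side(2)[of a]
  by (cases "left_shaded a"; auto simp: shade_def unshade_def left_shaded_def)+

lemma S_subset: "S \<subseteq> regions K"
  using colouring by (simp add: checkerboard_def)

lemma shade_surj: "R \<in> S \<Longrightarrow> \<exists>a \<in> arcs K. R = shade a"
  and unshade_surj: "R \<in> regions K - S \<Longrightarrow> \<exists>a \<in> arcs K. R = unshade a"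
proof -
  show "\<exists>a \<in> arcs K. R = shade a" if R: "R \<in> S"
  proof -
    obtain a b where a: "a \<in> arcs K" "R = region_of_side K (a, b)"
      using R S_subset region_exists[of R] by blast
    then have "b = left_shaded a" using R sides[OF a(1), of True] by (cases b) (auto simp: left_shaded_def)
    then show ?thesis using a by (auto simp: shade_def)
  qed
  show "\<exists>a \<in> arcs K. R = unshade a" if R: "R \<in> regions K - S"
  proof -
    obtain a b where a: "a \<in> arcs K" "R = region_of_side K (a, b)"
      using R region_exists[of R] by blast
    then have "b = (\<not> left_shaded a)" using R sides[OF a(1), of True] by (cases b) (auto simp: left_shaded_def)
    then show ?thesis using a by (auto simp: unshade_def)
  qed
qed

lemma shaded_corner:
  assumes "c < nc" "q < 4" "shaded c q"
  shows "shade (arc_at K c q) = region_at K c q" "shade (arc_at K c ((q + 1) mod 4)) = region_at K c q"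
proof -
  show "shade (arc_at K c q) = region_at K c q"
    using shaded_end[OF assms(1), of q] assms(3) by (simp add: shade_def region_at_def)
  let ?q = "(q + 1) mod 4"
  have "left_shaded (arc_at K c ?q) = (\<not> outgoing K c ?q)"
    using shaded_next[OF assms(1,2)] assms(3) shaded_end[OF assms(1), of ?q] by auto
  then show "shade (arc_at K c ?q) = region_at K c q"
    unfolding region_at_next[OF assms(1,2)] shade_def by simp
qed

lemma unshaded_corner:
  assumes "c < nc" "q < 4" "\<not> shaded c q"
  shows "unshade (arc_at K c q) = region_at K c q" "unshade (arc_at K c ((q + 1) mod 4)) = region_at K c q"
proof -
  have "left_shaded (arc_at K c q) = (\<not> outgoing K c q)"
    using shaded_end[OF assms(1), of q] assms(3) by auto
  then show "unshade (arc_at K c q) = region_at K c q"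
    by (simp add: unshade_def region_at_def)
  let ?q = "(q + 1) mod 4"
  have "left_shaded (arc_at K c ?q) = outgoing K c ?q"
    using shaded_next[OF assms(1,2)] assms(3) shaded_end[OF assms(1), of ?q] by auto
  then show "unshade (arc_at K c ?q) = region_at K c q"
    unfolding region_at_next[OF assms(1,2)] unshade_def by simp
qed

lemma lt4: "q < 4 \<Longrightarrow> q = 0 \<or> q = 1 \<or> q = 2 \<or> q = (3::nat)"
  by auto

lemma shade_ends:
  assumes "c < nc"
  shows "shaded c 0 \<Longrightarrow> tu c = region_at K c 0 \<and> tv c = region_at K c 2 \<and>
      shade (arc_at K c 1) = tu c \<and> shade (arc_at K c 3) = tv c"
    "\<not> shaded c 0 \<Longrightarrow> tu c = region_at K c 3 \<and> tv c = region_at K c 1 \<and>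
      shade (arc_at K c 1) = tv c \<and> shade (arc_at K c 3) = tu c"
proof -
  have mod4: "(0 + 1) mod 4 = (1::nat)" "(1 + 1) mod 4 = (2::nat)" "(2 + 1) mod 4 = (3::nat)" "(3 + 1) mod 4 = (0::nat)"
    by simp_all
  note sc = shaded_corner[OF assms]
  note scs = sc[of 0, unfolded mod4] sc[of 1, unfolded mod4] sc[of 2, unfolded mod4] sc[of 3, unfolded mod4]
  show "shaded c 0 \<Longrightarrow> tu c = region_at K c 0 \<and> tv c = region_at K c 2 \<and>
      shade (arc_at K c 1) = tu c \<and> shade (arc_at K c 3) = tv c"
    unfolding tu_def tv_def using scs(1,2,5,6) shaded_cases[OF assms] by simp
  show "\<not> shaded c 0 \<Longrightarrow> tu c = region_at K c 3 \<and> tv c = region_at K c 1 \<and>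
      shade (arc_at K c 1) = tv c \<and> shade (arc_at K c 3) = tu c"
    unfolding tu_def tv_def using scs(3,4,7,8) shaded_cases[OF assms] by simp
qed

lemma shade_end_cases: "c < nc \<Longrightarrow> q < 4 \<Longrightarrow> shade (arc_at K c q) \<in> {tu c, tv c}"
  using shade_ends[of c] lt4[of q] by (cases "shaded c 0") (auto simp: tu_def tv_def)

lemma pos_edge_T: "c < nc \<Longrightarrow> pos_edge T c \<longleftrightarrow> \<not> shaded c 0"
  using shaded_cases[of c] by (simp add: tait_graph_def)

lemma T_simps: "verts T = S" "edges T = {..<nc}"
  by (simp_all add: tait_graph_def)

lemma finite_regions: "finite (regions K)"
proof -
  have "card (regions K) = nc + 2" using diagram by (simp add: knot_diagram_def)
  then show ?thesis by (metis card.infinite add_is_0 zero_neq_numeral)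
qed

lemma finite_S: "finite S"
  using S_subset finite_regions by (rule finite_subset)

lemma ends_T:
  assumes "c < nc"
  shows "ends T c = {tu c, tv c}"
proof -
  have "{region_at K c q | q. q < 4} = {region_at K c 0, region_at K c 1, region_at K c 2, region_at K c 3}"
    using lt4 by force
  then have "ends T c = {region_at K c 0, region_at K c 1, region_at K c 2, region_at K c 3} \<inter> S"
    by (simp add: tait_graph_def)
  moreover have "{region_at K c 0, region_at K c 1, region_at K c 2, region_at K c 3} \<inter> S = {tu c, tv c}"
  proof (cases "shaded c 0")
    case True
    then have t: "tu c = region_at K c 0" "tv c = region_at K c 2" using shade_ends(1)[OF assms] by auto
    show ?thesis unfolding t using True shaded_cases[OF assms] by auto
  next
    case False
    then have t: "tu c = region_at K c 3" "tv c = region_at K c 1" using shade_ends(2)[OF assms] by auto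
    show ?thesis unfolding t using False shaded_cases[OF assms] by auto
  qed
  ultimately show ?thesis by simp
qed

sublocale MG: multigraph T tu tv
proof
  show "finite (edges T)" "finite (verts T)" by (simp_all add: T_simps finite_S)
  show "ends T e = {tu e, tv e}" if "e \<in> edges T" for e using that ends_T by (simp add: T_simps)
  show "tu e \<in> verts T" "tv e \<in> verts T" if "e \<in> edges T" for e
    using that shade_in arc_at_in by (auto simp: T_simps tu_def tv_def)
qed

text \<open>Translates between a subgraph \<open>H\<close> and the smoothing that joins shaded
  regions exactly along the edges of \<open>H\<close>: positive edges are in \<open>H\<close> when
  A-smoothed, negative ones when B-smoothed.\<close>

definition swap_pos :: "nat set \<Rightarrow> nat set" where
  "swap_pos H = {c. c < nc \<and> (c \<in> H \<longleftrightarrow> \<not> pos_edge T c)}"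

section \<open>Circles around a subgraph\<close>

lemma in_swap_pos: "c < nc \<Longrightarrow> c \<in> swap_pos H \<longleftrightarrow> (c \<in> H \<longleftrightarrow> shaded c 0)"
  by (simp add: swap_pos_def pos_edge_T)

lemma swap_pos_subset: "swap_pos H \<subseteq> {..<nc}"
  by (auto simp: swap_pos_def)

lemma swap_pos_swap_pos: "H \<subseteq> {..<nc} \<Longrightarrow> swap_pos (swap_pos H) = H"
  by (auto simp: swap_pos_def)

lemma swap_pos_flip: "c < nc \<Longrightarrow> swap_pos (flip c H) = flip c (swap_pos H)"
  by (auto simp: swap_pos_def in_flip_iff split: if_splits)

abbreviation "EE B \<equiv> links (smoothing K B)"

lemma mate_swap_pos:
  assumes "c < nc" "q < 4"
  shows "c \<notin> H \<Longrightarrow> shaded c q \<Longrightarrow> mate (swap_pos H) c q = (q + 1) mod 4"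
    "c \<in> H \<Longrightarrow> \<not> shaded c q \<Longrightarrow> mate (swap_pos H) c q = (q + 1) mod 4"
  using lt4[OF assms(2)] shaded_cases[OF assms(1)] in_swap_pos[OF assms(1), of H]
  by (elim disjE; simp add: mate_def)+

text \<open>A circle runs along the boundary of the joined shaded regions: at a crossing it stays at
  its region, or passes to the other end of an edge of \<open>H\<close>.\<close>

lemma shade_links:
  assumes "(a, b) \<in> EE (swap_pos H)"
  shows "(shade a, shade b) \<in> MG.L H"
proof -
  have step: "(shade (arc_at K c q), shade (arc_at K c (mate (swap_pos H) c q))) \<in> MG.L H"
    if c: "c < nc" "q < 4" for c q
  proof (cases "c \<in> H")
    case True
    have "shade (arc_at K c q) \<in> {tu c, tv c}" "shade (arc_at K c (mate (swap_pos H) c q)) \<in> {tu c, tv c}"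
      using shade_end_cases c mate(1)[OF c] by auto
    then show ?thesis
      using MG.L_edge[OF True] MG.L_eq(2)[OF MG.L_edge[OF True]] MG.L_eq(1) by auto
  next
    case False
    have eq: "shade (arc_at K c q) = shade (arc_at K c (mate (swap_pos H) c q))"
      if "q < 4" "shaded c q" for q
      using shaded_corner[OF c(1) that] mate_swap_pos(1)[OF c(1) that(1) False that(2)] by simp
    have "shade (arc_at K c q) = shade (arc_at K c (mate (swap_pos H) c q))"
    proof (cases "shaded c q")
      case True
      then show ?thesis using eq c by blast
    next
      case False
      then show ?thesis
        using eq[of "mate (swap_pos H) c q"] mate[OF c, of "swap_pos H"] by simp
    qed
    then show ?thesis using MG.L_eq(1) by simp
  qed
  define Q where "Q = {(a, b). (shade a, shade b) \<in> MG.L H}"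
  have "equiv UNIV Q"
    by (rule equivI) (auto simp: Q_def refl_on_def MG.L_eq(1) intro: symI transI MG.L_eq(2) MG.L_eq(3))
  moreover have "smoothing K (swap_pos H) \<subseteq> Q"
    using step by (auto simp: Q_def elim!: smoothingE)
  ultimately show ?thesis using links_least assms unfolding Q_def by blast
qed

text \<open>Without edges, the circles run around the shaded regions. \<open>Z\<close> collects the
  shaded sides of the arcs on one circle: at a shaded corner the smoothing joins the two arcs, and
  at an unshaded one neither side is shaded.\<close>

lemma circles_none: "a \<in> arcs K \<Longrightarrow> b \<in> arcs K \<Longrightarrow> shade a = shade b \<Longrightarrow> (a, b) \<in> EE (swap_pos {})"
proof -
  assume a: "a \<in> arcs K" and b: "b \<in> arcs K" and ab: "shade a = shade b"
  define Z where "Z = {(b, s). s = left_shaded b \<and> (a, b) \<in> EE (swap_pos {})}"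
  have "((a, left_shaded a), (b, left_shaded b)) \<in> same_region"
    using ab region_of_side_eq_iff[OF a b] by (simp add: shade_def)
  then have "(a, left_shaded a) \<in> Z \<longleftrightarrow> (b, left_shaded b) \<in> Z"
  proof (rule links_closed)
    fix r s assume "(r, s) \<in> corner_relation K"
    then obtain c q where c: "c < nc" "q < 4" and rs: "r = (arc_at K c q, outgoing K c q)"
      "s = (arc_at K c ((q + 1) mod 4), \<not> outgoing K c ((q + 1) mod 4))"
      by (auto simp: corner_relation_def)
    let ?q = "(q + 1) mod 4"
    have 1: "outgoing K c q = left_shaded (arc_at K c q) \<longleftrightarrow> shaded c q" using shaded_end[OF c(1)] by simp
    have 2: "(\<not> outgoing K c ?q) = left_shaded (arc_at K c ?q) \<longleftrightarrow> shaded c q"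
      using shaded_end[OF c(1), of ?q] shaded_next[OF c] by auto
    have "(arc_at K c q, arc_at K c ?q) \<in> EE (swap_pos {})" if "shaded c q"
      using smoothing_mate[OF c, of "swap_pos {}"] mate_swap_pos(1)[OF c _ that, of "{}"] by simp
    then have "(a, arc_at K c q) \<in> EE (swap_pos {}) \<longleftrightarrow> (a, arc_at K c ?q) \<in> EE (swap_pos {})" if "shaded c q"
      using that links_sym links_trans by metis
    then show "r \<in> Z \<longleftrightarrow> s \<in> Z"
      unfolding rs Z_def using 1 2 by auto
  qed
  then show ?thesis by (simp add: Z_def links_refl)
qed

lemma circles_all:
  assumes "(a, b) \<in> EE (swap_pos {..<nc})"
  shows "unshade a = unshade b"
proof -
  have eq: "unshade (arc_at K c q) = unshade (arc_at K c (mate (swap_pos {..<nc}) c q))"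
    if c: "c < nc" "q < 4" for c q
  proof -
    have eq: "unshade (arc_at K c q) = unshade (arc_at K c (mate (swap_pos {..<nc}) c q))"
      if "q < 4" "\<not> shaded c q" for q
      using unshaded_corner[OF c(1) that] mate_swap_pos(2)[OF c(1) that(1) _ that(2), of "{..<nc}"] c(1) by simp
    show ?thesis
    proof (cases "shaded c q")
      case True
      then show ?thesis
        using eq[of "mate (swap_pos {..<nc}) c q"] mate[OF c, of "swap_pos {..<nc}"] by simp
    next
      case False
      then show ?thesis using eq c by blast
    qed
  qed
  have "equiv UNIV {(a, b). unshade a = unshade b}"
    by (rule equivI) (auto simp: refl_on_def intro: symI transI)
  moreover have "smoothing K (swap_pos {..<nc}) \<subseteq> {(a, b). unshade a = unshade b}"
    using eq by (auto elim!: smoothingE)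
  ultimately show ?thesis using links_least assms by blast
qed

text \<open>Consecutive arcs of the knot meet at a crossing, whose edge links their shaded sides;
  walking along the knot reaches all of them.\<close>

lemma T_connected:
  assumes "a \<in> S" "b \<in> S"
  shows "(a, b) \<in> MG.L {..<nc}"
proof -
  have step: "(shade t, shade (Suc t)) \<in> MG.L {..<nc}" if "Suc t < 2 * nc" for t
  proof -
    have n: "next_arc K t = Suc t" using that by (simp add: next_arc_def)
    have "\<exists>c q r. c < nc \<and> q < 4 \<and> r < 4 \<and> t = arc_at K c q \<and> Suc t = arc_at K c r"
    proof (rule times_surj)
      show "t < 2 * nc" using that by simp
    next
      fix c assume c: "c < nc" "t = under_time K c"
      then have "t = arc_at K c 0" "Suc t = arc_at K c 2" using n by (auto simp: arc_at_def)
      then show ?thesis using c(1) by (intro exI[of _ c] exI[of _ 0] exI[of _ 2]) simp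
    next
      fix c assume c: "c < nc" "t = over_time K c"
      let ?q = "if pos_crossing K c then 3 else 1" and ?r = "if pos_crossing K c then 1 else (3::nat)"
      have "t = arc_at K c ?q" "Suc t = arc_at K c ?r" using n c by (auto simp: arc_at_def)
      then show ?thesis using c(1) by (intro exI[of _ c] exI[of _ ?q] exI[of _ ?r]) simp
    qed
    then obtain c q r where c: "c < nc" "q < 4" "r < 4" "t = arc_at K c q" "Suc t = arc_at K c r" by blast
    then have "shade t \<in> {tu c, tv c}" "shade (Suc t) \<in> {tu c, tv c}" using shade_end_cases by auto
    moreover have "(tu c, tv c) \<in> MG.L {..<nc}" using c(1) by (intro MG.L_edge) simp
    ultimately show ?thesis using MG.L_eq(1) MG.L_eq(2) by auto
  qed
  have all: "(shade 0, shade t) \<in> MG.L {..<nc}" if "t \<in> arcs K" for t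
    using that
  proof (induction t)
    case (Suc t)
    then have "Suc t < 2 * nc" by (auto simp: arcs_def)
    then show ?case using step[of t] Suc MG.L_eq(3) by (auto simp: arcs_def)
  qed (rule MG.L_eq(1))
  obtain s t where "s \<in> arcs K" "a = shade s" "t \<in> arcs K" "b = shade t" using assms shade_surj by blast
  then show ?thesis using all MG.L_eq(2,3) by metis
qed

text \<open>Adding an edge that joins two components merges two circles, and any other edge adds at most
  one circle. Euler's formula leaves no room for an edge of the second kind that merges
  circles.\<close>

definition excess :: "nat set \<Rightarrow> int" where
  "excess H = int (card (circ (swap_pos H))) - int (card H) - 2 * int (MG.components H) + int (card S)"

text \<open>Linked circles imply linked regions by \<open>shade_links\<close>, which leaves three
  cases. The changes in circles, edges and components balance except when the regions are linked and
  the circles are not.\<close>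

lemma excess_insert:
  assumes "c < nc" "c \<notin> H" "finite H"
  shows "excess (insert c H) = excess H -
    (if (tu c, tv c) \<in> MG.L H \<and> (arc_at K c 0, arc_at K c 2) \<notin> EE (swap_pos H) then 2 else 0)"
proof -
  have circ: "int (card (circ (swap_pos (insert c H)))) = int (card (circ (swap_pos H))) +
      (if (arc_at K c 0, arc_at K c 2) \<in> EE (swap_pos H) then 1 else -1)"
    using card_circ_flip[OF assms(1), of "swap_pos H"] swap_pos_flip[OF assms(1), of H] assms(2)
    by (simp add: flip_def)
  have comp: "MG.components H = MG.components (insert c H) + (if (tu c, tv c) \<in> MG.L H then 0 else 1)"
    by (rule MG.components_insert) (simp add: T_simps assms(1))
  have "(tu c, tv c) \<in> MG.L H" if "(arc_at K c 0, arc_at K c 2) \<in> EE (swap_pos H)"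
    using shade_links[OF that] by (simp add: tu_def tv_def)
  then show ?thesis
    unfolding excess_def using circ comp assms(2,3) by (auto split: if_splits)
qed

lemma excess_none: "excess {} \<le> 0"
proof -
  have "card (circ (swap_pos {})) \<le> card (shade ` arcs K)"
  proof (rule surj_card_le)
    show "finite (shade ` arcs K)" by (simp add: arcs_def)
    define h where "h R = cl (swap_pos {}) (SOME a. a \<in> arcs K \<and> shade a = R)" for R
    have "cl (swap_pos {}) a = h (shade a)" if a: "a \<in> arcs K" for a
    proof -
      have "(SOME b. b \<in> arcs K \<and> shade b = shade a) \<in> arcs K \<and> shade (SOME b. b \<in> arcs K \<and> shade b = shade a) = shade a"
        using someI[of "\<lambda>b. b \<in> arcs K \<and> shade b = shade a" a] a by simp
      then have "(a, SOME b. b \<in> arcs K \<and> shade b = shade a) \<in> EE (swap_pos {})"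
        using circles_none[OF a] by simp
      then show ?thesis unfolding h_def cl_eq_iff .
    qed
    then show "circ (swap_pos {}) \<subseteq> h ` shade ` arcs K" by auto
  qed
  also have "\<dots> \<le> card S" by (rule card_mono) (use finite_S shade_in in auto)
  finally show ?thesis using MG.components_empty by (simp add: excess_def T_simps)
qed

text \<open>Dually to \<open>excess_none\<close>, there is at least one circle for each unshaded
  region, of which genus zero provides \<open>nc + 2 - card S\<close>; the full Tait graph has one
  component.\<close>

lemma excess_all: "excess {..<nc} \<ge> 0"
proof -
  have "card (regions K - S) \<le> card (circ (swap_pos {..<nc}))"
  proof (rule surj_card_le)
    show "finite (circ (swap_pos {..<nc}))" by (simp add: arcs_def)
    define h where "h C = unshade (SOME a. a \<in> C)" for C
    have "unshade a = h (cl (swap_pos {..<nc}) a)" for a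
    proof -
      have "(SOME b. b \<in> cl (swap_pos {..<nc}) a) \<in> cl (swap_pos {..<nc}) a"
        by (rule someI[of _ a]) (simp add: links_refl)
      then show ?thesis unfolding h_def by (intro circles_all) simp
    qed
    then show "regions K - S \<subseteq> h ` circ (swap_pos {..<nc})" using unshade_surj by (fastforce simp: image_iff)
  qed
  moreover have "card (regions K - S) = nc + 2 - card S"
    using diagram card_Diff_subset[OF finite_S S_subset] by (simp add: knot_diagram_def)
  moreover have "card S \<le> nc + 2"
    using diagram card_mono[OF finite_regions S_subset] by (simp add: knot_diagram_def)
  moreover have "MG.components {..<nc} \<le> 1"
  proof -
    have "(\<lambda>a. MG.L {..<nc} `` {a}) ` S \<subseteq> {MG.L {..<nc} `` {shade 0}}"
      using T_connected class_eq_iff[OF MG.equiv_L] shade_in[OF base_A] by blast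
    then show ?thesis unfolding MG.components_def T_simps by (metis card_mono finite.emptyI finite_insert is_singletonI is_singleton_altdef)
  qed
  ultimately show ?thesis by (simp add: excess_def)
qed

lemma excess_mono:
  assumes "finite X" "X \<subseteq> {..<nc} - H" "H \<subseteq> {..<nc}"
  shows "excess (H \<union> X) \<le> excess H"
  using assms(1,2)
proof (induction X rule: finite_induct)
  case (insert c X)
  have "finite H" using assms(3) finite_subset by blast
  then have "excess (insert c (H \<union> X)) \<le> excess (H \<union> X)"
    using insert excess_insert[of c "H \<union> X"] by auto
  then show ?case using insert by auto
qed simp

text \<open>The excess never grows as edges are added, starts at 0 or below and ends at 0 or
  above.\<close>

lemma excess_0:
  assumes "H \<subseteq> {..<nc}"
  shows "excess H = 0"
proof -
  have "finite H" using assms finite_subset by blast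
  then have "excess H \<le> excess {}" using excess_mono[of H "{}"] assms by simp
  moreover have "excess {..<nc} \<le> excess H"
    using excess_mono[of "{..<nc} - H" H] assms by (simp add: Un_absorb1)
  ultimately show ?thesis using excess_none excess_all by simp
qed

lemma linked_circles_iff:
  assumes "H \<subseteq> {..<nc}" "c < nc" "c \<notin> H"
  shows "(arc_at K c 0, arc_at K c 2) \<in> EE (swap_pos H) \<longleftrightarrow> (tu c, tv c) \<in> MG.L H"
proof -
  have "finite H" using assms finite_subset by blast
  then have "\<not> ((tu c, tv c) \<in> MG.L H \<and> (arc_at K c 0, arc_at K c 2) \<notin> EE (swap_pos H))"
  proof -
    have "excess (insert c H) = 0" using excess_0[of "insert c H"] assms by simp
    then have "(if (tu c, tv c) \<in> MG.L H \<and> (arc_at K c 0, arc_at K c 2) \<notin> EE (swap_pos H) then 2 else 0) = (0::int)"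
      using excess_insert[OF assms(2,3) \<open>finite H\<close>] excess_0[OF assms(1)] by linarith
    then show ?thesis by presburger
  qed
  moreover have "(tu c, tv c) \<in> MG.L H" if "(arc_at K c 0, arc_at K c 2) \<in> EE (swap_pos H)"
    using shade_links[OF that] by (simp add: tu_def tv_def)
  ultimately show ?thesis by blast
qed

text \<open>With \<open>c\<close> removed, its ends are linked exactly if it is externally live,
  since an internally live edge is not linked by the others. Putting \<open>c\<close> back reverses
  the state of its circles by \<open>xor_flip\<close>.\<close>

lemma live_linked_iff:
  assumes "H \<subseteq> {..<nc}" "c \<in> MG.live H"
  shows "(arc_at K c 0, arc_at K c 2) \<in> EE (swap_pos H) \<longleftrightarrow> (c \<in> H \<longleftrightarrow> \<not> MG.ext H c)"
proof -
  have c: "c < nc" using assms(2) by (simp add: MG.live_def T_simps)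
  have H': "H - {c} \<subseteq> {..<nc}" "c \<notin> H - {c}" using assms(1) by auto
  have L: "(tu c, tv c) \<in> MG.L (H - {c}) \<longleftrightarrow> MG.ext H c"
  proof
    assume "(tu c, tv c) \<in> MG.L (H - {c})"
    then have "\<not> MG.int_live H c"
      using MG.L_monoD MG.above_below[of H c] assms(1) unfolding MG.int_live_def T_simps by blast
    then show "MG.ext H c" using assms(2) by (simp add: MG.live_def)
  next
    assume "MG.ext H c"
    then show "(tu c, tv c) \<in> MG.L (H - {c})"
      unfolding MG.ext_def by (rule MG.L_monoD) (auto simp: MG.above_def)
  qed
  have "H = H - {c} \<or> H = flip c (H - {c})" by (auto simp: flip_def)
  then show ?thesis
    using linked_circles_iff[OF H'(1) c H'(2)] L xor_flip[OF c, of "swap_pos (H - {c})"]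
      swap_pos_flip[OF c, of "H - {c}"] by (cases "c \<in> H") auto
qed

lemma card_circ:
  "H \<subseteq> {..<nc} \<Longrightarrow> int (card (circ (swap_pos H))) = int (card H) + 2 * int (MG.components H) - int (card S)"
  using excess_0[of H] by (simp add: excess_def)

lemma connected_components:
  assumes "\<And>a b. a \<in> S \<Longrightarrow> b \<in> S \<Longrightarrow> (a, b) \<in> MG.L H"
  shows "MG.components H = 1"
proof -
  have "(\<lambda>a. MG.L H `` {a}) ` S = {MG.L H `` {shade 0}}"
  proof (intro equalityI subsetI)
    fix C assume "C \<in> (\<lambda>a. MG.L H `` {a}) ` S"
    then obtain a where a: "a \<in> S" "C = MG.L H `` {a}" by blast
    have "MG.L H `` {a} = MG.L H `` {shade 0}"
      using assms[OF a(1) shade_in[OF base_A]] by (rule iffD2[OF class_eq_iff[OF MG.equiv_L]])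
    then show "C \<in> {MG.L H `` {shade 0}}" using a(2) by simp
  qed (use shade_in[OF base_A] in auto)
  then show ?thesis by (simp add: MG.components_def T_simps)
qed

lemma spanning_tree_card:
  assumes "spanning_tree T H"
  shows "card H + 1 = card S"
  using MG.components_forest[of H] connected_components[of H] assms
  unfolding MG.spanning_tree_iff by (simp add: T_simps)

definition live_crossings :: "nat set \<Rightarrow> nat set" where
  "live_crossings B = MG.live (swap_pos B)"

definition dead_B :: "nat set \<Rightarrow> nat set" where
  "dead_B B = {c. c < nc \<and> c \<in> B \<and> c \<notin> live_crossings B}"

section \<open>Live crossings of the diagram\<close>

lemma sum_powers_less: "finite X \<Longrightarrow> X \<subseteq> {..<c} \<Longrightarrow> (\<Sum>e\<in>X. 2 ^ e) < (2::nat) ^ c"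
proof -
  assume "finite X" "X \<subseteq> {..<c}"
  then have "(\<Sum>e\<in>X. 2 ^ e) \<le> (\<Sum>e<c. (2::nat) ^ e)" by (intro sum_mono2) auto
  also have "\<dots> < 2 ^ c" by (induction c) auto
  finally show ?thesis .
qed

lemma smoothing_restrict: "smoothing K B = smoothing K (B \<inter> {..<nc})"
  by (auto simp: smoothing_def)

sublocale LC: live_circles nc "arcs K" "\<lambda>B. links (smoothing K B)" "\<lambda>c. arc_at K c 0" "\<lambda>c. arc_at K c 2" 0
  live_crossings "\<lambda>B. \<Sum>c \<in> dead_B B. 2 ^ c"
proof
  have sub: "swap_pos B \<subseteq> edges T" for B using swap_pos_subset by (simp add: T_simps)
  \<comment> \<open>\<open>B\<close> may contain numbers that are no crossings;
    \<open>swap_pos\<close> drops them, and the smoothing ignores them.\<close>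
  have sp: "EE B = EE (swap_pos (swap_pos B))" for B
    by (subst smoothing_restrict, rule arg_cong[where f = "\<lambda>B. links (smoothing K B)"]) (auto simp: swap_pos_def)
  show less: "e < nc" if "e \<in> live_crossings B" for e B
    using that by (simp add: live_crossings_def MG.live_def T_simps)
  show U_flip: "live_crossings (flip e B) = live_crossings B" if "e \<in> live_crossings B" for e B
    using MG.live_flip(2)[OF _ sub] that swap_pos_flip[OF less[OF that], of B] by (simp add: live_crossings_def)
  show "(\<Sum>c \<in> dead_B (flip e B). 2 ^ c) = (\<Sum>c \<in> dead_B B. (2::nat) ^ c)" if "e \<in> live_crossings B" for e B
  proof -
    have "dead_B (flip e B) = dead_B B"
      using that unfolding dead_B_def U_flip[OF that] by (auto simp: in_flip_iff split: if_splits)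
    then show ?thesis by simp
  qed
  show "(\<Sum>e \<in> dead_B B. 2 ^ e) < (\<Sum>e \<in> dead_B (flip c B). (2::nat) ^ e)"
    if c: "c < nc" "c \<notin> B" "c \<notin> live_crossings B" for c B
  proof -
    \<comment> \<open>Crossings from \<open>c\<close> upwards keep their liveness, so
      \<open>c\<close> contributes a new binary digit; the smaller digits may change, but amount to
      less than \<open>2 ^ c\<close>.\<close>
    have live: "e \<in> live_crossings (flip c B) \<longleftrightarrow> e \<in> live_crossings B" if "c \<le> e" for e
      using MG.live_above[OF that] swap_pos_flip[OF c(1), of B] by (simp add: live_crossings_def)
    define X where "X = dead_B B \<inter> {c<..}"
    have fin: "finite (dead_B B')" for B' by (simp add: dead_B_def)
    have 1: "dead_B B = X \<union> (dead_B B \<inter> {..<c})"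
    proof -
      have "e < c \<or> c < e" if "e \<in> dead_B B" for e
        using that c by (cases e c rule: linorder_cases) (auto simp: dead_B_def)
      then show ?thesis by (auto simp: X_def)
    qed
    have 2: "insert c X \<subseteq> dead_B (flip c B)"
    proof
      fix e assume "e \<in> insert c X"
      then consider "e = c" | "e \<noteq> c" "e \<in> dead_B B" "c < e" by (auto simp: X_def)
      then show "e \<in> dead_B (flip c B)"
      proof cases
        case 1
        then show ?thesis using c live[of c] by (simp add: dead_B_def flip_def)
      next
        case 2
        then show ?thesis using live[of e] by (simp add: dead_B_def flip_def)
      qed
    qed
    define Y where "Y = dead_B B \<inter> {..<c}"
    have Y: "finite Y" "Y \<subseteq> {..<c}"
      unfolding Y_def by (rule finite_Int, rule disjI1, rule fin) (rule Int_lower2)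
    have X: "finite X" "c \<notin> X" unfolding X_def by (rule finite_Int, rule disjI1, rule fin) simp
    have XY: "X \<inter> Y = {}" unfolding X_def Y_def by force
    have "sum ((^) (2::nat)) (dead_B B) = sum ((^) 2) (X \<union> Y)"
      unfolding Y_def by (rule arg_cong[OF 1])
    also have "\<dots> = sum ((^) 2) X + sum ((^) 2) Y"
      using X(1) Y(1) XY by (rule sum.union_disjoint)
    also have "\<dots> < 2 ^ c + sum ((^) (2::nat)) X" using sum_powers_less[OF Y] by linarith
    also have "\<dots> = sum ((^) (2::nat)) (insert c X)" using X by (rule sum.insert[symmetric])
    also have "\<dots> \<le> (\<Sum>e \<in> dead_B (flip c B). 2 ^ e)" by (rule sum_mono2[OF fin 2]) simp
    finally show ?thesis .
  qed
  have linked: "(arc_at K g 0, arc_at K g 2) \<in> EE B \<longleftrightarrow> (g \<in> swap_pos B \<longleftrightarrow> \<not> MG.ext (swap_pos B) g)"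
    if "g \<in> live_crossings B" for g B
    using live_linked_iff[OF swap_pos_subset, of g B] that sp[of B] by (simp add: live_crossings_def)
  show "(arc_at K g 0, arc_at K g 2) \<in> EE (flip e B) \<longleftrightarrow> (arc_at K g 0, arc_at K g 2) \<in> EE B"
    if eg: "e \<in> live_crossings B" "g \<in> live_crossings B" "e \<noteq> g" for e g B
  proof -
    have "g \<in> live_crossings (flip e B)" using U_flip eg by simp
    moreover have "MG.ext (swap_pos (flip e B)) g \<longleftrightarrow> MG.ext (swap_pos B) g"
      using MG.live_flip(1)[OF _ sub, of e B g] eg(1) less[OF eg(2)] swap_pos_flip[OF less[OF eg(1)], of B]
      by (simp add: live_crossings_def T_simps)
    ultimately show ?thesis
      using linked[of g "flip e B"] linked[OF eg(2)] eg(3) swap_pos_flip[OF less[OF eg(1)], of B]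
      by (simp add: in_flip_iff)
  qed
  show "(a, b) \<in> EE B" if all: "\<And>e. e \<in> live_crossings B \<Longrightarrow> (arc_at K e 0, arc_at K e 2) \<in> EE B"
    and ab: "a \<in> arcs K" "b \<in> arcs K" for a b B
  proof -
    have "MG.unflipped (swap_pos B)"
      using all linked by (auto simp: MG.unflipped_def live_crossings_def)
    then have tree: "spanning_tree T (swap_pos B)"
      using MG.unflipped_iff_spanning_tree[OF sub] T_connected by (simp add: T_simps)
    then have "MG.components (swap_pos B) = 1"
      using connected_components unfolding MG.spanning_tree_iff by (simp add: T_simps)
    \<comment> \<open>The count of circles is \<open>card H + 2 - card S\<close> for a connected
      \<open>H\<close>, and a tree has \<open>card S - 1\<close> edges.\<close>
    then have "card (circ B) = 1"
      using card_circ[OF swap_pos_subset, of B] spanning_tree_card[OF tree] sp[of B] by simp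
    then obtain C where "circ B = {C}" by (rule card_1_singletonE)
    then have "cl B a \<in> {C}" "cl B b \<in> {C}" using ab by (metis imageI)+
    then have "cl B a = cl B b" by simp
    then show ?thesis using cl_eq_iff by simp
  qed
qed

end

section \<open>The spanning tree complex\<close>

context coloured_diagram
begin

lemma live_crossings_swap_pos: "H \<subseteq> {..<nc} \<Longrightarrow> live_crossings (swap_pos H) = MG.live H"
  by (simp add: live_crossings_def swap_pos_swap_pos)

lemma swap_pos_trees: "H \<subseteq> {..<nc} \<Longrightarrow> swap_pos H \<in> LC.trees \<longleftrightarrow> spanning_tree T H"
proof -
  assume H: "H \<subseteq> {..<nc}"
  have "swap_pos H \<in> LC.trees \<longleftrightarrow> (\<forall>c \<in> MG.live H. (arc_at K c 0, arc_at K c 2) \<in> EE (swap_pos H))"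
    using swap_pos_subset by (auto simp: LC.trees_def LC.Fl_def live_crossings_swap_pos[OF H])
  also have "\<dots> \<longleftrightarrow> MG.unflipped H"
    using live_linked_iff[OF H] by (simp add: MG.unflipped_def)
  also have "\<dots> \<longleftrightarrow> spanning_tree T H"
    using MG.unflipped_iff_spanning_tree[of H] T_connected H by (simp add: T_simps)
  finally show ?thesis .
qed

lemma spanning_tree_subset: "spanning_tree T H \<Longrightarrow> H \<subseteq> {..<nc}"
  by (simp add: spanning_tree_def T_simps)

lemma bij_swap_pos: "bij_betw swap_pos {H. spanning_tree T H} LC.trees"
proof (rule bij_betw_byWitness[where f' = swap_pos])
  show "\<forall>H \<in> {H. spanning_tree T H}. swap_pos (swap_pos H) = H"
    using swap_pos_swap_pos spanning_tree_subset by blast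
  have trees: "R \<subseteq> {..<nc}" if "R \<in> LC.trees" for R using that by (simp add: LC.trees_def)
  show "\<forall>R \<in> LC.trees. swap_pos (swap_pos R) = R" using swap_pos_swap_pos trees by blast
  show "swap_pos ` {H. spanning_tree T H} \<subseteq> LC.trees" using swap_pos_trees spanning_tree_subset by blast
  show "swap_pos ` LC.trees \<subseteq> {H. spanning_tree T H}"
  proof
    fix H assume "H \<in> swap_pos ` LC.trees"
    then obtain R where R: "R \<in> LC.trees" "H = swap_pos R" by blast
    then have "swap_pos H = R" using swap_pos_swap_pos trees by simp
    then show "H \<in> {H. spanning_tree T H}" using R swap_pos_trees[OF swap_pos_subset, of R] by simp
  qed
qed

text \<open>In the smoothing of a tree, positive internally and negative externally active edges are
  A-smoothed, the other active ones B-smoothed. So \<open>tree_u\<close> counts live A-smoothings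
  minus live B-smoothings.\<close>

lemma tree_u_live:
  assumes "spanning_tree T H"
  shows "tree_u T H = int (card (MG.live H - swap_pos H)) - int (card (MG.live H \<inter> swap_pos H))"
proof -
  have live: "e < nc" if "e \<in> MG.live H" for e using that by (simp add: MG.live_def T_simps)
  have H: "e < nc" if "e \<in> H" for e using that spanning_tree_subset[OF assms] by auto
  note act = MG.internally_active_iff[OF assms] MG.externally_active_iff[OF assms]
  let ?X = "\<lambda>a b. {e \<in> MG.live H. (pos_edge T e \<longleftrightarrow> a) \<and> (e \<in> H \<longleftrightarrow> b)}"
  have sets: "{e \<in> edges T. pos_edge T e \<and> internally_active T H e} = ?X True True"
    "{e \<in> edges T. pos_edge T e \<and> externally_active T H e} = ?X True False"
    "{e \<in> edges T. \<not> pos_edge T e \<and> internally_active T H e} = ?X False True"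
    "{e \<in> edges T. \<not> pos_edge T e \<and> externally_active T H e} = ?X False False"
    unfolding act T_simps using live by auto
  have fin: "finite (MG.live H)" using live by (meson finite_nat_iff_bounded lessThan_iff subsetI)
  have "MG.live H - swap_pos H = ?X True True \<union> ?X False False"
    "MG.live H \<inter> swap_pos H = ?X True False \<union> ?X False True"
    using live by (auto simp: swap_pos_def)
  moreover have "card (?X True True \<union> ?X False False) = card (?X True True) + card (?X False False)"
    "card (?X True False \<union> ?X False True) = card (?X True False) + card (?X False True)"
    by (rule card_Un_disjoint; use fin in auto)+
  ultimately show ?thesis unfolding tree_u_def sets by simp
qed

text \<open>The B-smoothings are at the positive edges off the tree, \<open>E_plus - v\<close> in
  number, and at the negative edges of the tree, \<open>card S - 1 - v\<close> in number.\<close>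

lemma card_swap_pos:
  assumes "spanning_tree T H"
  shows "int (card (swap_pos H)) = int (E_plus T) + int (card S) - 1 - 2 * tree_v T H"
proof -
  have H: "H \<subseteq> {..<nc}" using assms by (rule spanning_tree_subset)
  let ?X = "\<lambda>a b. {e. e < nc \<and> (pos_edge T e \<longleftrightarrow> a) \<and> (e \<in> H \<longleftrightarrow> b)}"
  have "swap_pos H = ?X True False \<union> ?X False True" "{e \<in> edges T. pos_edge T e} = ?X True True \<union> ?X True False"
    "H = ?X True True \<union> ?X False True" "{e \<in> H. pos_edge T e} = ?X True True"
    using H by (auto simp: swap_pos_def T_simps)
  moreover have "card (?X True False \<union> ?X False True) = card (?X True False) + card (?X False True)"
    "card (?X True True \<union> ?X True False) = card (?X True True) + card (?X True False)"
    "card (?X True True \<union> ?X False True) = card (?X True True) + card (?X False True)"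
    by (rule card_Un_disjoint; auto)+
  ultimately have "card (swap_pos H) = card (?X True False) + card (?X False True)"
    "E_plus T = card (?X True True) + card (?X True False)"
    "card H = card (?X True True) + card (?X False True)"
    "tree_v T H = int (card (?X True True))"
    unfolding E_plus_def tree_v_def by metis+
  then show ?thesis using spanning_tree_card[OF assms] by linarith
qed

lemma E_plus_minus: "E_plus T + E_minus T = nc"
proof -
  have "card ({e \<in> edges T. pos_edge T e} \<union> {e \<in> edges T. \<not> pos_edge T e}) = E_plus T + E_minus T"
    unfolding E_plus_def E_minus_def by (rule card_Un_disjoint) (auto simp: T_simps)
  moreover have "{e \<in> edges T. pos_edge T e} \<union> {e \<in> edges T. \<not> pos_edge T e} = {..<nc}" by (auto simp: T_simps)
  ultimately show ?thesis by simp
qed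

definition negative_crossings :: int where
  "negative_crossings = int (card {c. c < nc \<and> \<not> pos_crossing K c})"

section \<open>Comparison of the degrees\<close>

lemma writhe_eq: "writhe K = int nc - 2 * negative_crossings"
proof -
  have "card ({c. c < nc \<and> pos_crossing K c} \<union> {c. c < nc \<and> \<not> pos_crossing K c}) =
      card {c. c < nc \<and> pos_crossing K c} + card {c. c < nc \<and> \<not> pos_crossing K c}"
    by (rule card_Un_disjoint) auto
  moreover have "{c. c < nc \<and> pos_crossing K c} \<union> {c. c < nc \<and> \<not> pos_crossing K c} = {..<nc}" by auto
  ultimately show ?thesis by (simp add: writhe_def negative_crossings_def)
qed

lemma based_states_iff: "(B, P) \<in> LC.based_states \<longleftrightarrow> (B, P) \<in> enhanced_states K \<and> base_plus (B, P)"
proof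
  assume "(B, P) \<in> LC.based_states"
  then obtain Q where Q: "B \<subseteq> {..<nc}" "sat B Q" "0 \<in> Q" "P = cls B Q"
    by (auto simp: LC.based_states_def st_def)
  then have "P \<subseteq> circ B" using sat_subset by (metis image_mono)
  moreover have "0 \<in> \<Union> P" using Q sat_Union by simp
  ultimately show "(B, P) \<in> enhanced_states K \<and> base_plus (B, P)"
    using Q(1) by (auto simp: enhanced_states_def base_plus_def circles_eq)
next
  assume "(B, P) \<in> enhanced_states K \<and> base_plus (B, P)"
  then have P: "B \<subseteq> {..<nc}" "P \<subseteq> circ B" "0 \<in> \<Union> P"
    by (auto simp: enhanced_states_def base_plus_def circles_eq)
  then show "(B, P) \<in> LC.based_states"
    using states_sat[OF P(2)] unfolding LC.based_states_def st_def by blast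
qed

lemma has_degree_iff:
  assumes "(B, P) \<in> enhanced_states K"
  shows "has_degree K (B, P) p \<longleftrightarrow> LC.degree (- negative_crossings) (writhe K) (B, P) = p"
proof -
  have B: "B \<subseteq> {..<nc}" "P \<subseteq> circ B" using assms by (auto simp: enhanced_states_def circles_eq)
  have fin: "finite B" "finite P" using finite_subset[OF B(1)] finite_subset[OF B(2)] finite_A by simp_all
  have "int (card ({..<nc} - B)) = int nc - int (card B)"
    using card_Diff_subset[OF fin(1) B(1)] card_mono[OF _ B(1)] by simp
  moreover have "int (card (circ B - P)) = int (card (circ B)) - int (card P)"
    using card_Diff_subset[OF fin(2) B(2)] card_mono[OF _ B(2)] finite_A by simp
  moreover obtain i j where "p = (i, j)" by (cases p)
  ultimately show ?thesis
    unfolding has_degree_def state_sigma_def state_tau_def LC.degree_def circles_eq writhe_eq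
    by auto
qed

lemma reduced_khovanov_group_eq: "reduced_khovanov_group K =
  (\<lambda>p. free_Abelian_group {s \<in> LC.based_states. LC.degree (- negative_crossings) (writhe K) s = p})"
proof
  fix p
  have "{s \<in> enhanced_states K. has_degree K s p \<and> base_plus s} =
      {s \<in> LC.based_states. LC.degree (- negative_crossings) (writhe K) s = p}"
  proof (rule Set.set_eqI)
    fix s :: enhanced_state
    obtain B P where "s = (B, P)" by (cases s)
    then show "s \<in> {s \<in> enhanced_states K. has_degree K s p \<and> base_plus s} \<longleftrightarrow>
        s \<in> {s \<in> LC.based_states. LC.degree (- negative_crossings) (writhe K) s = p}"
      using based_states_iff[of B P] has_degree_iff[of B P p] by auto
  qed
  then show "reduced_khovanov_group K p =
      free_Abelian_group {s \<in> LC.based_states. LC.degree (- negative_crossings) (writhe K) s = p}"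
    by (simp add: reduced_khovanov_group_def)
qed

lemma khovanov_diff_eq: "khovanov_diff K = diff"
  by (simp add: khovanov_diff_def diff_def resolve_map_eq)

definition shift :: "int \<Rightarrow> int \<times> int \<Rightarrow> int \<times> rat" where
  "shift k = (\<lambda>(i, j). (j - i - writhe K + 1, of_int j / 2 - of_int i - of_int (writhe K - k - 2) / 4))"

text \<open>The differences \<open>j - i\<close> and \<open>j / 2 - i\<close> differ by
  \<open>j / 2\<close>, so they determine both degrees.\<close>

lemma inj_shift: "inj (shift k)"
proof (rule injI)
  fix p q :: "int \<times> int"
  assume eq: "shift k p = shift k q"
  obtain i j i' j' where p: "p = (i, j)" "q = (i', j')" by (cases p, cases q)
  have 1: "j - i = j' - i'" using eq p by (simp add: shift_def)
  then have "(of_int j :: rat) - of_int i = of_int j' - of_int i'" by (metis of_int_diff)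
  moreover have "(of_int j :: rat) / 2 - of_int i = of_int j' / 2 - of_int i'" using eq p by (simp add: shift_def)
  ultimately have "(of_int j :: rat) = of_int j'" by linarith
  then show "p = q" using 1 p by simp
qed

lemma shift_plus: "shift k (p + (1, 0)) = shift k p + (-1, -1)"
  by (cases p) (simp add: shift_def)

text \<open>Flipping all live crossings adds \<open>tree_u\<close> to the number of B-smoothings,
  and \<open>state_tau\<close> becomes \<open>1 - tree_u\<close>, which gives the first component.
  The constant \<open>k\<close> is what makes the second one equal \<open>tree_v\<close>.\<close>

lemma shift_critical_state:
  assumes H: "spanning_tree T H" and k: "k = int (E_plus T) - int (E_minus T) + 2 * (int (card S) - 1)"
  shows "shift k (LC.degree (- negative_crossings) (writhe K) (LC.critical_state (swap_pos H))) =
    (tree_u T H, of_int (tree_v T H))"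
proof -
  let ?R = "swap_pos H" and ?U = "MG.live H"
  have R: "?R \<in> LC.trees" using swap_pos_trees[OF spanning_tree_subset[OF H]] H by simp
  have U: "live_crossings ?R = ?U" by (rule live_crossings_swap_pos[OF spanning_tree_subset[OF H]])
  define b where "b = int (card (LC.all_flipped ?R))"
  define u where "u = tree_u T H"
  have fin: "finite ?R" "finite ?U"
    using swap_pos_subset finite_subset[of ?R "{..<nc}"] LC.finite_U[of ?R] U by auto
  have "LC.all_flipped ?R = (?R - ?U) \<union> (?U - ?R)" by (auto simp: LC.all_flipped_def flips_def U)
  moreover have "card ((?R - ?U) \<union> (?U - ?R)) = card (?R - ?U) + card (?U - ?R)"
    by (rule card_Un_disjoint) (use fin in auto)
  moreover have "card ?R = card (?R - ?U) + card (?U \<inter> ?R)"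
    using card_Diff_subset_Int[of ?R ?U] card_mono[OF fin(1), of "?R \<inter> ?U"] fin by (simp add: Int_commute)
  ultimately have b: "b = int (card ?R) + u" by (simp add: b_def u_def tree_u_live[OF H])
  have deg: "LC.degree (- negative_crossings) (writhe K) (LC.critical_state ?R) =
      (- negative_crossings + b, - negative_crossings + b + writhe K - 1 + u)"
    using LC.card_critical[OF R]
    by (simp add: LC.critical_state_def st_def LC.degree_def b_def u_def tree_u_live[OF H] U)
  define v where "v = tree_v T H"
  \<comment> \<open>Four times the formula for \<open>v\<close>, to stay in the integers. It reduces
    to \<open>nc - 2 * card (swap_pos H) + k\<close>, and \<open>card_swap_pos\<close> leaves
    \<open>4 * v\<close>.\<close>
  have "2 * (- negative_crossings + b + writhe K - 1 + u) - 4 * (- negative_crossings + b) - (writhe K - k - 2) = 4 * v"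
    using b card_swap_pos[OF H] E_plus_minus k writhe_eq by (simp add: v_def)
  then have "rat_of_int (2 * (- negative_crossings + b + writhe K - 1 + u) - 4 * (- negative_crossings + b) - (writhe K - k - 2)) =
      rat_of_int (4 * v)" by (rule arg_cong)
  then have "rat_of_int (- negative_crossings + b + writhe K - 1 + u) / 2 - rat_of_int (- negative_crossings + b)
      - rat_of_int (writhe K - k - 2) / 4 = rat_of_int v"
    by (simp add: field_simps)
  then show ?thesis unfolding deg shift_def by (simp add: u_def v_def)
qed

theorem tree_complex:
  assumes k: "k = int (E_plus T) - int (E_minus T) + 2 * (int (card S) - 1)"
  shows "\<exists>D. deformation_retract (shift k) (-1, -1) (tree_group T) D
    (1, 0) (reduced_khovanov_group K) (\<lambda>_. khovanov_diff K)"
proof -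
  interpret M: acyclic_matching LC.based_states "LC.degree (- negative_crossings) (writhe K)" "(1, 0)" diff
    LC.lower LC.upper LC.partner LC.state_rank
    by (rule LC.acyclic_matching)
  have crit: "bij_betw (LC.critical_state \<circ> swap_pos) {H. spanning_tree T H} M.critical"
    using bij_betw_trans[OF bij_swap_pos LC.bij_critical_state] by simp
  have group: "tree_group T =
      (\<lambda>q. free_Abelian_group {H \<in> {H. spanning_tree T H}. (tree_u T H, of_int (tree_v T H)) = q})"
    by (intro ext) (simp add: tree_group_def split: prod.split)
  show ?thesis
    unfolding group khovanov_diff_eq reduced_khovanov_group_eq
    by (rule M.deformation_retract_critical[OF crit _ inj_shift shift_plus])
      (simp add: shift_critical_state[OF _ k])
qed

end

theorem theorem3:
  fixes K :: knot_code and S :: "region set" and G :: "(region, nat) signed_graph" and w k :: int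
  assumes "knot_diagram K"
    and "checkerboard K S"
    and "G = tait_graph K S"
    and "E_plus G \<ge> E_minus G"
    and "w = writhe K"
    and "k = int (E_plus G) - int (E_minus G) + 2 * (int (card (verts G)) - 1)"
  shows "\<exists>d :: int \<times> rat \<Rightarrow> (nat set \<Rightarrow>\<^sub>0 int) \<Rightarrow> (nat set \<Rightarrow>\<^sub>0 int).
     chain_complex (-1, -1) (tree_group G) d \<and>
     deformation_retract
       (\<lambda>(i, j). (j - i - w + 1, of_int j / 2 - of_int i - of_int (w - k - 2) / 4))
       (-1, -1) (tree_group G) d
       (1, 0) (reduced_khovanov_group K) (\<lambda>_. khovanov_diff K) \<and>
     (\<forall>(i :: int) (j :: int) (u :: int) (v :: rat).
        u = j - i - w + 1 \<longrightarrow>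
        v = of_int j / 2 - of_int i - of_int (w - k - 2) / 4 \<longrightarrow>
        homology (1, 0) (reduced_khovanov_group K) (\<lambda>_. khovanov_diff K) (i, j)
          \<cong> homology (-1, -1) (tree_group G) d (u, v))"
proof -
  interpret coloured_diagram K S using assms(1,2) by unfold_locales
  have "k = int (E_plus (tait_graph K S)) - int (E_minus (tait_graph K S)) + 2 * (int (card S) - 1)"
    using assms(3,6) by (simp add: T_simps)
  then obtain D where D: "deformation_retract (shift k) (-1, -1) (tree_group (tait_graph K S)) D
      (1, 0) (reduced_khovanov_group K) (\<lambda>_. khovanov_diff K)"
    using tree_complex by blast
  then have "chain_complex (-1, -1) (tree_group (tait_graph K S)) D"
    by (simp add: deformation_retract_def)
  moreover have "homology (1, 0) (reduced_khovanov_group K) (\<lambda>_. khovanov_diff K) (i, j)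
      \<cong> homology (-1, -1) (tree_group (tait_graph K S)) D (shift k (i, j))" for i j
    by (rule homology_deformation_retract[OF D])
  ultimately show ?thesis
    using D unfolding assms(3,5) shift_def by (intro exI[of _ D]) simp
qed

end
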